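(* Let $n$ be an odd positive integer not dividing $3$, let $r$ be an integer with $(n+1)/2\le r\le n-1$, and let $$f_{n,r}=\eta^4K^{\frac rn-\frac23}\,{}_3F_2\Big(\frac rn-\frac23,\frac rn-\frac13,\frac rn;\frac{3r}{2n},\frac{3r}{2n}-\frac12;K\Big).$$ Let $N=2n$, $q_N=e^{2\pi i\tau/N}$, and write $f_{n,r}=\sum_{m\ge1}a_mq_N^m$. Then for every prime $p\equiv-1\pmod n$ and every $m\ge1$, $$a_{p^2m}+pa_m\equiv0\pmod{p^{2+v_p(m)}}.$$
   Context: $\eta=q^{1/24}\prod_{m\ge1}(1-q^m)$, $q=e^{2\pi i\tau}$; $K=1728/j$ with $j$ the modular $j$-invariant, so $K=1728q(1-744q+\cdots)$, and for rational $s$, $K^s:=1728^sq^s(1-744q+\cdots)^s$ (binomial series, $1728^s>0$). ${}_3F_2(a_1,a_2,a_3;b_1,b_2;z)=\sum_{m\ge0}\frac{(a_1)_m(a_2)_m(a_3)_m}{(b_1)_m(b_2)_m\,m!}z^m$. The form $f_{n,r}$ is a weight-2 cusp form on $H_0=\langle\bar U^n\rangle\bar\Gamma_0(2)'$, $U=\begin{pmatrix}1&0\\2&1\end{pmatrix}$. $v_p$ is the $p$-adic valuation; a congruence $x\equiv0\pmod{p^e}$ for algebraic $x$ means $x/p^e$ is integral at all primes above $p$. *)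

theory Defs
  imports
    "HOL-Computational_Algebra.Computational_Algebra"
    "HOL-Number_Theory.Cong"
    "HOL-Algebra.Ideal"
    "HOL-Analysis.Analysis"
begin

text \<open>
  A pair \<open>(e, F)\<close> stands for the formal series \<open>q\<^sup>e F(q)\<close> with a rational exponent \<open>e\<close>.
  The representation is not unique, e.g. \<open>(e, q F)\<close> and \<open>(e + 1, F)\<close> stand for
  the same series; \<open>qser_coeff\<close> does not depend on the representative.
\<close>

type_synonym qseries = "rat \<times> complex fps"

definition qser_mult :: "qseries \<Rightarrow> qseries \<Rightarrow> qseries" where
  "qser_mult f g = (fst f + fst g, snd f * snd g)"

definition qser_power :: "qseries \<Rightarrow> nat \<Rightarrow> qseries" where
  "qser_power f k = (of_nat k * fst f, snd f ^ k)"

definition qser_of_fps :: "complex fps \<Rightarrow> qseries" where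
  "qser_of_fps F = (0, F)"

text \<open>The coefficient of \<open>q\<^sup>x\<close>.\<close>

definition qser_coeff :: "qseries \<Rightarrow> rat \<Rightarrow> complex" where
  "qser_coeff f x = (if x - fst f \<in> \<nat> then fps_nth (snd f) (nat \<lfloor>x - fst f\<rfloor>) else 0)"

text \<open>\<open>f = (\<Sum>m\<ge>1. a m * q\<^sub>N ^ m)\<close>, where \<open>q\<^sub>N = q powr (1 / N)\<close>.\<close>

definition has_qN_expansion :: "qseries \<Rightarrow> nat \<Rightarrow> (nat \<Rightarrow> complex) \<Rightarrow> bool" where
  "has_qN_expansion f N a \<longleftrightarrow>
     (\<forall>m\<ge>1. qser_coeff f (of_nat m / of_nat N) = a m) \<and>
     (\<forall>x. qser_coeff f x \<noteq> 0 \<longrightarrow> (\<exists>m\<ge>1. x = of_nat m / of_nat N))"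

text \<open>The infinite product is taken in the \<open>q\<close>-adic topology of the formal power series.\<close>

definition eta :: qseries where
  "eta = (1 / 24, \<Prod>m. 1 - fps_X ^ Suc m)"

definition E4 :: "complex fps" where
  "E4 = Abs_fps (\<lambda>k. if k = 0 then 1 else 240 * of_nat (\<Sum>d | d dvd k. d ^ 3))"

text \<open>\<open>\<Delta> = \<eta>\<^sup>2\<^sup>4\<close> has the integral leading exponent \<open>24 \<cdot> 1/24 = 1\<close>.\<close>

definition Delta :: "complex fps" where
  "Delta = fps_X * snd eta ^ 24"

definition j_inv :: "complex fls" where
  "j_inv = fps_to_fls (E4 ^ 3) / fps_to_fls Delta"

text \<open>\<open>1728 / j\<close> is a power series without constant term, so the regular part loses nothing.\<close>

definition K :: "complex fps" where
  "K = fls_regpart (1728 / j_inv)"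

text \<open>\<open>K / (1728 q) = 1 - 744 q + \<dots>\<close>\<close>

definition K_unit :: "complex fps" where
  "K_unit = fps_const (1 / 1728) * fps_shift 1 K"

definition K_powr :: "rat \<Rightarrow> qseries" where
  "K_powr s = (s, fps_const (complex_of_real (1728 powr of_rat s)) *
                  (fps_binomial (of_rat s) oo (K_unit - 1)))"

definition f_form :: "nat \<Rightarrow> int \<Rightarrow> qseries" where
  "f_form n r =
    (let t = of_int r / of_nat n :: rat;
         H = fps_hypergeo [of_rat (t - 2/3), of_rat (t - 1/3), of_rat t]
                          [of_rat (3/2 * t), of_rat (3/2 * t - 1/2)] 1
     in qser_mult (qser_mult (qser_power eta 4) (K_powr (t - 2/3))) (qser_of_fps (H oo K)))"

definition algebraic_integers :: "complex ring" where
  "algebraic_integers =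
     \<lparr>carrier = {x. algebraic_int x}, mult = (*), one = 1, zero = 0, add = (+)\<rparr>"

text \<open>
  The primes above \<open>p\<close> are taken in the ring of all algebraic integers; their restrictions to a
  number field containing \<open>x\<close> are exactly the primes above \<open>p\<close> of that field.
\<close>

definition prime_above :: "nat \<Rightarrow> complex set \<Rightarrow> bool" where
  "prime_above p P \<longleftrightarrow> primeideal P algebraic_integers \<and> of_nat p \<in> P"

text \<open>Membership in the localization at \<open>P\<close>.\<close>

definition integral_at :: "complex set \<Rightarrow> complex \<Rightarrow> bool" where
  "integral_at P x \<longleftrightarrow>
     (\<exists>a b. algebraic_int a \<and> algebraic_int b \<and> b \<notin> P \<and> x = a / b)"

definition alg_cong_0 :: "complex \<Rightarrow> nat \<Rightarrow> nat \<Rightarrow> bool" where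
  "alg_cong_0 x p e \<longleftrightarrow>
     algebraic x \<and> (\<forall>P. prime_above p P \<longrightarrow> integral_at P (x / of_nat p ^ e))"

end

(*
Let h = q prod (1 + q^m)^24 be the Hauptmodul of Gamma_0(2) and A = 2 E2(2 tau) - E2(tau) its
logarithmic derivative.  Then K = 1728 h / (1 + 256 h)^3 and eta^4 = h^(1/6) A (1 + 64 h)^(-1/2),
and a degenerate case of Bailey's cubic transformation evaluates the 3F2 at K as a power of
1 + 256 h.  Hence, with e = 2 r - n,
  f_{n,r} = 1728^(r/n - 2/3) h^(e/N) (1 + 64 h)^(-1/2) A,
that is, f_{n,r} dq/q is a constant times x^(e/N) (1 + 64 x)^(-1/2) dx/x at x = h.
In the parameter x^(1/N) the coefficients of this differential are explicit,
(-16)^k binomial(2k, k), and for them the congruence is elementary.  Its integral is thus of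
Honda type p + T^2, a property that is invariant under substitution of power series with p-integral
coefficients, such as h^(1/N) as a series in q_N.

The modular identities come from Liouville's elementary identity: it yields
E2^2 = E4 + 12 q dE2/dq and 5 A^2 = E4(tau) + 4 E4(2 tau), and together with the substitution
q -> -q these determine all quadratic relations between E2(tau), E2(2 tau), E2(4 tau).  The series
theta_a, theta_b, theta_c are the Lambert series of phi(q)^4, phi(-q)^4, 16 q psi(q^2)^4.
*)

theory Submission
  imports Defs "HOL-Number_Theory.Residues"
begin

unbundle fps_syntax
unbundle no vec_syntax

section \<open>Liouville's identity\<close>

text \<open>Since n and p are odd, p = -1 (mod n) lifts to p + 1 = N c. Multiplication by p
  exchanges the classes e and -e modulo N, and only multiplication by p^2 preserves the support of
  the expansion; hence the Honda element p + T^2. The passage from m = e + N k to p^2 m = e + N k'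
  goes through p m = N (k1 + 1) - e, where k1 = p k + (e c - 1) and k' = p k1 + (p - e c). The bound
  r <= n - 1 means e <= n - 2 and yields 2 e c < p: doubling the last base p digit of k1 causes no
  carry, doubling that of k' causes one. This carry supplies the factor p, and the parity of a
  number of units supplies the sign. The modulus has v_p(m) in it because the form is a derivative:
  if L is its integral, L(p^2 m) + L(m)/p is p-integral and gets multiplied by p^2 m.
  Finite-dimensionality of spaces of modular forms is never invoked. Identities come from linear
  combinations of Eisenstein relations, or from a first order equation for q d/dq, whose solution is
  fixed by one coefficient.\<close>

definition quads :: "nat \<Rightarrow> (nat \<times> nat \<times> nat \<times> nat) set" where
  "quads n = {(a, b, x, y). a > 0 \<and> b > 0 \<and> x > 0 \<and> y > 0 \<and> a * x + b * y = n}"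

lemma finite_quads: "finite (quads n)"
proof (rule finite_subset)
  show "quads n \<subseteq> {..n} \<times> {..n} \<times> {..n} \<times> {..n}"
  proof
    fix t assume "t \<in> quads n"
    then obtain a b x y where t: "t = (a, b, x, y)" "a > 0" "b > 0" "x > 0" "y > 0" "a * x + b * y = n"
      by (auto simp: quads_def)
    have "a \<le> a * x" "x \<le> a * x" "b \<le> b * y" "y \<le> b * y" using t by auto
    with t show "t \<in> {..n} \<times> {..n} \<times> {..n} \<times> {..n}"
      by (auto intro: trans_le_add1 trans_le_add2)
  qed
qed auto

text \<open>Each sum is cut by trichotomy, of a against b or of x against y. The bijections
  \<open>T1\<close>, \<open>T2\<close>, \<open>T3\<close> are steps of Euclid's algorithm on one
  pair with the compensating change of the other, so they preserve a x + b y. The open regions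
  cancel and only the diagonals a = b and x = y survive.\<close>

lemma liouville_identity:
  fixes F :: "int \<Rightarrow> 'a :: comm_ring_1"
  assumes even_F: "\<And>x. F (- x) = F x"
  shows "(\<Sum>(a, b, x, y) \<in> quads n. F (int a - int b) - F (int a + int b)) =
     (\<Sum>(a, b, x, y) \<in> {(a, b, x, y) \<in> quads n. a = b}. F 0 + 2 * F (int a))
     - (\<Sum>(a, b, x, y) \<in> {(a, b, x, y) \<in> quads n. x = y}. 2 * F (int a) + F (int a + int b))"
proof -
  define S where "S = (\<lambda>P (f :: nat \<Rightarrow> nat \<Rightarrow> 'a). \<Sum>(a, b, x, y) \<in> {(a, b, x, y) \<in> quads n. P a b x y}. f a b)"
  have split: "S (\<lambda>a b x y. True) f = S (\<lambda>a b x y. u a b x y < (v a b x y :: nat)) f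
      + S (\<lambda>a b x y. u a b x y = v a b x y) f + S (\<lambda>a b x y. v a b x y < u a b x y) f" for u v f
    unfolding S_def
    by (subst sum.union_disjoint[symmetric] sum.union_disjoint[symmetric];
        (rule sum.cong)?; auto intro: finite_subset[OF _ finite_quads[of n]])+
  have swap: "S P f = S (\<lambda>a b x y. P b a y x) (\<lambda>a b. f b a)" for P f
    unfolding S_def
    by (rule sum.reindex_bij_witness[where i = "\<lambda>(a, b, x, y). (b, a, y, x)" and j = "\<lambda>(a, b, x, y). (b, a, y, x)"])
       (auto simp: quads_def add.commute)
  have F_swap: "F (int b - int a) = F (int a - int b)" for a b
    using even_F[of "int b - int a"] by simp
  have T1: "S (\<lambda>a b x y. b < a) (\<lambda>a b. F (int a - int b)) = S (\<lambda>a b x y. x < y) (\<lambda>a b. F (int a))"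
    unfolding S_def
    by (rule sum.reindex_bij_witness[where i = "\<lambda>(a, b, x, y). (a + b, b, x, y - x)"
          and j = "\<lambda>(a, b, x, y). (a - b, b, x, x + y)"])
       (auto simp: quads_def algebra_simps dest!: less_imp_Suc_add)
  have T2: "S (\<lambda>a b x y. y < x) (\<lambda>a b. F (int a + int b)) = S (\<lambda>a b x y. b < a) (\<lambda>a b. F (int a))"
    unfolding S_def
    by (rule sum.reindex_bij_witness[where i = "\<lambda>(a, b, x, y). (b, a - b, x + y, x)"
          and j = "\<lambda>(a, b, x, y). (a + b, a, y, x - y)"])
       (auto simp: quads_def algebra_simps dest!: less_imp_Suc_add)
  have T3: "S (\<lambda>a b x y. y < x) (\<lambda>a b. F (int a)) = S (\<lambda>a b x y. a < b) (\<lambda>a b. F (int a))"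
    unfolding S_def
    by (rule sum.reindex_bij_witness[where i = "\<lambda>(a, b, x, y). (a, b - a, x + y, y)"
          and j = "\<lambda>(a, b, x, y). (a, a + b, x - y, y)"])
       (auto simp: quads_def algebra_simps dest!: less_imp_Suc_add)
  have T1': "S (\<lambda>a b x y. a < b) (\<lambda>a b. F (int a - int b)) = S (\<lambda>a b x y. b < a) (\<lambda>a b. F (int a - int b))"
    by (subst swap) (simp add: F_swap)
  have T2': "S (\<lambda>a b x y. x < y) (\<lambda>a b. F (int a + int b)) = S (\<lambda>a b x y. y < x) (\<lambda>a b. F (int a + int b))"
    by (subst swap) (simp add: add.commute)
  have D: "S P (\<lambda>a b. f a b - g a b) = S P f - S P g" for P f g
    unfolding S_def by (simp add: sum_subtractf split_def)
  have A: "S P (\<lambda>a b. f a b + g a b) = S P f + S P g" for P f g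
    unfolding S_def by (simp add: sum.distrib split_def)
  have M: "S P (\<lambda>a b. 2 * f a b) = 2 * S P f" for P f
    unfolding S_def by (simp add: sum_distrib_left split_def)
  have Z: "S (\<lambda>a b x y. a = b) (\<lambda>a b. F (int a - int b)) = S (\<lambda>a b x y. a = b) (\<lambda>a b. F 0)"
    unfolding S_def by (rule sum.cong) auto
  \<comment> \<open>The same sum of F (a) is cut in two ways; \<open>T3\<close> identifies one
    region of each cut, and what remains is the difference that \<open>T1\<close> and
    \<open>T2\<close> produce.\<close>
  have K: "S (\<lambda>a b x y. x = y) (\<lambda>a b. F (int a)) = S (\<lambda>a b x y. a = b) (\<lambda>a b. F (int a))
      + S (\<lambda>a b x y. b < a) (\<lambda>a b. F (int a)) - S (\<lambda>a b x y. x < y) (\<lambda>a b. F (int a))"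
    using split[of "\<lambda>a b. F (int a)" "\<lambda>a b x y. a" "\<lambda>a b x y. b"]
      split[of "\<lambda>a b. F (int a)" "\<lambda>a b x y. x" "\<lambda>a b x y. y"] T3 by (simp add: algebra_simps)
  have "S (\<lambda>a b x y. True) (\<lambda>a b. F (int a - int b) - F (int a + int b)) =
     S (\<lambda>a b x y. a = b) (\<lambda>a b. F 0 + 2 * F (int a)) - S (\<lambda>a b x y. x = y) (\<lambda>a b. 2 * F (int a) + F (int a + int b))"
    unfolding D A M K
    using split[of "\<lambda>a b. F (int a - int b)" "\<lambda>a b x y. a" "\<lambda>a b x y. b"]
      split[of "\<lambda>a b. F (int a + int b)" "\<lambda>a b x y. x" "\<lambda>a b x y. y"] T1 T2 T1' T2' Z
    by (simp add: algebra_simps)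
  thus ?thesis unfolding S_def by simp
qed

section \<open>Lambert series and divisor sums\<close>

definition lambert :: "(nat \<Rightarrow> complex) \<Rightarrow> complex fps" where
  "lambert f = Abs_fps (\<lambda>n. if n = 0 then 0 else \<Sum>d | d dvd n. f d)"

lemma lambert_nth: "lambert f $ n = (if n = 0 then 0 else \<Sum>d | d dvd n. f d)"
  by (simp add: lambert_def)

text \<open>A quadruple amounts to a splitting n = i + j with a divisor a of i and a divisor b of j;
  x and y are the cofactors.\<close>

lemma sum_quads_mult:
  "(\<Sum>(a, b, x, y) \<in> quads n. f a * g b) = (lambert f * lambert g) $ n"
proof -
  have "(lambert f * lambert g) $ n = (\<Sum>i\<in>{0<..<n}. lambert f $ i * lambert g $ (n - i))"
    unfolding fps_mult_nth by (rule sum.mono_neutral_right) (auto simp: lambert_nth)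
  also have "\<dots> = (\<Sum>i\<in>{0<..<n}. \<Sum>(a, b) \<in> {a. a dvd i} \<times> {b. b dvd (n - i)}. f a * g b)"
    by (rule sum.cong) (auto simp: lambert_nth sum_product sum.cartesian_product)
  also have "\<dots> = (\<Sum>(i, a, b) \<in> (SIGMA i:{0<..<n}. {a. a dvd i} \<times> {b. b dvd (n - i)}). f a * g b)"
    by (subst sum.Sigma) (auto simp: split_def)
  also have "\<dots> = (\<Sum>(a, b, x, y) \<in> quads n. f a * g b)"
  proof (rule sum.reindex_bij_witness[where i = "\<lambda>(a, b, x, y). (a * x, a, b)"
          and j = "\<lambda>(i, a, b). (a, b, i div a, (n - i) div b)"], goal_cases)
    case (2 t)
    then obtain i a b where t: "t = (i, a, b)" "0 < i" "i < n" "a dvd i" "b dvd n - i" by auto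
    then obtain x y where "i = a * x" "n - i = b * y" by (auto elim!: dvdE)
    moreover from this t have "a > 0" "x > 0" "b > 0" "y > 0" "n = a * x + b * y"
      by (auto intro!: Nat.gr0I)
    ultimately show ?case using t by (auto simp: quads_def)
  qed (auto simp: quads_def)
  finally show ?thesis ..
qed

text \<open>For a = b = d the equation reads d (x + y) = n, which leaves n div d - 1 choices of
  x.\<close>

lemma sum_quads_eq_fst:
  assumes "n > 0"
  shows "(\<Sum>(a, b, x, y) \<in> {(a, b, x, y) \<in> quads n. a = b}. G a) = (\<Sum>d | d dvd n. (of_nat (n div d) - 1) * G d :: complex)"
proof -
  have "(\<Sum>(a, b, x, y) \<in> {(a, b, x, y) \<in> quads n. a = b}. G a) =
      (\<Sum>(d, x) \<in> (SIGMA d:{d. d dvd n}. {0<..<n div d}). G d)"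
  proof (rule sum.reindex_bij_witness[where i = "\<lambda>(d, x). (d, d, x, n div d - x)"
          and j = "\<lambda>(a, b, x, y). (a, x)"], goal_cases)
    case (4 t)
    then obtain d x where t: "t = (d, x)" "d dvd n" "0 < x" "x < n div d" by auto
    moreover have "d * x + d * (n div d - x) = n"
      using t by (simp flip: distrib_left)
    ultimately show ?case using assms by (auto simp: quads_def intro!: Nat.gr0I)
  qed (auto simp: quads_def simp flip: distrib_left)
  also have "\<dots> = (\<Sum>d | d dvd n. \<Sum>x\<in>{0<..<n div d}. G d)"
    using assms by (subst sum.Sigma) auto
  also have "\<dots> = (\<Sum>d | d dvd n. (of_nat (n div d) - 1) * G d)"
  proof (rule sum.cong, goal_cases)
    case (2 d)
    then have "n div d \<ge> 1" using assms by (auto elim!: dvdE)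
    thus ?case by (simp add: of_nat_diff)
  qed auto
  finally show ?thesis .
qed

text \<open>For x = y the equation reads (a + b) x = n, so the sum runs over the divisors d = a + b
  and the splittings of d.\<close>

lemma sum_quads_eq_snd:
  assumes "n > 0"
  shows "(\<Sum>(a, b, x, y) \<in> {(a, b, x, y) \<in> quads n. x = y}. H a (a + b)) = (\<Sum>d | d dvd n. \<Sum>a\<in>{0<..<d}. H a d :: complex)"
proof -
  have "(\<Sum>(a, b, x, y) \<in> {(a, b, x, y) \<in> quads n. x = y}. H a (a + b)) =
      (\<Sum>(d, a) \<in> (SIGMA d:{d. d dvd n}. {0<..<d}). H a d)"
  proof (rule sum.reindex_bij_witness[where i = "\<lambda>(d, a). (a, d - a, n div d, n div d)"
          and j = "\<lambda>(a, b, x, y). (a + b, a)"], goal_cases)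
    case (4 t)
    then obtain d a where t: "t = (d, a)" "d dvd n" "0 < a" "a < d" by auto
    moreover have "a * (n div d) + (d - a) * (n div d) = n"
      using t by (simp flip: distrib_right)
    ultimately show ?case using assms by (auto simp: quads_def intro!: Nat.gr0I)
  qed (auto simp: quads_def simp flip: distrib_right)
  also have "\<dots> = (\<Sum>d | d dvd n. \<Sum>a\<in>{0<..<d}. H a d)"
    using assms by (subst sum.Sigma) auto
  finally show ?thesis .
qed

lemma liouville_divisors:
  fixes F :: "int \<Rightarrow> complex"
  assumes "\<And>x. F (- x) = F x" and n: "n > 0"
  shows "(\<Sum>(a, b, x, y) \<in> quads n. F (int a - int b) - F (int a + int b)) =
     (\<Sum>d | d dvd n. (of_nat (n div d) - 1) * (F 0 + 2 * F (int d))
        - (2 * (\<Sum>a\<in>{0<..<d}. F (int a)) + (of_nat d - 1) * F (int d)))"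
proof -
  have eq: "(\<Sum>a\<in>{0<..<d}. 2 * F (int a) + F (int d)) =
      2 * (\<Sum>a\<in>{0<..<d}. F (int a)) + (of_nat d - 1) * F (int d)" if "d dvd n" for d
    using dvd_pos_nat[OF n that] by (simp add: sum.distrib sum_distrib_left of_nat_diff)
  have "(\<Sum>(a, b, x, y) \<in> quads n. F (int a - int b) - F (int a + int b)) =
     (\<Sum>(a, b, x, y) \<in> {(a, b, x, y) \<in> quads n. a = b}. F 0 + 2 * F (int a))
     - (\<Sum>(a, b, x, y) \<in> {(a, b, x, y) \<in> quads n. x = y}. 2 * F (int a) + F (int a + int b))"
    by (rule liouville_identity) fact
  also have "\<dots> = (\<Sum>d | d dvd n. (of_nat (n div d) - 1) * (F 0 + 2 * F (int d)))
      - (\<Sum>d | d dvd n. \<Sum>a\<in>{0<..<d}. 2 * F (int a) + F (int d))"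
    using sum_quads_eq_fst[OF n, of "\<lambda>a. F 0 + 2 * F (int a)"]
      sum_quads_eq_snd[OF n, of "\<lambda>a d. 2 * F (int a) + F (int d)"] by simp
  also have "\<dots> = (\<Sum>d | d dvd n. (of_nat (n div d) - 1) * (F 0 + 2 * F (int d)))
      - (\<Sum>d | d dvd n. 2 * (\<Sum>a\<in>{0<..<d}. F (int a)) + (of_nat d - 1) * F (int d))"
    using eq by simp
  finally show ?thesis by (simp add: sum_subtractf)
qed

lemma sum_squares_below: "(\<Sum>a\<in>{0<..<d}. (of_nat a :: complex)^2) = (of_nat d - 1) * of_nat d * (2 * of_nat d - 1) / 6"
  if "d > 0" for d
  using that
proof (induction d rule: nat_induct_non_zero)
  case (Suc d)
  have "{0<..<Suc d} = insert d {0<..<d}" using Suc by auto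
  thus ?case using Suc by (simp add: power2_eq_square field_simps)
qed auto

lemma sum_even_squares_below:
  "(\<Sum>a\<in>{0<..<d}. (if even a then (of_nat a :: complex)^2 else 0)) =
    (of_nat d^3 - of_nat d) / 6 + (if even d then (of_nat d - of_nat d^2) / 2 else 0)"
  if "d > 0" for d
  using that
proof (induction d rule: nat_induct_non_zero)
  case (Suc d)
  have "{0<..<Suc d} = insert d {0<..<d}" using Suc by auto
  thus ?case using Suc.hyps
    by (cases "even d") (simp_all add: Suc.IH power2_eq_square power3_eq_cube field_simps)
qed auto

lemma fps_nth_compose_X_power:
  assumes "k > 0"
  shows "(f oo fps_X ^ k) $ n = (if k dvd n then f $ (n div k) else (0 :: complex))"
proof -
  have "(f oo fps_X ^ k) $ n = (\<Sum>i\<in>{0..n}. if n = k * i then f $ i else 0)"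
    unfolding fps_compose_nth by (rule sum.cong) (auto simp flip: power_mult simp: fps_X_power_nth)
  also have "\<dots> = (\<Sum>i\<in>{0..n} \<inter> {i. n = k * i}. f $ i)"
    by (subst sum.inter_restrict) auto
  also have "{0..n} \<inter> {i. n = k * i} = (if k dvd n then {n div k} else {})"
    using assms by (auto elim!: dvdE)
  finally show ?thesis by simp
qed

lemma sum_even_divisors:
  fixes f :: "nat \<Rightarrow> complex"
  assumes "n > 0"
  shows "(\<Sum>d | d dvd n. if even d then f (d div 2) else 0) = (if even n then \<Sum>d | d dvd n div 2. f d else 0)"
proof (cases "even n")
  case True
  have "(\<Sum>d | d dvd n. if even d then f (d div 2) else 0) = (\<Sum>d\<in>{d. d dvd n} \<inter> {d. even d}. f (d div 2))"
    using assms by (subst sum.inter_restrict) auto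
  also have "\<dots> = (\<Sum>d | d dvd n div 2. f d)"
    using True assms
    by (intro sum.reindex_bij_witness[where i = "\<lambda>d. 2 * d" and j = "\<lambda>d. d div 2"]) (auto elim!: evenE)
  finally show ?thesis using True by simp
next
  case False
  hence "\<forall>d. d dvd n \<longrightarrow> odd d" using dvd_trans by blast
  thus ?thesis using False by simp
qed

lemma lambert_even: "lambert (\<lambda>d. if even d then f (d div 2) else 0) = lambert f oo fps_X ^ 2"
proof (rule fps_ext)
  fix n
  show "lambert (\<lambda>d. if even d then f (d div 2) else 0) $ n = (lambert f oo fps_X ^ 2) $ n"
    using sum_even_divisors[of n f]
    by (auto simp: lambert_nth fps_nth_compose_X_power simp del: mult_Suc elim!: evenE)
qed

text \<open>The left side is twice the even part. Divisor sums of such an f obey the Hecke recursion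
  s(2k) = (1 + c) s(k) - c s(k/2), so the even part involves only q^2 and q^4.\<close>

lemma lambert_hecke2:
  assumes "\<And>d. f (2 * d) = c * f d"
  shows "(lambert f oo (- fps_X)) + lambert f =
    fps_const (2 * (1 + c)) * (lambert f oo fps_X ^ 2) - fps_const (2 * c) * (lambert f oo fps_X ^ 4)"
proof (rule fps_ext)
  fix n :: nat
  have neg: "(lambert f oo (- fps_X)) $ n = (- 1) ^ n * lambert f $ n"
    using fps_nth_compose_linear[of "lambert f" "- 1" n] by (simp flip: fps_const_neg)
  show "((lambert f oo (- fps_X)) + lambert f) $ n =
    (fps_const (2 * (1 + c)) * (lambert f oo fps_X ^ 2) - fps_const (2 * c) * (lambert f oo fps_X ^ 4)) $ n"
  proof (cases "even n")
    case False
    hence "\<not> 4 dvd n" using dvd_trans[of 2 4 n] by auto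
    thus ?thesis using False by (simp add: neg fps_nth_compose_X_power)
  next
    case True
    then obtain k where k: "n = 2 * k" by auto
    show ?thesis
    proof (cases "k = 0")
      case True
      thus ?thesis using k by (simp add: lambert_nth)
    next
      case False
      have f_even: "f d = c * f (d div 2)" if "even d" for d
        using assms[of "d div 2"] that by simp
      have dvd4: "4 dvd n \<longleftrightarrow> even k" "n div 4 = k div 2" using k by auto
      have odd_dvd: "odd d \<Longrightarrow> d dvd 2 * k \<longleftrightarrow> d dvd k" for d
        by (simp add: coprime_dvd_mult_right_iff)
      have split: "(\<Sum>d | d dvd m. f d) = (\<Sum>d | d dvd m. if odd d then f d else 0)
          + c * (\<Sum>d | d dvd m. if even d then f (d div 2) else 0)" for m
        unfolding sum_distrib_left sum.distrib[symmetric] by (rule sum.cong) (auto simp: f_even)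
      have odd_eq: "(\<Sum>d | d dvd 2 * k. if odd d then f d else 0) = (\<Sum>d | d dvd k. if odd d then f d else 0)"
        by (rule sum.mono_neutral_right) (use False odd_dvd in auto)
      have sum_n: "(\<Sum>d | d dvd n. f d) = (1 + c) * (\<Sum>d | d dvd k. f d)
          - c * (if even k then \<Sum>d | d dvd k div 2. f d else 0)"
        using split[of "2 * k"] split[of k] odd_eq sum_even_divisors[of k f] sum_even_divisors[of "2 * k" f] False
        unfolding k by (simp add: algebra_simps)
      have "even k \<Longrightarrow> k div 2 > 0" "n \<noteq> 0" "even n" "n div 2 = k" using k False by auto
      thus ?thesis using False
        unfolding fps_add_nth fps_sub_nth neg fps_mult_left_const_nth
        by (cases "even k") (simp_all add: fps_nth_compose_X_power lambert_nth dvd4 sum_n algebra_simps)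
    qed
  qed
qed

section \<open>Eisenstein series of level four\<close>

definition theta :: "complex fps \<Rightarrow> complex fps" where
  "theta f = fps_X * fps_deriv f"

lemma theta_nth [simp]: "theta f $ n = of_nat n * f $ n"
  by (simp add: theta_def fps_mult_fps_X_deriv_shift)

lemma theta_add: "theta (f + g) = theta f + theta g"
  and theta_diff: "theta (f - g) = theta f - theta g"
  and theta_mult: "theta (f * g) = theta f * g + f * theta g"
  and theta_1: "theta 1 = 0"
  by (simp_all add: theta_def algebra_simps)

lemma theta_power: "theta (f ^ n) = of_nat n * f ^ (n - 1) * theta f"
  by (simp add: theta_def fps_deriv_power fps_of_nat algebra_simps)

lemma theta_prod:
  assumes "\<And>k. k \<in> A \<Longrightarrow> theta (f k) = v k * f k"
  shows "theta (\<Prod>k\<in>A. f k) = (\<Sum>k\<in>A. v k) * (\<Prod>k\<in>A. f k)"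
  using assms by (induction A rule: infinite_finite_induct) (auto simp: theta_mult theta_1 algebra_simps)

lemma theta_compose_X_power:
  "theta (f oo fps_X ^ k) = fps_const (of_nat k) * (theta f oo fps_X ^ k)" if "k > 0"
  using that by (intro fps_ext) (auto simp: fps_nth_compose_X_power elim!: dvdE)

lemma theta_compose_uminus: "theta (f oo (- fps_X)) = theta f oo (- fps_X)"
proof (rule fps_ext)
  have neg: "(g oo (- fps_X)) $ n = (- 1) ^ n * (g :: complex fps) $ n" for n g
    using fps_nth_compose_linear[of g "- 1" n] by (simp flip: fps_const_neg)
  show "theta (f oo (- fps_X)) $ n = (theta f oo (- fps_X)) $ n" for n
    by (simp add: neg)
qed

text \<open>If the difference of two solutions has order k, comparing its lowest coefficients gives
  k = v $ 0 = m, so agreement in degree m alone suffices.\<close>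

lemma theta_ODE_unique:
  assumes "theta y = v * y" "theta z = v * z" "v $ 0 = of_nat m" "y $ m = z $ m"
  shows "y = z"
proof (rule ccontr)
  define d where "d = y - z"
  assume "y \<noteq> z"
  hence "d \<noteq> 0" by (simp add: d_def)
  define k where "k = subdegree d"
  have dk: "d $ k \<noteq> 0" "\<And>i. i < k \<Longrightarrow> d $ i = 0"
    using \<open>d \<noteq> 0\<close> by (auto simp: k_def)
  have "theta d = v * d" using assms by (simp add: d_def theta_diff algebra_simps)
  hence "of_nat k * d $ k = (v * d) $ k" by (metis theta_nth)
  also have "\<dots> = (\<Sum>i\<in>{0}. v $ i * d $ (k - i))"
    unfolding fps_mult_nth by (rule sum.mono_neutral_right) (auto simp: dk)
  finally have "k = m" using dk assms(3) by simp
  thus False using dk assms(4) by (simp add: d_def)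
qed

definition S1 :: "complex fps" where "S1 = lambert of_nat"
definition S3 :: "complex fps" where "S3 = lambert (\<lambda>d. of_nat d ^ 3)"

lemma fps_numeral_mult_nth: "(numeral k * f) $ n = numeral k * (f $ n :: complex)"
  by (simp add: numeral_fps_const)

lemma sum_divisors_complement:
  "n > 0 \<Longrightarrow> d dvd n \<Longrightarrow> of_nat (n div d) * of_nat d = (of_nat n :: complex)"
  by (simp flip: of_nat_mult)

text \<open>Liouville's identity for F (x) = x^2, where F (a - b) - F (a + b) = -4 a b. The
  derivative comes from the diagonal a = b, because (n div d) * d = n there.\<close>

lemma S1_square: "12 * (S1 * S1) = 5 * S3 + S1 - 6 * theta S1"
proof (rule fps_ext)
  fix n
  show "(12 * (S1 * S1)) $ n = (5 * S3 + S1 - 6 * theta S1) $ n"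
  proof (cases "n = 0")
    case True thus ?thesis by (simp add: S1_def S3_def lambert_nth fps_numeral_nth_0)
  next
    case False
    define F :: "int \<Rightarrow> complex" where "F = (\<lambda>x. of_int x ^ 2)"
    have summand: "(of_nat (n div d) - 1) * (F 0 + 2 * F (int d))
        - (2 * (\<Sum>a\<in>{0<..<d}. F (int a)) + (of_nat d - 1) * F (int d))
        = 2 * of_nat n * of_nat d - 5 / 3 * of_nat d ^ 3 - of_nat d / 3" if "d dvd n" for d
    proof -
      have "(of_nat (n div d) - 1) * (F 0 + 2 * F (int d))
        = 2 * (of_nat (n div d) * of_nat d) * of_nat d - 2 * of_nat d ^ 2"
        by (simp add: F_def power2_eq_square algebra_simps)
      also have "of_nat (n div d) * of_nat d = (of_nat n :: complex)"
        using that False by (intro sum_divisors_complement) auto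
      finally have eq: "(of_nat (n div d) - 1) * (F 0 + 2 * F (int d)) = 2 * of_nat n * of_nat d - 2 * of_nat d ^ 2" .
      have sum_F: "(\<Sum>a\<in>{0<..<d}. F (int a)) = (of_nat d - 1) * of_nat d * (2 * of_nat d - 1) / 6"
        using sum_squares_below[of d] dvd_pos_nat[of n d] that False by (simp add: F_def)
      show ?thesis
        unfolding eq sum_F by (simp add: F_def power2_eq_square power3_eq_cube field_simps)
    qed
    have "(- 4) * (S1 * S1) $ n = (\<Sum>(a, b, x, y) \<in> quads n. F (int a - int b) - F (int a + int b))"
      unfolding S1_def sum_quads_mult[symmetric] sum_distrib_left
      by (rule sum.cong) (auto simp: F_def power2_eq_square algebra_simps)
    also have "\<dots> = (\<Sum>d | d dvd n. 2 * of_nat n * of_nat d - 5 / 3 * of_nat d ^ 3 - of_nat d / 3)"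
      using summand False by (subst liouville_divisors) (auto simp: F_def)
    also have "\<dots> = 2 * of_nat n * S1 $ n - 5 / 3 * S3 $ n - S1 $ n / 3"
      using False by (simp add: S1_def S3_def lambert_nth sum_subtractf sum_distrib_left sum_divide_distrib)
    finally have eq: "(- 4) * (S1 * S1) $ n = 2 * of_nat n * S1 $ n - 5 / 3 * S3 $ n - S1 $ n / 3" .
    have "12 * (S1 * S1) $ n = (- 3) * ((- 4) * (S1 * S1) $ n)" by simp
    also note eq
    finally show ?thesis
      unfolding fps_numeral_mult_nth fps_add_nth fps_sub_nth theta_nth by (simp add: algebra_simps)
  qed
qed

lemma lambert_add: "lambert (\<lambda>d. f d + g d) = lambert f + lambert g"
  and lambert_cmult: "lambert (\<lambda>d. c * f d) = fps_const c * lambert f"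
  by (auto intro!: fps_ext simp: lambert_nth sum.distrib sum_distrib_left)

lemma lambert_odd_part:
  "lambert (\<lambda>d. if odd d then of_nat d else 0) = S1 - 2 * (S1 oo fps_X ^ 2)"
  "lambert (\<lambda>d. if even d then of_nat d else 0) = 2 * (S1 oo fps_X ^ 2)"
proof -
  have "lambert (\<lambda>d. if even d then of_nat d else 0) =
      lambert (\<lambda>d. 2 * (if even d then of_nat (d div 2) else 0))"
    by (rule arg_cong[of _ _ lambert], rule ext) (auto elim!: evenE)
  thus *: "lambert (\<lambda>d. if even d then of_nat d else 0) = 2 * (S1 oo fps_X ^ 2)"
    unfolding lambert_cmult lambert_even by (simp add: S1_def numeral_fps_const)
  have "lambert of_nat = lambert (\<lambda>d. (if odd d then of_nat d else 0) + (if even d then of_nat d else 0))"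
    by (rule arg_cong[of _ _ lambert], rule ext) auto
  thus "lambert (\<lambda>d. if odd d then of_nat d else 0) = S1 - 2 * (S1 oo fps_X ^ 2)"
    unfolding lambert_add * unfolding S1_def by (simp add: algebra_simps)
qed

text \<open>Now F is x^2 restricted to even x, so only a and b of equal parity contribute -4 a b.
  The left side is the square of the odd-divisor part \<open>S1 - 2 * S\<close> plus that of the
  even-divisor part \<open>2 * S\<close>.\<close>

lemma S1_odd_square:
  defines "S \<equiv> S1 oo fps_X ^ 2"
  shows "12 * ((S1 - 2 * S)^2 + 4 * S^2) = 24 * (S3 oo fps_X ^ 2) + 6 * S - 12 * theta S + S3 - S1"
    (is "?L = ?R")
proof (rule fps_ext)
  fix n
  show "?L $ n = ?R $ n"
  proof (cases "n = 0")
    case True thus ?thesis by (simp add: S_def S1_def S3_def lambert_nth fps_numeral_nth_0 power2_eq_square)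
  next
    case False
    define F :: "int \<Rightarrow> complex" where "F = (\<lambda>x. if even x then of_int x ^ 2 else 0)"
    define f :: "nat \<Rightarrow> complex" where "f = (\<lambda>d. if odd d then of_nat d else 0)"
    define g :: "nat \<Rightarrow> complex" where "g = (\<lambda>d. if even d then of_nat d else 0)"
    have summand: "(of_nat (n div d) - 1) * (F 0 + 2 * F (int d))
        - (2 * (\<Sum>a\<in>{0<..<d}. F (int a)) + (of_nat d - 1) * F (int d))
        = (if even d then (4 * of_nat n - 2) * of_nat (d div 2) - 8 * of_nat (d div 2) ^ 3 else 0)
          - (of_nat d ^ 3 - of_nat d) / 3" if "d dvd n" for d
    proof -
      have sum_F: "(\<Sum>a\<in>{0<..<d}. F (int a)) =
         (of_nat d^3 - of_nat d) / 6 + (if even d then (of_nat d - of_nat d^2) / 2 else 0)"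
        using sum_even_squares_below[of d] dvd_pos_nat[of n d] that False
        by (simp add: F_def cong: if_cong)
      show ?thesis
      proof (cases "even d")
        case True
        then obtain k where k: "d = 2 * k" by auto
        have "(of_nat (n div d) - 1) * (F 0 + 2 * F (int d))
          = 2 * (of_nat (n div d) * of_nat d) * of_nat d - 2 * of_nat d ^ 2"
          using True by (simp add: F_def power2_eq_square algebra_simps)
        also have "of_nat (n div d) * of_nat d = (of_nat n :: complex)"
          using that False by (intro sum_divisors_complement) auto
        finally show ?thesis
          unfolding sum_F using k
          by (simp add: F_def power2_eq_square power3_eq_cube field_simps)
      next
        case False
        thus ?thesis unfolding sum_F by (simp add: F_def)
      qed
    qed
    have "(- 4) * ((S1 - 2 * S)^2 + (2 * S)^2) $ n = (- 4) * (lambert f * lambert f + lambert g * lambert g) $ n"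
      by (simp add: f_def g_def lambert_odd_part S_def power2_eq_square)
    also have "\<dots> = (\<Sum>(a, b, x, y) \<in> quads n. F (int a - int b) - F (int a + int b))"
      unfolding fps_add_nth sum_quads_mult[symmetric] sum.distrib[symmetric] sum_distrib_left
      by (rule sum.cong) (auto simp: F_def f_def g_def power2_eq_square algebra_simps)
    also have "\<dots> = (\<Sum>d | d dvd n. (if even d then (4 * of_nat n - 2) * of_nat (d div 2) - 8 * of_nat (d div 2) ^ 3 else 0)
          - (of_nat d ^ 3 - of_nat d) / 3)"
      using summand False by (subst liouville_divisors) (auto simp: F_def)
    also have "\<dots> = (if even n then \<Sum>d | d dvd n div 2. (4 * of_nat n - 2) * of_nat d - 8 * of_nat d ^ 3 else 0)
        - (S3 $ n - S1 $ n) / 3"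
      using False sum_even_divisors[of n "\<lambda>d. (4 * of_nat n - 2) * of_nat d - 8 * of_nat d ^ 3"]
      by (simp add: S1_def S3_def lambert_nth sum_subtractf flip: sum_divide_distrib)
    also have "(if even n then \<Sum>d | d dvd n div 2. (4 * of_nat n - 2) * of_nat d - 8 * of_nat d ^ 3 else 0)
        = (4 * of_nat n - 2) * S $ n - 8 * (S3 oo fps_X ^ 2) $ n"
      using False
      by (auto simp: S_def S1_def S3_def fps_nth_compose_X_power lambert_nth sum_subtractf sum_distrib_left elim!: evenE)
    finally show ?thesis
      by (simp add: numeral_fps_const field_simps power_mult_distrib)
  qed
qed

lemma S1_hecke: "(S1 oo (- fps_X)) = 6 * (S1 oo fps_X ^ 2) - 4 * (S1 oo fps_X ^ 4) - S1"
  using lambert_hecke2[of of_nat 2] by (simp add: S1_def numeral_fps_const algebra_simps)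

lemma S3_hecke: "(S3 oo (- fps_X)) = 18 * (S3 oo fps_X ^ 2) - 16 * (S3 oo fps_X ^ 4) - S3"
  using lambert_hecke2[of "\<lambda>d. of_nat d ^ 3" 8] by (simp add: S3_def numeral_fps_const algebra_simps power_mult_distrib)

section \<open>Quadratic relations of E2 at q, q^2, q^4\<close>

abbreviation "X2 \<equiv> (fps_X ^ 2 :: complex fps)"
abbreviation "X4 \<equiv> (fps_X ^ 4 :: complex fps)"

definition E2 :: "complex fps" where "E2 = 1 - 24 * S1"

definition "Ps = E2"
definition "Qs = E2 oo X2"
definition "Rs = E2 oo X4"

lemma E4_eq: "E4 = 1 + 240 * S3"
  by (rule fps_ext) (auto simp: E4_def S3_def lambert_nth numeral_fps_const)

lemma compose_X2_X2: "f oo X2 oo X2 = f oo X4"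
proof -
  have "X2 oo X2 = X4" by (subst fps_compose_power[symmetric]) (auto simp flip: power_mult)
  thus ?thesis by (subst fps_compose_assoc[symmetric]) auto
qed

lemma compose_X2_uminus: "f oo X2 oo (- fps_X) = f oo X2" "f oo X4 oo (- fps_X) = f oo X4"
proof -
  have *: "X2 oo (- fps_X) = X2" "X4 oo (- fps_X) = X4"
    by (subst fps_compose_power[symmetric]; simp)+
  show "f oo X2 oo (- fps_X) = f oo X2" "f oo X4 oo (- fps_X) = f oo X4"
    by (subst fps_compose_assoc[symmetric]; simp add: *)+
qed

lemma theta_numeral: "theta (numeral k) = 0"
  by (simp add: theta_def)

lemmas theta_simps = theta_add theta_diff theta_mult theta_numeral theta_1
lemmas compose_simps = fps_compose_add_distrib fps_compose_sub_distrib fps_compose_mult_distrib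

lemma compose_square: "g $ 0 = 0 \<Longrightarrow> f ^ 2 oo g = ((f :: complex fps) oo g) ^ 2"
  by (simp add: fps_compose_power)

lemma ramanujan_E2: "E2 ^ 2 = E4 + 12 * theta E2"
proof -
  have "E2 ^ 2 - (E4 + 12 * theta E2) = 48 * (12 * (S1 * S1) - (5 * S3 + S1 - 6 * theta S1))"
    unfolding E2_def E4_eq theta_simps by (simp add: algebra_simps power2_eq_square)
  thus ?thesis by (simp add: S1_square)
qed

text \<open>Together with \<open>ramanujan_E2\<close> these are six linear equations for the three
  E4 series and the three derivatives, and they determine all six as quadratic forms in
  \<open>Ps\<close>, \<open>Qs\<close>, \<open>Rs\<close>. The last one is
  \<open>ramanujan_E2\<close> at -q; the Hecke relations express E2(-q) and E4(-q) through the
  series at q, q^2, q^4.\<close>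

lemma E2_relations:
  "Qs ^ 2 = (E4 oo X2) + 6 * theta Qs"
  "Rs ^ 2 = (E4 oo X4) + 3 * theta Rs"
  "5 * (2 * Qs - Ps) ^ 2 = E4 + 4 * (E4 oo X2)"
  "5 * (2 * Rs - Qs) ^ 2 = (E4 oo X2) + 4 * (E4 oo X4)"
  "(6 * Qs - 4 * Rs - Ps) ^ 2 = 18 * (E4 oo X2) - 16 * (E4 oo X4) - E4 + 12 * (6 * theta Qs - 4 * theta Rs - theta Ps)"
proof -
  have two: "theta (f oo X2) = 2 * (theta f oo X2)" for f
    by (simp add: theta_compose_X_power numeral_fps_const)
  have four: "theta (f oo X4) = 4 * (theta f oo X4)" for f
    by (simp add: theta_compose_X_power numeral_fps_const)
  show Q: "Qs ^ 2 = (E4 oo X2) + 6 * theta Qs"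
    using arg_cong[OF ramanujan_E2, of "\<lambda>f. f oo X2"]
    by (simp add: Qs_def two compose_simps compose_square)
  show "Rs ^ 2 = (E4 oo X4) + 3 * theta Rs"
    using arg_cong[OF ramanujan_E2, of "\<lambda>f. f oo X4"]
    by (simp add: Rs_def four compose_simps compose_square)
  define S where "S = S1 oo X2"
  have Q_eq: "Qs = 1 - 24 * S"
    by (simp add: Qs_def E2_def S_def compose_simps)
  have S_sq: "12 * (S * S) = 5 * (S3 oo X2) + S - 3 * theta S"
    using arg_cong[OF S1_square, of "\<lambda>f. f oo X2"]
    by (simp add: S_def two compose_simps)
  have "5 * (2 * Qs - Ps) ^ 2 - (E4 + 4 * (E4 oo X2)) =
     240 * (12 * ((S1 - 2 * S)^2 + 4 * S^2) - (24 * (S3 oo fps_X ^ 2) + 6 * S - 12 * theta S + S3 - S1))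
     - 960 * (12 * (S * S) - (5 * (S3 oo X2) + S - 3 * theta S))"
    unfolding Q_eq Ps_def E2_def E4_eq by (simp add: compose_simps power2_eq_square algebra_simps)
  also have "\<dots> = 0" using S1_odd_square S_sq unfolding S_def by simp
  finally show A: "5 * (2 * Qs - Ps) ^ 2 = E4 + 4 * (E4 oo X2)" by simp
  show "5 * (2 * Rs - Qs) ^ 2 = (E4 oo X2) + 4 * (E4 oo X4)"
    using arg_cong[OF A, of "\<lambda>f. f oo X2"]
    by (simp add: Rs_def Qs_def Ps_def compose_simps compose_X2_X2 compose_square)
  have "E2 oo (- fps_X) = 6 * Qs - 4 * Rs - Ps"
    by (simp add: E2_def compose_simps S1_hecke Qs_def Rs_def Ps_def algebra_simps)
  moreover have "E4 oo (- fps_X) = 18 * (E4 oo X2) - 16 * (E4 oo X4) - E4"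
    by (simp add: E4_eq compose_simps S3_hecke algebra_simps)
  ultimately show "(6 * Qs - 4 * Rs - Ps) ^ 2 = 18 * (E4 oo X2) - 16 * (E4 oo X4) - E4
      + 12 * (6 * theta Qs - 4 * theta Rs - theta Ps)"
    using arg_cong[OF ramanujan_E2, of "\<lambda>f. f oo (- fps_X)"] theta_compose_uminus[of E2, symmetric]
    by (simp add: compose_simps compose_square theta_simps)
qed

section \<open>Theta series and their logarithmic derivatives\<close>

definition "theta_a = fps_const (1 / 3) * (4 * Rs - Ps)"
definition "theta_b = fps_const (1 / 3) * (Ps - 6 * Qs + 8 * Rs)"
definition "theta_c = theta_a - theta_b"

lemma fps_numeral_cancel: "numeral k * f = numeral k * g \<Longrightarrow> f = (g :: complex fps)"
  by simp

lemma three_ab: "3 * theta_a = 4 * Rs - Ps" "3 * theta_b = Ps - 6 * Qs + 8 * Rs"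
   "3 * theta_c = 6 * Qs - 4 * Rs - 2 * Ps"
proof -
  have *: "3 * (fps_const (1 / 3) * f) = (f :: complex fps)" for f
    by (simp add: numeral_fps_const flip: mult.assoc)
  show 1: "3 * theta_a = 4 * Rs - Ps" and 2: "3 * theta_b = Ps - 6 * Qs + 8 * Rs"
    by (simp_all add: theta_a_def theta_b_def *)
  show "3 * theta_c = 6 * Qs - 4 * Rs - 2 * Ps"
    unfolding theta_c_def right_diff_distrib 1 2 by (simp add: algebra_simps)
qed

lemma three_theta: "3 * theta f = theta (3 * f)"
  by (simp add: theta_mult theta_numeral)

text \<open>The factor is suggested by phi(-q)^4 = eta(tau)^8 / eta(2 tau)^4, whose logarithmic
  derivative is (Ps - Qs) / 3. Here it is confirmed inside the algebra of Eisenstein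
  relations.\<close>

lemma theta_theta_b: "3 * theta theta_b = theta_b * (Ps - Qs)"
proof (rule fps_numeral_cancel[of "num.Bit0 (num.Bit0 num.One)"], rule fps_numeral_cancel[of "num.Bit1 num.One"])
  have "3 * (4 * (3 * theta theta_b)) = 3 * (4 * theta (3 * theta_b))" by (simp add: three_theta)
  also have "\<dots> = 12 * (theta Ps - 6 * theta Qs + 8 * theta Rs)"
    unfolding three_ab by (simp add: theta_simps)
  also have "\<dots> = 4 * (Ps - 6 * Qs + 8 * Rs) * (Ps - Qs)"
  proof -
    \<comment> \<open>The multipliers solve a linear system: the three E4 terms cancel and the
      derivatives match.\<close>
    have "12 * (theta Ps - 6 * theta Qs + 8 * theta Rs) - 4 * (Ps - 6 * Qs + 8 * Rs) * (Ps - Qs) =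
      - 5 * (Ps ^ 2 - (E4 + 12 * theta Ps))
      + 60 * (Qs ^ 2 - ((E4 oo X2) + 6 * theta Qs))
      - 96 * (Rs ^ 2 - ((E4 oo X4) + 3 * theta Rs))
      + 1 * (5 * (2 * Qs - Ps) ^ 2 - (E4 + 4 * (E4 oo X2)))
      + 8 * (5 * (2 * Rs - Qs) ^ 2 - ((E4 oo X2) + 4 * (E4 oo X4)))
      - 4 * ((6 * Qs - 4 * Rs - Ps) ^ 2 - (18 * (E4 oo X2) - 16 * (E4 oo X4) - E4
        + 12 * (6 * theta Qs - 4 * theta Rs - theta Ps)))"
      by (simp add: power2_eq_square algebra_simps)
    also have "\<dots> = 0" by (simp add: E2_relations ramanujan_E2[folded Ps_def])
    finally show ?thesis by simp
  qed
  also have "\<dots> = 3 * (4 * (theta_b * (Ps - Qs)))"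
    unfolding three_ab[symmetric] by simp
  finally show "3 * (4 * (3 * theta theta_b)) = 3 * (4 * (theta_b * (Ps - Qs)))" .
qed

lemma E4_theta: "E4 = theta_b ^ 2 + 16 * theta_a * theta_c"
proof (rule fps_numeral_cancel[of "num.Bit1 (num.Bit0 (num.Bit0 num.One))"])
  have "9 * E4 = (Ps - 6 * Qs + 8 * Rs) ^ 2 + 16 * (4 * Rs - Ps) * (6 * Qs - 4 * Rs - 2 * Ps)"
  proof -
    \<comment> \<open>This time the multipliers are chosen so that the derivatives, E4(2 tau) and
      E4(4 tau) all cancel.\<close>
    have "9 * E4 - ((Ps - 6 * Qs + 8 * Rs) ^ 2 + 16 * (4 * Rs - Ps) * (6 * Qs - 4 * Rs - 2 * Ps)) =
      6 * (Ps ^ 2 - (E4 + 12 * theta Ps))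
      - 72 * (Qs ^ 2 - ((E4 oo X2) + 6 * theta Qs))
      + 96 * (Rs ^ 2 - ((E4 oo X4) + 3 * theta Rs))
      - 9 * (5 * (2 * Qs - Ps) ^ 2 - (E4 + 4 * (E4 oo X2)))
      + 6 * ((6 * Qs - 4 * Rs - Ps) ^ 2 - (18 * (E4 oo X2) - 16 * (E4 oo X4) - E4
        + 12 * (6 * theta Qs - 4 * theta Rs - theta Ps)))"
      by (simp add: power2_eq_square algebra_simps)
    also have "\<dots> = 0" by (simp add: E2_relations ramanujan_E2[folded Ps_def])
    finally show ?thesis by simp
  qed
  thus "9 * E4 = 9 * (theta_b ^ 2 + 16 * theta_a * theta_c)"
    unfolding three_ab[symmetric] by (simp add: power2_eq_square algebra_simps)
qed

text \<open>Replacing q by -q turns \<open>theta_b\<close> into \<open>theta_a\<close> and fixes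
  \<open>Qs\<close> and \<open>Rs\<close>, so the equation for \<open>theta_b\<close> transforms
  into this one.\<close>

lemma theta_theta_a: "3 * theta theta_a = theta_a * (5 * Qs - Ps - 4 * Rs)"
proof -
  have neg: "Ps oo (- fps_X) = 6 * Qs - 4 * Rs - Ps" "Qs oo (- fps_X) = Qs" "Rs oo (- fps_X) = Rs"
    using compose_X2_uminus[of E2]
    by (simp_all add: E2_def compose_simps S1_hecke Qs_def Rs_def Ps_def algebra_simps)
  have "3 * (theta_b oo (- fps_X)) = 3 * theta_a"
    using arg_cong[OF three_ab(2), of "\<lambda>f. f oo (- fps_X)"]
    unfolding three_ab(1) by (simp add: compose_simps neg)
  hence b_neg: "theta_b oo (- fps_X) = theta_a" by simp
  show ?thesis
    using arg_cong[OF theta_theta_b, of "\<lambda>f. f oo (- fps_X)"] theta_compose_uminus[of theta_b, symmetric]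
    by (simp add: compose_simps neg b_neg algebra_simps)
qed

lemma theta_theta_c: "3 * theta theta_c = theta_c * (4 * Rs - Qs)"
proof (rule fps_numeral_cancel[of "num.Bit1 num.One"])
  have "3 * theta theta_c = 3 * theta theta_a - 3 * theta theta_b"
    by (simp add: theta_c_def theta_diff right_diff_distrib)
  also have "\<dots> = theta_a * (5 * Qs - Ps - 4 * Rs) - theta_b * (Ps - Qs)"
    by (simp only: theta_theta_a theta_theta_b)
  finally have "3 * (3 * theta theta_c) = (3 * theta_a) * (5 * Qs - Ps - 4 * Rs) - (3 * theta_b) * (Ps - Qs)"
    by (simp add: right_diff_distrib mult.assoc)
  also have "\<dots> = (3 * theta_c) * (4 * Rs - Qs)"
    unfolding three_ab by (simp add: algebra_simps)
  also have "\<dots> = 3 * (theta_c * (4 * Rs - Qs))" by (simp only: mult.assoc)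
  finally show "3 * (3 * theta theta_c) = 3 * (theta_c * (4 * Rs - Qs))" .
qed

section \<open>The Hauptmodul of level two\<close>

lemma fps_prod_nth_0: "(\<Prod>k\<in>A. f k) $ 0 = (\<Prod>k\<in>A. f k $ 0 :: complex)"
  by (induction A rule: infinite_finite_induct) auto

definition euler_product :: "complex fps" where
  "euler_product = (\<Prod>m. 1 - fps_X ^ Suc m)"

text \<open>Coefficients of the partial products stabilise, and one \<open>N\<close> serves all
  degrees up to \<open>n\<close>. This replaces the infinite product by finite ones in all later
  arguments.\<close>

lemma euler_product_coeff:
  "\<exists>N\<ge>n. \<forall>i\<le>n. (\<Prod>k\<le>N. 1 - fps_X ^ Suc k) $ i = euler_product $ i"
proof -
  define f :: "nat \<Rightarrow> complex fps" where "f = (\<lambda>k. 1 - fps_X ^ Suc k)"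
  have nth0: "f k $ 0 = 1" for k by (simp add: f_def)
  have nz: "f k \<noteq> 0" for k using nth0[of k] by auto
  have "f k - 1 = - (fps_X ^ Suc k)" for k by (simp add: f_def)
  hence "subdegree (f k - 1) = Suc k" for k by (simp only: subdegree_uminus subdegree_power subdegree_fps_X mult_1_right)
  from tendsto_prod_fps[of f "\<lambda>n. n", OF nz] this
  obtain P where P: "(\<lambda>n. \<Prod>k\<le>n. f k) \<longlonglongrightarrow> P" by auto
  have ev: "eventually (\<lambda>N. (\<Prod>k\<le>N. f k) $ i = P $ i) sequentially" for i
    using P unfolding tendsto_fps_iff by blast
  \<comment> \<open>\<open>has_prod\<close> asks for a nonzero limit, and the constant coefficient
    shows that P is one.\<close>
  obtain N0 where "(\<Prod>k\<le>N0. f k) $ 0 = P $ 0" using ev[of 0] by (auto simp: eventually_sequentially)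
  moreover have "(\<Prod>k\<le>N0. f k) $ 0 = 1" by (simp add: fps_prod_nth_0 nth0)
  ultimately have "P \<noteq> 0" by auto
  hence "f has_prod P" using P by (simp add: has_prod_def raw_has_prod_def)
  hence "euler_product = P" unfolding euler_product_def f_def[symmetric] by (rule has_prod_unique[symmetric])
  moreover have "eventually (\<lambda>N. N \<ge> n \<and> (\<forall>i\<in>{..n}. (\<Prod>k\<le>N. f k) $ i = P $ i)) sequentially"
    by (intro eventually_conj eventually_ge_at_top eventually_ball_finite) (use ev in auto)
  ultimately show ?thesis
    by (auto simp: eventually_sequentially f_def)
qed

lemma euler_product_nth_0: "euler_product $ 0 = 1"
proof -
  obtain N where "(\<Prod>k\<le>N. 1 - fps_X ^ Suc k) $ 0 = euler_product $ 0" using euler_product_coeff[of 0] by auto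
  thus ?thesis by (simp add: fps_prod_nth_0)
qed

lemma theta_euler_product: "theta euler_product = - S1 * euler_product"
proof (rule fps_ext)
  fix n
  \<comment> \<open>\<open>G k\<close> expands (k + 1) X^(k + 1) / (1 - X^(k + 1)), minus the
    logarithmic derivative of factor k. Summed over k this is the Lambert series
    \<open>S1\<close>.\<close>
  define G :: "nat \<Rightarrow> complex fps" where
    "G = (\<lambda>k. Abs_fps (\<lambda>i. if i > 0 \<and> Suc k dvd i then of_nat (Suc k) else 0))"
  have theta_factor: "theta (1 - fps_X ^ Suc k) = - G k * (1 - fps_X ^ Suc k)" for k
  proof (rule fps_ext)
    fix i
    have "(G k * (1 - fps_X ^ Suc k)) $ i = G k $ i - (if i \<ge> Suc k then G k $ (i - Suc k) else 0)"
      by (simp only: right_diff_distrib mult_1_right fps_sub_nth fps_X_power_mult_right_nth) auto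
    also have "\<dots> = (if i = Suc k then of_nat (Suc k) else 0)"
      by (auto simp: G_def dvd_minus_self simp del: of_nat_Suc intro: dvd_imp_le)
    finally show "theta (1 - fps_X ^ Suc k) $ i = (- G k * (1 - fps_X ^ Suc k)) $ i"
      by (auto simp: fps_X_power_nth simp del: power_Suc of_nat_Suc)
  qed
  obtain N where N: "N \<ge> n" "\<And>i. i \<le> n \<Longrightarrow> (\<Prod>k\<le>N. 1 - fps_X ^ Suc k) $ i = euler_product $ i"
    using euler_product_coeff[of n] by auto
  have sum_G: "(\<Sum>k\<le>N. G k) $ i = S1 $ i" if "i \<le> n" for i
  proof (cases "i = 0")
    case False
    have "(\<Sum>k\<le>N. G k) $ i = (\<Sum>k\<in>{..N} \<inter> {k. Suc k dvd i}. of_nat (Suc k))"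
      using False by (subst sum.inter_restrict) (auto simp: G_def fps_sum_nth)
    also have "\<dots> = (\<Sum>d | d dvd i. of_nat d)"
      by (rule sum.reindex_bij_witness[where i = "\<lambda>d. d - 1" and j = Suc])
         (use that N(1) False in \<open>auto dest: dvd_imp_le intro!: Nat.gr0I\<close>)
    finally show ?thesis using False by (simp add: S1_def lambert_nth)
  qed (simp add: G_def fps_sum_nth S1_def lambert_nth)
  have "theta euler_product $ n = theta (\<Prod>k\<le>N. 1 - fps_X ^ Suc k) $ n"
    using N(2)[of n] by (simp only: theta_nth order_refl)
  also have "theta (\<Prod>k\<le>N. 1 - fps_X ^ Suc k) = (\<Sum>k\<le>N. - G k) * (\<Prod>k\<le>N. 1 - fps_X ^ Suc k)"
    by (rule theta_prod) (rule theta_factor)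
  also have "\<dots> $ n = (- S1 * euler_product) $ n"
    unfolding fps_mult_nth using sum_G N(2) by (intro sum.cong) (auto simp: sum_negf)
  finally show "theta euler_product $ n = (- S1 * euler_product) $ n" .
qed

lemma snd_eta: "snd eta = euler_product"
  by (simp add: eta_def euler_product_def)

lemma Delta_eq: "Delta = fps_X * euler_product ^ 24"
  by (simp add: Delta_def snd_eta)

lemma theta_Delta: "theta Delta = Ps * Delta"
proof -
  have "theta Delta = fps_X * euler_product ^ 24 + fps_X * (24 * euler_product ^ 23 * theta euler_product)"
    unfolding Delta_eq theta_mult theta_power by (simp add: theta_def)
  also have "\<dots> = fps_X * euler_product ^ 24 - fps_X * (24 * S1 * (euler_product * euler_product ^ 23))"
    unfolding theta_euler_product by (simp add: algebra_simps)
  also have "euler_product * euler_product ^ 23 = euler_product ^ 24"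
    by (simp flip: power_Suc)
  finally show ?thesis
    by (simp add: Delta_eq Ps_def E2_def algebra_simps)
qed

lemma S1_nth_0: "S1 $ 0 = 0" and S1_nth_1: "S1 $ 1 = 1"
  by (simp_all add: S1_def lambert_nth)

lemma PQR_nth_0: "Ps $ 0 = 1" "Qs $ 0 = 1" "Rs $ 0 = 1"
  by (simp_all add: Ps_def Qs_def Rs_def E2_def S1_nth_0)

lemma theta_abc_nth: "theta_a $ 0 = 1" "theta_b $ 0 = 1" "theta_c $ 0 = 0" "theta_c $ 1 = 16"
proof -
  show 1: "theta_a $ 0 = 1" "theta_b $ 0 = 1"
    by (simp_all add: theta_a_def theta_b_def PQR_nth_0)
  thus "theta_c $ 0 = 0" by (simp add: theta_c_def)
  have "Ps $ 1 = - 24" by (simp only: Ps_def E2_def fps_sub_nth fps_numeral_mult_nth S1_nth_1) simp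
  moreover have "Qs $ 1 = 0" "Rs $ 1 = 0" by (simp_all add: Qs_def Rs_def fps_nth_compose_X_power)
  moreover have "3 * theta_c $ 1 = (6 * Qs - 4 * Rs - 2 * Ps) $ 1"
    by (simp only: three_ab(3)[symmetric] fps_numeral_mult_nth)
  ultimately show "theta_c $ 1 = 16"
    by (simp only: fps_sub_nth fps_numeral_mult_nth) simp
qed

section \<open>The Hauptmodul and its relations to E4, Delta and K\<close>

definition haupt :: "complex fps" where
  "haupt = fps_const (1 / 16) * theta_a * theta_c * inverse (theta_b ^ 2)"

definition haupt_unit :: "complex fps" where
  "haupt_unit = fps_shift 1 haupt"

abbreviation "E2_level2 \<equiv> 2 * Qs - Ps"

lemma haupt_mult: "16 * theta_b ^ 2 * haupt = theta_a * theta_c"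
proof -
  have "16 * theta_b ^ 2 * haupt = (16 * fps_const (1 / 16)) * (theta_a * theta_c * (theta_b ^ 2 * inverse (theta_b ^ 2)))"
    by (simp only: haupt_def mult_ac)
  also have "theta_b ^ 2 * inverse (theta_b ^ 2) = 1"
    by (rule inverse_mult_eq_1') (simp add: fps_nth_power_0 theta_abc_nth)
  finally show ?thesis by (simp add: numeral_fps_const)
qed

lemma haupt_nth: "haupt $ 0 = 0" "haupt $ 1 = 1"
proof -
  show 0: "haupt $ 0 = 0" by (simp add: haupt_def theta_abc_nth)
  have "(16 * theta_b ^ 2 * haupt) $ 1 = 16"
    unfolding haupt_mult by (simp add: fps_mult_nth theta_abc_nth theta_abc_nth(4)[simplified])
  thus "haupt $ 1 = 1" using 0
    by (simp add: fps_mult_nth[of _ haupt] fps_nth_power_0 theta_abc_nth)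
qed

lemma haupt_unit: "haupt = fps_X * haupt_unit" "haupt_unit $ 0 = 1"
proof -
  show "haupt = fps_X * haupt_unit"
    unfolding haupt_unit_def by (rule fps_ext) (auto simp: haupt_nth)
  show "haupt_unit $ 0 = 1" using haupt_nth by (simp add: haupt_unit_def)
qed

lemma theta_b_nonzero: "theta_b \<noteq> 0"
  using theta_abc_nth by auto

text \<open>Three times the logarithmic derivative is (5 Qs - Ps - 4 Rs) + (4 Rs - Qs) - 2 (Ps - Qs)
  = 3 (2 Qs - Ps).\<close>

lemma theta_haupt: "theta haupt = haupt * E2_level2"
proof -
  have "3 * theta (16 * theta_b ^ 2 * haupt) = 3 * theta (theta_a * theta_c)"
    by (simp only: haupt_mult)
  hence "16 * (2 * theta_b * (3 * theta theta_b) * haupt + theta_b ^ 2 * (3 * theta haupt)) =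
      (3 * theta theta_a) * theta_c + theta_a * (3 * theta theta_c)"
    by (simp add: theta_mult theta_power theta_numeral algebra_simps)
  hence "16 * (2 * theta_b * (theta_b * (Ps - Qs)) * haupt + theta_b ^ 2 * (3 * theta haupt)) =
      (theta_a * theta_c) * (4 * Qs - Ps)"
    unfolding theta_theta_a theta_theta_b theta_theta_c by (simp add: algebra_simps)
  hence "48 * theta_b ^ 2 * theta haupt = 48 * theta_b ^ 2 * (haupt * E2_level2)"
    unfolding haupt_mult[symmetric] by (simp add: algebra_simps power2_eq_square)
  thus ?thesis using theta_b_nonzero by simp
qed

lemma E4_haupt: "E4 = theta_b ^ 2 * (1 + 256 * haupt)"
proof -
  have "theta_b ^ 2 * (1 + 256 * haupt) = theta_b ^ 2 + 16 * (16 * theta_b ^ 2 * haupt)"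
    by (simp add: algebra_simps)
  thus ?thesis unfolding haupt_mult E4_theta by simp
qed

text \<open>The series is \<open>theta_a + theta_c\<close>, and (a + c)^2 = (a - c)^2 + 4 a c with a
  - c = \<open>theta_b\<close>.\<close>

lemma E2_level2_square: "E2_level2 ^ 2 = theta_b ^ 2 * (1 + 64 * haupt)"
proof -
  have "3 * E2_level2 = 3 * theta_a + 3 * theta_c"
    unfolding three_ab by simp
  hence "3 * E2_level2 = 3 * (theta_a + theta_c)" by (simp only: distrib_left)
  hence "E2_level2 = theta_a + theta_c" by (rule fps_numeral_cancel)
  hence "E2_level2 ^ 2 = (theta_a + theta_c) ^ 2" by simp
  also have "\<dots> = theta_b ^ 2 + 4 * (theta_a * theta_c)"
    by (simp add: theta_c_def power2_eq_square algebra_simps)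
  finally show ?thesis unfolding haupt_mult[symmetric] by (simp add: algebra_simps)
qed

text \<open>Both sides have logarithmic derivative \<open>Ps\<close>, as 2 (Ps - Qs) + (2 Qs - Ps) =
  Ps, and both begin with q; hence the comparison in degree 1.\<close>

lemma Delta_haupt: "Delta = theta_b ^ 6 * haupt"
proof (rule theta_ODE_unique[where m = 1])
  show "theta Delta = Ps * Delta" by (rule theta_Delta)
  have "3 * theta (theta_b ^ 6) = 6 * theta_b ^ 5 * (3 * theta theta_b)"
    by (simp add: theta_power)
  also have "\<dots> = 6 * (Ps - Qs) * (theta_b * theta_b ^ 5)"
    unfolding theta_theta_b by (simp only: mult_ac)
  also have "theta_b * theta_b ^ 5 = theta_b ^ 6" by (simp flip: power_Suc)
  finally have "3 * theta (theta_b ^ 6 * haupt) = 6 * (Ps - Qs) * theta_b ^ 6 * haupt + 3 * theta_b ^ 6 * (haupt * E2_level2)"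
    by (simp add: theta_mult theta_haupt distrib_left flip: mult.assoc)
  also have "\<dots> = 3 * (Ps * (theta_b ^ 6 * haupt))"
    by (simp add: algebra_simps)
  finally show "theta (theta_b ^ 6 * haupt) = Ps * (theta_b ^ 6 * haupt)" by (rule fps_numeral_cancel)
  show "Ps $ 0 = of_nat 1" by (simp add: PQR_nth_0)
  show "Delta $ 1 = (theta_b ^ 6 * haupt) $ 1"
    by (simp add: Delta_eq fps_mult_nth haupt_nth haupt_nth(2)[simplified] fps_nth_power_0
        euler_product_nth_0 theta_abc_nth)
qed

lemma E4_nth_0: "E4 $ 0 = 1"
  by (simp add: E4_def)

text \<open>\<open>theta_b ^ 6\<close> is a factor of both Delta and E4^3, so it cancels and K
  becomes a rational function of \<open>haupt\<close>.\<close>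

lemma K_eq: "K = 1728 * haupt * inverse ((1 + 256 * haupt) ^ 3)"
proof -
  have inv: "inverse (fps_to_fls f) = fps_to_fls (inverse f)" if "f $ 0 = 1" for f :: "complex fps"
    using that by (simp add: fls_inverse_fps_to_fls subdegree_eq_0)
  have "1728 / j_inv = fps_to_fls (1728 * Delta * inverse (E4 ^ 3))"
    unfolding j_inv_def by (simp add: fls_times_fps_to_fls fps_nth_power_0 E4_nth_0 divide_inverse mult_ac flip: inv)
  hence K: "K = 1728 * Delta * inverse (E4 ^ 3)"
    unfolding K_def by simp
  have "E4 ^ 3 = theta_b ^ 6 * (1 + 256 * haupt) ^ 3"
    by (simp add: E4_haupt power_mult_distrib flip: power_mult)
  hence "K = 1728 * haupt * (theta_b ^ 6 * inverse (theta_b ^ 6)) * inverse ((1 + 256 * haupt) ^ 3)"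
    unfolding K Delta_haupt by (simp add: fps_inverse_mult mult_ac)
  also have "theta_b ^ 6 * inverse (theta_b ^ 6) = 1"
    by (rule inverse_mult_eq_1') (simp add: fps_nth_power_0 theta_abc_nth)
  finally show ?thesis by simp
qed

lemma K_unit_eq: "K_unit = haupt_unit * inverse ((1 + 256 * haupt) ^ 3)"
proof -
  have "K = fps_X * (1728 * (haupt_unit * inverse ((1 + 256 * haupt) ^ 3)))"
    unfolding K_eq haupt_unit(1) by (simp add: mult_ac)
  hence "fps_shift 1 K = fps_shift 1 (fps_X * (1728 * (haupt_unit * inverse ((1 + 256 * haupt) ^ 3))))"
    by (rule arg_cong)
  moreover have "fps_shift 1 (fps_X * g) = g" for g :: "complex fps" by (rule fps_ext) simp
  ultimately have "fps_shift 1 K = 1728 * (haupt_unit * inverse ((1 + 256 * haupt) ^ 3))"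
    by (simp only:)
  thus ?thesis unfolding K_unit_def
    by (simp add: numeral_fps_const flip: mult.assoc)
qed

section \<open>Complex powers of power series and the hypergeometric factor\<close>

text \<open>The power u^c for u with constant term 1, shaped like the series in
  \<open>K_powr\<close>.\<close>

definition fpow :: "complex fps \<Rightarrow> complex \<Rightarrow> complex fps" where
  "fpow u c = fps_binomial c oo (u - 1)"

lemma fpow_nth_0 [simp]: "fpow u c $ 0 = 1"
  by (simp add: fpow_def)

lemma fpow_add: "u $ 0 = 1 \<Longrightarrow> fpow u (c + d) = fpow u c * fpow u d"
  by (simp add: fpow_def fps_binomial_add_mult fps_compose_mult_distrib)

lemma fpow_power: "u $ 0 = 1 \<Longrightarrow> fpow u c ^ n = fpow u (of_nat n * c)"
  by (simp add: fpow_def fps_compose_power fps_binomial_power)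

lemma fpow_of_nat: "u $ 0 = 1 \<Longrightarrow> fpow u (of_nat n) = u ^ n"
  by (simp add: fpow_def fps_binomial_of_nat fps_compose_add_distrib flip: fps_compose_power)

lemma fpow_0 [simp]: "fpow u 0 = 1"
  by (simp add: fpow_def)

lemma fpow_1: "u $ 0 = 1 \<Longrightarrow> fpow u 1 = u"
  using fpow_of_nat[of u 1] by simp

lemma fpow_uminus: "u $ 0 = 1 \<Longrightarrow> fpow u (- c) = inverse (fpow u c)"
  using fpow_add[of u c "- c"] by (intro fps_inverse_unique[symmetric]) simp

lemma theta_fpow:
  assumes "u $ 0 = 1"
  shows "u * theta (fpow u c) = fps_const c * theta u * fpow u c"
proof -
  have "(1 + fps_X) * fps_deriv (fps_binomial c) = (1 + fps_X) * inverse (1 + fps_X) * (fps_const c * fps_binomial c)"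
    by (simp add: fps_binomial_deriv fps_divide_unit mult_ac)
  hence "(1 + fps_X) * fps_deriv (fps_binomial c) = fps_const c * fps_binomial c"
    by (simp add: inverse_mult_eq_1')
  hence "((1 + fps_X) * fps_deriv (fps_binomial c)) oo (u - 1) = (fps_const c * fps_binomial c) oo (u - 1)"
    by simp
  hence *: "u * (fps_deriv (fps_binomial c) oo (u - 1)) = fps_const c * fpow u c"
    using assms by (simp add: fpow_def fps_compose_mult_distrib fps_compose_add_distrib)
  have "u * theta (fpow u c) = fps_X * fps_deriv u * (u * (fps_deriv (fps_binomial c) oo (u - 1)))"
    using assms by (simp add: theta_def fpow_def fps_compose_deriv mult_ac)
  thus ?thesis unfolding * by (simp add: theta_def mult_ac)
qed

text \<open>Composition with the binomial series hides multiplicativity in the base; this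
  characterisation by a differential equation makes it accessible.\<close>

lemma fpow_unique:
  assumes "u $ 0 = 1" "y $ 0 = 1" "u * theta y = fps_const c * theta u * y"
  shows "y = fpow u c"
proof (rule theta_ODE_unique[where m = 0])
  define v where "v = inverse u * (fps_const c * theta u)"
  have inv: "inverse u * u = 1" using assms by (simp add: inverse_mult_eq_1)
  have "inverse u * (u * theta y) = inverse u * (fps_const c * theta u * y)" using assms by simp
  thus "theta y = v * y" using inv by (simp add: v_def flip: mult.assoc)
  have "inverse u * (u * theta (fpow u c)) = inverse u * (fps_const c * theta u * fpow u c)"
    using theta_fpow[OF assms(1)] by simp
  thus "theta (fpow u c) = v * fpow u c" using inv by (simp add: v_def flip: mult.assoc)
  show "v $ 0 = of_nat 0" by (simp add: v_def)
qed (use assms in auto)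

lemma fpow_mult_base:
  assumes "u $ 0 = 1" "w $ 0 = 1"
  shows "fpow (u * w) c = fpow u c * fpow w c"
proof (rule fpow_unique[symmetric])
  have "u * w * theta (fpow u c * fpow w c) = w * (u * theta (fpow u c)) * fpow w c + u * fpow u c * (w * theta (fpow w c))"
    by (simp add: theta_mult algebra_simps)
  thus "u * w * theta (fpow u c * fpow w c) = fps_const c * theta (u * w) * (fpow u c * fpow w c)"
    unfolding theta_fpow[OF assms(1)] theta_fpow[OF assms(2)] by (simp add: theta_mult algebra_simps)
qed (use assms in auto)

lemma fpow_power_base:
  assumes "u $ 0 = 1"
  shows "fpow (u ^ n) c = fpow u (of_nat n * c)"
  by (induction n) (use assms in \<open>auto simp: fpow_mult_base fps_nth_power_0 fpow_add algebra_simps fpow_def[of 1]\<close>)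

lemma fpow_compose:
  assumes "u $ 0 = 1" "g $ 0 = 0"
  shows "fpow u c oo g = fpow (u oo g) c"
  unfolding fpow_def using assms by (subst fps_compose_assoc[symmetric]) (auto simp: fps_compose_sub_distrib)

lemma fpow_linear_nth: "fpow (1 + fps_const d * fps_X) c $ n = d ^ n * (c gchoose n)"
  by (simp add: fpow_def)

text \<open>In y^n - z^n the cofactor of y - z has constant coefficient n, so it is nonzero.\<close>

lemma fps_power_eq_imp_eq:
  fixes y z :: "complex fps"
  assumes "y ^ n = z ^ n" "n > 0" "y $ 0 = 1" "z $ 0 = 1"
  shows "y = z"
proof -
  have "(y - z) * (\<Sum>i<n. z ^ (n - Suc i) * y ^ i) = 0"
    using assms(1) by (simp flip: power_diff_sumr2)
  moreover have "(\<Sum>i<n. z ^ (n - Suc i) * y ^ i) $ 0 = of_nat n"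
    using assms by (simp add: fps_sum_nth fps_nth_power_0)
  hence "(\<Sum>i<n. z ^ (n - Suc i) * y ^ i) \<noteq> 0" using \<open>n > 0\<close> by auto
  ultimately show ?thesis by simp
qed

text \<open>Taking sixth powers removes all fractional exponents: both sides become Delta / q. The
  constant term 1 makes the root unique.\<close>

lemma euler_product_fourth_power:
  "euler_product ^ 4 = fpow haupt_unit (1 / 6) * E2_level2 * fpow (1 + 64 * haupt) (- 1 / 2)"
proof (rule fps_power_eq_imp_eq[of _ 6])
  define w where "w = 1 + 64 * haupt"
  have w0: "w $ 0 = 1" by (simp add: w_def haupt_nth)
  have "(fpow w (- 1 / 2)) ^ 6 = fpow w (- of_nat 3)"
    using w0 by (simp add: fpow_power)
  hence w6: "(fpow w (- 1 / 2)) ^ 6 * w ^ 3 = 1"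
    using w0 by (simp add: fpow_uminus fpow_of_nat inverse_mult_eq_1 fps_nth_power_0 del: of_nat_numeral)
  have u6: "fpow haupt_unit (1 / 6) ^ 6 = haupt_unit"
    by (simp add: fpow_power fpow_1 haupt_unit(2))
  have "E2_level2 ^ 6 = (E2_level2 ^ 2) ^ 3" by (simp flip: power_mult)
  also have "\<dots> = (theta_b ^ 2) ^ 3 * w ^ 3" unfolding E2_level2_square w_def by (rule power_mult_distrib)
  also have "(theta_b ^ 2) ^ 3 = theta_b ^ 6" by (simp flip: power_mult)
  finally have A6: "E2_level2 ^ 6 = theta_b ^ 6 * w ^ 3" .
  have "(fpow haupt_unit (1 / 6) * E2_level2 * fpow w (- 1 / 2)) ^ 6 =
      fpow haupt_unit (1 / 6) ^ 6 * E2_level2 ^ 6 * (fpow w (- 1 / 2)) ^ 6"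
    by (simp only: power_mult_distrib)
  also have "\<dots> = haupt_unit * theta_b ^ 6 * ((fpow w (- 1 / 2)) ^ 6 * w ^ 3)"
    unfolding u6 A6 by (simp only: mult_ac)
  also have "\<dots> = haupt_unit * theta_b ^ 6" by (simp only: w6 mult_1_right)
  finally have R: "(fpow haupt_unit (1 / 6) * E2_level2 * fpow w (- 1 / 2)) ^ 6 = haupt_unit * theta_b ^ 6" .
  have "fps_X * (euler_product ^ 4) ^ 6 = fps_X * (haupt_unit * theta_b ^ 6)"
    using Delta_haupt unfolding Delta_eq haupt_unit(1) by (simp add: mult_ac flip: power_mult)
  hence "(euler_product ^ 4) ^ 6 = haupt_unit * theta_b ^ 6" by simp
  thus "(euler_product ^ 4) ^ 6 = (fpow haupt_unit (1 / 6) * E2_level2 * fpow (1 + 64 * haupt) (- 1 / 2)) ^ 6"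
    using R by (simp add: w_def)
qed (simp_all add: fps_nth_power_0 euler_product_nth_0 PQR_nth_0)

section \<open>The hypergeometric series at K\<close>

lemma compose_mult_nth:
  fixes f g h :: "complex fps"
  assumes "g $ 0 = 0"
  shows "((f oo g) * h) $ k = (\<Sum>m\<le>k. f $ m * (g ^ m * h) $ k)"
proof -
  have f: "(f oo g) $ i = (\<Sum>m\<le>k. f $ m * (g ^ m) $ i)" if "i \<le> k" for i
    unfolding fps_compose_nth
    by (rule sum.mono_neutral_left) (use that assms in \<open>auto simp: startsby_zero_power_prefix\<close>)
  have "((f oo g) * h) $ k = (\<Sum>i=0..k. \<Sum>m\<le>k. f $ m * ((g ^ m) $ i * h $ (k - i)))"
    unfolding fps_mult_nth by (rule sum.cong) (auto simp: f sum_distrib_right mult.assoc)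
  also have "\<dots> = (\<Sum>m\<le>k. \<Sum>i=0..k. f $ m * ((g ^ m) $ i * h $ (k - i)))"
    by (rule sum.swap)
  finally show ?thesis by (simp add: fps_mult_nth sum_distrib_left)
qed

lemma pochhammer_times_two: "4 ^ m * (pochhammer ((a + 1) / 2) m * pochhammer ((a + 2) / 2) m) = pochhammer (a + 1 :: complex) (2 * m)"
  by (induction m) (simp_all add: pochhammer_Suc field_simps)

lemma pochhammer_times_three:
  "27 ^ m * (pochhammer (a / 3) m * pochhammer ((a + 1) / 3) m * pochhammer ((a + 2) / 3) m) = pochhammer (a :: complex) (3 * m)"
proof (induction m)
  case (Suc m)
  have "3 * Suc m = Suc (Suc (Suc (3 * m)))" by simp
  hence "pochhammer a (3 * Suc m) = pochhammer a (3 * m) * ((a + 3 * of_nat m) * (a + 3 * of_nat m + 1) * (a + 3 * of_nat m + 2))"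
    unfolding \<open>3 * Suc m = _\<close> pochhammer_Suc by (simp add: algebra_simps)
  also note Suc.IH[symmetric]
  also have "27 ^ m * (pochhammer (a / 3) m * pochhammer ((a + 1) / 3) m * pochhammer ((a + 2) / 3) m) *
        ((a + 3 * of_nat m) * (a + 3 * of_nat m + 1) * (a + 3 * of_nat m + 2)) =
      27 ^ Suc m * (pochhammer (a / 3) (Suc m) * pochhammer ((a + 1) / 3) (Suc m) * pochhammer ((a + 2) / 3) (Suc m))"
  proof -
    have "(a + 3 * of_nat m) * (a + 3 * of_nat m + 1) * (a + 3 * of_nat m + 2) =
        27 * ((a / 3 + of_nat m) * ((a + 1) / 3 + of_nat m) * ((a + 2) / 3 + of_nat m))"
      by (simp add: field_simps)
    thus ?thesis unfolding pochhammer_Suc power_Suc by (simp only: mult_ac)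
  qed
  finally show ?case by simp
qed auto

text \<open>This is a k-th difference with step 2 of a polynomial of degree j < k. In terms of
  generating functions, (1 + X)^(-c) (1 - (1 + X)^(-2))^k has order at least k.\<close>

lemma alternating_sum_pochhammer:
  assumes "j < k"
  shows "(\<Sum>m\<le>k. (- 1) ^ m * of_nat (k choose m) * pochhammer (c + 2 * of_nat m) j) = (0 :: complex)"
proof -
  define y :: "complex fps" where "y = fps_binomial (- 2)"
  have "(fps_binomial (- c) * (1 - y) ^ k) $ j = 0"
  proof -
    have "(1 - y) $ 0 = 0" by (simp add: y_def)
    hence "((1 - y) ^ k) $ i = 0" if "i \<le> j" for i
      using that assms by (auto intro: startsby_zero_power_prefix[rule_format])
    thus ?thesis by (simp add: fps_mult_nth)
  qed
  moreover have "(1 - y) ^ k = (\<Sum>m\<le>k. of_nat (k choose m) * (- y) ^ m * 1 ^ (k - m))"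
    using binomial_ring[of "- y" 1 k] by simp
  moreover have "(fps_binomial (- c) * (of_nat b * (- y) ^ m * 1 ^ (k - m))) $ j
      = (- 1) ^ m * of_nat b * (fps_binomial (- c) * y ^ m) $ j" for b m
  proof -
    have eq: "fps_binomial (- c) * (of_nat b * (- y) ^ m * 1 ^ (k - m)) =
        fps_const ((- 1) ^ m * of_nat b) * (fps_binomial (- c) * y ^ m)"
      by (cases "even m") (simp_all add: fps_of_nat[symmetric] mult_ac flip: fps_const_neg)
    show ?thesis unfolding eq by simp
  qed
  ultimately have "0 = (\<Sum>m\<le>k. (- 1) ^ m * of_nat (k choose m) * (fps_binomial (- c) * y ^ m) $ j)"
    by (simp only: sum_distrib_left fps_sum_nth)
  also have "\<dots> = (\<Sum>m\<le>k. (- 1) ^ m * of_nat (k choose m) * ((- (c + 2 * of_nat m)) gchoose j))"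
    by (intro sum.cong refl) (simp add: y_def fps_binomial_power mult.commute flip: fps_binomial_add_mult)
  also have "\<dots> = (- 1) ^ j / fact j * (\<Sum>m\<le>k. (- 1) ^ m * of_nat (k choose m) * pochhammer (c + 2 * of_nat m) j)"
    by (simp add: gbinomial_pochhammer sum_distrib_left mult_ac add.commute)
  finally show ?thesis by simp
qed

text \<open>Since 3m + (k - m) = 2m + k, the Pochhammer symbols combine to a (a + 1)_{2m} (a + 1 +
  2m)_{k - 1}. The denominator cancels, and what is left is a k-th difference of a polynomial of
  degree k - 1 in m.\<close>

lemma hypergeo_cubic_aux:
  fixes a :: complex
  assumes nz: "\<And>i::nat. a + 1 + of_nat i \<noteq> 0" and "k > 0"
  shows "(\<Sum>m\<le>k. (pochhammer a (3 * m) / (pochhammer (a + 1) (2 * m) * fact m)) * ((- a - 3 * of_nat m) gchoose (k - m))) = 0"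
proof -
  have poch_nz: "pochhammer (a + 1) i \<noteq> 0" for i
  proof
    assume "pochhammer (a + 1) i = 0"
    then obtain j where "a + 1 = - of_nat j" by (auto simp: pochhammer_eq_0_iff)
    thus False using nz[of j] by simp
  qed
  have summand: "(pochhammer a (3 * m) / (pochhammer (a + 1) (2 * m) * fact m)) * ((- a - 3 * of_nat m) gchoose (k - m))
      = (- 1) ^ k * a / fact k * ((- 1) ^ m * of_nat (k choose m) * pochhammer (a + 1 + 2 * of_nat m) (k - 1))"
    if "m \<le> k" for m
  proof -
    have "pochhammer a (3 * m) * pochhammer (a + 3 * of_nat m) (k - m) = pochhammer a (Suc (2 * m + (k - 1)))"
      using pochhammer_product'[of a "3 * m" "k - m"] that \<open>k > 0\<close> by (simp add: algebra_simps)
    also have "\<dots> = a * (pochhammer (a + 1) (2 * m) * pochhammer (a + 1 + 2 * of_nat m) (k - 1))"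
      unfolding pochhammer_rec by (simp add: pochhammer_product')
    finally have *: "pochhammer a (3 * m) * pochhammer (a + 3 * of_nat m) (k - m) =
       a * (pochhammer (a + 1) (2 * m) * pochhammer (a + 1 + 2 * of_nat m) (k - 1))" .
    have "(- 1) ^ k = (- 1) ^ (k - m) * ((- 1) ^ m :: complex)"
      using that by (simp flip: power_add)
    hence sgn: "(- 1) ^ (k - m) = ((- 1) ^ k * (- 1) ^ m :: complex)"
      by (simp add: mult.assoc flip: power_mult_distrib)
    have "(pochhammer a (3 * m) / (pochhammer (a + 1) (2 * m) * fact m)) * ((- a - 3 * of_nat m) gchoose (k - m)) =
      (- 1) ^ (k - m) * (pochhammer a (3 * m) * pochhammer (a + 3 * of_nat m) (k - m)) /
        (pochhammer (a + 1) (2 * m) * fact m * fact (k - m))"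
      by (simp add: gbinomial_pochhammer add.commute)
    also have "\<dots> = (- 1) ^ (k - m) * a * pochhammer (a + 1 + 2 * of_nat m) (k - 1) / (fact m * fact (k - m))"
      unfolding * using poch_nz[of "2 * m"] by (simp add: field_simps)
    also have "\<dots> = (- 1) ^ k * a / fact k * ((- 1) ^ m * of_nat (k choose m) * pochhammer (a + 1 + 2 * of_nat m) (k - 1))"
      unfolding sgn using that by (simp add: binomial_fact field_simps)
    finally show ?thesis .
  qed
  have "(\<Sum>m\<le>k. (pochhammer a (3 * m) / (pochhammer (a + 1) (2 * m) * fact m)) * ((- a - 3 * of_nat m) gchoose (k - m)))
     = (- 1) ^ k * a / fact k * (\<Sum>m\<le>k. (- 1) ^ m * of_nat (k choose m) * pochhammer (a + 1 + 2 * of_nat m) (k - 1))"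
    unfolding sum_distrib_left by (rule sum.cong[OF refl]) (rule summand, simp)
  also have "\<dots> = 0" using \<open>k > 0\<close> by (subst alternating_sum_pochhammer) auto
  finally show ?thesis .
qed

text \<open>The case \<open>b = (a + 1) / 2\<close> of Bailey's cubic transformation, in which a vanishing
  numerator parameter reduces the hypergeometric series on the other side to \<open>1\<close>.\<close>

lemma hypergeo_cubic:
  fixes a :: complex
  assumes nz: "\<And>i::nat. a + 1 + of_nat i \<noteq> 0"
  defines "H \<equiv> fps_hypergeo [a / 3, (a + 1) / 3, (a + 2) / 3] [(a + 2) / 2, (a + 1) / 2] 1"
  defines "w \<equiv> 1 + fps_const 256 * fps_X"
  shows "H oo (1728 * fps_X * fpow w (- 3)) = fpow w a"
proof -
  define g where "g = 1728 * fps_X * fpow w (- 3)"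
  have w0: "w $ 0 = 1" by (simp add: w_def)
  have H: "H $ m = 4 ^ m / 27 ^ m * (pochhammer a (3 * m) / (pochhammer (a + 1) (2 * m) * fact m))" for m
    unfolding H_def pochhammer_times_two[symmetric] pochhammer_times_three[symmetric]
    by (simp add: mult_ac)
  have gm: "(g ^ m * fpow w (- a)) $ k = 1728 ^ m * 256 ^ (k - m) * ((- a - 3 * of_nat m) gchoose (k - m))"
    if "m \<le> k" for m k
  proof -
    have "g ^ m * fpow w (- a) = fps_const (1728 ^ m) * (fps_X ^ m * (fpow w (- 3) ^ m * fpow w (- a)))"
      by (simp add: g_def power_mult_distrib numeral_fps_const mult_ac fps_const_power)
    also have "fpow w (- 3) ^ m * fpow w (- a) = fpow w (- a - 3 * of_nat m)"
    proof -
      have "of_nat m * (- 3) + (- a) = - a - 3 * of_nat m" by simp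
      thus ?thesis by (simp only: fpow_power[OF w0] fpow_add[OF w0, symmetric])
    qed
    finally show ?thesis
      using that unfolding w_def by (simp add: fps_X_power_mult_nth fpow_linear_nth)
  qed
  \<comment> \<open>Multiplying by w^(-a) absorbs it into the factor w^(-3m) of
    \<open>g ^ m\<close>, so every coefficient is a sum of the kind just shown to vanish.\<close>
  have "(H oo g) * fpow w (- a) = 1"
  proof (rule fps_ext)
    fix k
    have "((H oo g) * fpow w (- a)) $ k = (\<Sum>m\<le>k. H $ m * (g ^ m * fpow w (- a)) $ k)"
      by (rule compose_mult_nth) (simp add: g_def)
    also have "\<dots> = (\<Sum>m\<le>k. 256 ^ k * ((pochhammer a (3 * m) / (pochhammer (a + 1) (2 * m) * fact m)) * ((- a - 3 * of_nat m) gchoose (k - m))))"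
    proof (rule sum.cong)
      fix m assume "m \<in> {..k}"
      hence "m \<le> k" by simp
      \<comment> \<open>The ratio 4/27 comes from the multiplication formulas for Pochhammer
        symbols. As 4/27 * 1728 = 256, the total power of 256 does not depend on m.\<close>
      have "(4 ^ m / 27 ^ m) * (1728 ^ m * 256 ^ (k - m)) = (256 ^ m * 256 ^ (k - m) :: complex)"
        by (simp flip: power_divide power_mult_distrib mult.assoc)
      also have "\<dots> = 256 ^ k" using \<open>m \<le> k\<close> by (simp flip: power_add)
      finally have c: "(4 ^ m / 27 ^ m) * (1728 ^ m * 256 ^ (k - m)) = (256 ^ k :: complex)" .
      have "H $ m * (g ^ m * fpow w (- a)) $ k = ((4 ^ m / 27 ^ m) * (1728 ^ m * 256 ^ (k - m))) *
          ((pochhammer a (3 * m) / (pochhammer (a + 1) (2 * m) * fact m)) * ((- a - 3 * of_nat m) gchoose (k - m)))"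
        unfolding H gm[OF \<open>m \<le> k\<close>] by (simp only: mult_ac)
      thus "H $ m * (g ^ m * fpow w (- a)) $ k = 256 ^ k * ((pochhammer a (3 * m) / (pochhammer (a + 1) (2 * m) * fact m)) * ((- a - 3 * of_nat m) gchoose (k - m)))"
        unfolding c .
    qed simp
    also have "\<dots> = (1 :: complex fps) $ k"
      unfolding sum_distrib_left[symmetric]
      by (cases "k = 0") (use hypergeo_cubic_aux[OF nz, of k] in \<open>auto simp: sum_distrib_left\<close>)
    finally show "((H oo g) * fpow w (- a)) $ k = 1 $ k" .
  qed
  hence "(H oo g) * (fpow w (- a) * fpow w a) = fpow w a" by (simp flip: mult.assoc)
  moreover have "fpow w (- a) * fpow w a = 1" using w0 by (simp flip: fpow_add)
  ultimately show ?thesis by (simp add: g_def)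
qed

lemma hypergeo_K:
  fixes a :: complex
  assumes nz: "\<And>i::nat. a + 1 + of_nat i \<noteq> 0"
  shows "fps_hypergeo [a / 3, (a + 1) / 3, (a + 2) / 3] [(a + 2) / 2, (a + 1) / 2] 1 oo K = fpow (1 + 256 * haupt) a"
proof -
  define w :: "complex fps" where "w = 1 + fps_const 256 * fps_X"
  have w0: "w $ 0 = 1" by (simp add: w_def)
  have w_haupt: "w oo haupt = 1 + 256 * haupt"
    by (simp add: w_def haupt_nth fps_compose_add_distrib fps_compose_mult_distrib numeral_fps_const)
  have "K = 1728 * haupt * fpow (1 + 256 * haupt) (- of_nat 3)"
    unfolding K_eq by (simp add: fpow_uminus fpow_of_nat haupt_nth del: of_nat_numeral)
  also have "\<dots> = (1728 * fps_X * fpow w (- 3)) oo haupt"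
    by (simp add: haupt_nth fps_compose_mult_distrib fpow_compose w0 w_haupt)
  finally have K: "K = (1728 * fps_X * fpow w (- 3)) oo haupt" .
  show ?thesis
    unfolding K by (subst fps_compose_assoc)
      (simp_all add: haupt_nth hypergeo_cubic[OF nz, folded w_def] fpow_compose w0 w_haupt)
qed

text \<open>With a = 3t - 2, the power of K contributes w^(-a) and the 3F2 contributes w^a for w =
  \<open>1 + 256 * haupt\<close>, so w disappears. The exponents of \<open>haupt_unit\<close> add up
  to a/3 + 1/6 = t - 1/2. The bound on t gives a + 1 > 0, which keeps the lower parameters away from
  the poles.\<close>

lemma f_form_eq:
  fixes n :: nat and r :: int
  defines "t \<equiv> of_int r / of_nat n :: rat"
  assumes t: "t > 1 / 3"
  shows "fst (f_form n r) = t - 1 / 2"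
    "snd (f_form n r) = fps_const (complex_of_real (1728 powr of_rat (t - 2 / 3))) *
       (fpow haupt_unit (of_rat (t - 1 / 2)) * E2_level2 * fpow (1 + 64 * haupt) (- 1 / 2))"
proof -
  show "fst (f_form n r) = t - 1 / 2"
    by (simp add: f_form_def Let_def qser_mult_def qser_power_def eta_def K_powr_def qser_of_fps_def t_def)
  define C where "C = fps_const (complex_of_real (1728 powr of_rat (t - 2 / 3)))"
  define w where "w = 1 + 256 * haupt"
  have w0: "w $ 0 = 1" by (simp add: w_def haupt_nth)
  define a :: complex where "a = of_rat (3 * t - 2)"
  have nz: "a + 1 + of_nat i \<noteq> 0" for i :: nat
  proof -
    have "a + 1 + of_nat i = of_rat (3 * t - 2 + 1 + of_nat i)" by (simp add: a_def of_rat_add of_rat_diff)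
    moreover have "3 * t - 2 + 1 + of_nat i > 0" using t by simp
    ultimately show ?thesis by simp
  qed
  have params: "of_rat (t - 2 / 3) = a / 3" "of_rat (t - 1 / 3) = (a + 1) / 3" "of_rat t = (a + 2) / 3"
    "of_rat (3 / 2 * t) = (a + 2) / 2" "of_rat (3 / 2 * t - 1 / 2) = (a + 1) / 2"
    by (simp_all add: a_def of_rat_add of_rat_diff of_rat_mult of_rat_divide field_simps)
  have K_unit_0: "K_unit $ 0 = 1"
    unfolding K_unit_eq by (simp add: fps_nth_power_0 haupt_unit(2) haupt_nth)
  have "K_unit * w ^ 3 = haupt_unit"
    unfolding K_unit_eq w_def[symmetric] using w0
    by (simp add: mult.assoc inverse_mult_eq_1 fps_nth_power_0)
  hence "fpow K_unit (a / 3) * fpow (w ^ 3) (a / 3) = fpow haupt_unit (a / 3)"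
    using w0 K_unit_0 by (simp add: fps_nth_power_0 flip: fpow_mult_base)
  hence pw: "fpow K_unit (a / 3) * fpow w a = fpow haupt_unit (a / 3)"
    using w0 by (simp add: fpow_power_base)
  have "snd (f_form n r) = euler_product ^ 4 * (C * fpow K_unit (a / 3)) * fpow w a"
    unfolding f_form_def t_def[symmetric] Let_def params hypergeo_K[OF nz]
    by (simp add: qser_mult_def qser_power_def snd_eta K_powr_def qser_of_fps_def C_def w_def
        fpow_def[of K_unit] flip: params)
  also have "\<dots> = C * (euler_product ^ 4 * (fpow K_unit (a / 3) * fpow w a))" by (simp only: mult_ac)
  also have "\<dots> = C * ((fpow haupt_unit (a / 3) * fpow haupt_unit (1 / 6)) * E2_level2 * fpow (1 + 64 * haupt) (- 1 / 2))"
    unfolding pw euler_product_fourth_power by (simp only: mult_ac)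
  also have "fpow haupt_unit (a / 3) * fpow haupt_unit (1 / 6) = fpow haupt_unit (a / 3 + 1 / 6)"
    using haupt_unit(2) by (simp add: fpow_add)
  also have "a / 3 + 1 / 6 = of_rat (t - 1 / 2)"
    by (simp add: a_def of_rat_diff of_rat_mult of_rat_divide field_simps)
  finally show "snd (f_form n r) = fps_const (complex_of_real (1728 powr of_rat (t - 2 / 3))) *
       (fpow haupt_unit (of_rat (t - 1 / 2)) * E2_level2 * fpow (1 + 64 * haupt) (- 1 / 2))"
    by (simp add: C_def)
qed

section \<open>Congruences between power series\<close>

text \<open>The localisation of the integers at p, embedded in the complex numbers.\<close>

definition pint :: "nat \<Rightarrow> complex set" where
  "pint p = {of_int a / of_int b | a b. \<not> int p dvd b}"

definition pideal :: "nat \<Rightarrow> nat \<Rightarrow> complex set" where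
  "pideal p e = {of_nat p ^ e * z | z. z \<in> pint p}"

definition pideal_fps :: "nat \<Rightarrow> nat \<Rightarrow> complex fps set" where
  "pideal_fps p e = {f. \<forall>n. f $ n \<in> pideal p e}"

lemma pideal_0: "pideal p 0 = pint p"
  by (simp add: pideal_def)

context
  fixes p :: nat
  assumes p: "prime p"
begin

lemma pint_of_int: "of_int a \<in> pint p"
proof -
  have "(of_int a :: complex) = of_int a / of_int 1" "\<not> int p dvd 1" using prime_gt_1_nat[OF p] by auto
  thus ?thesis unfolding pint_def by blast
qed

lemma pint_of_nat: "of_nat a \<in> pint p"
  using pint_of_int[of "int a"] by simp

lemma pint_0: "0 \<in> pint p" and pint_1: "1 \<in> pint p"
  using pint_of_int[of 0] pint_of_int[of 1] by auto

lemma prime_int_p: "prime (int p)"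
  using p by simp

lemma pint_add: assumes "x \<in> pint p" "y \<in> pint p" shows "x + y \<in> pint p"
proof -
  obtain a b c d where *: "x = of_int a / of_int b" "\<not> int p dvd b" "y = of_int c / of_int d" "\<not> int p dvd d"
    using assms by (auto simp: pint_def)
  hence "b \<noteq> 0" "d \<noteq> 0" by auto
  hence "x + y = of_int (a * d + c * b) / of_int (b * d)" using * by (simp add: field_simps)
  moreover have "\<not> int p dvd b * d" using * prime_dvd_mult_iff[OF prime_int_p] by auto
  ultimately show ?thesis unfolding pint_def by blast
qed

lemma pint_mult: assumes "x \<in> pint p" "y \<in> pint p" shows "x * y \<in> pint p"
proof -
  obtain a b c d where *: "x = of_int a / of_int b" "\<not> int p dvd b" "y = of_int c / of_int d" "\<not> int p dvd d"
    using assms by (auto simp: pint_def)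
  hence "x * y = of_int (a * c) / of_int (b * d)" by simp
  moreover have "\<not> int p dvd b * d" using * prime_dvd_mult_iff[OF prime_int_p] by auto
  ultimately show ?thesis unfolding pint_def by blast
qed

lemma pint_divide_int: assumes "x \<in> pint p" "\<not> int p dvd b" shows "x / of_int b \<in> pint p"
proof -
  have "of_int 1 / of_int b \<in> pint p" using assms(2) unfolding pint_def by blast
  from pint_mult[OF assms(1) this] show ?thesis by simp
qed

lemma pint_divide_nat: assumes "x \<in> pint p" "\<not> p dvd b" shows "x / of_nat b \<in> pint p"
  using pint_divide_int[of x "int b"] assms by simp

lemma pint_uminus: "x \<in> pint p \<Longrightarrow> - x \<in> pint p"
  using pint_mult[OF pint_of_int[of "- 1"]] by simp

lemma pint_diff: "x \<in> pint p \<Longrightarrow> y \<in> pint p \<Longrightarrow> x - y \<in> pint p"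
  using pint_add[of x "- y"] pint_uminus by simp

lemma pint_sum: "(\<And>i. i \<in> A \<Longrightarrow> f i \<in> pint p) \<Longrightarrow> sum f A \<in> pint p"
  by (induction A rule: infinite_finite_induct) (auto simp: pint_0 pint_add)

lemma pideal_0I: "0 \<in> pideal p e"
  unfolding pideal_def using pint_0 by force

lemma pideal_add: assumes "x \<in> pideal p e" "y \<in> pideal p e" shows "x + y \<in> pideal p e"
proof -
  obtain z z' where "x = of_nat p ^ e * z" "y = of_nat p ^ e * z'" "z \<in> pint p" "z' \<in> pint p"
    using assms by (auto simp: pideal_def)
  hence "x + y = of_nat p ^ e * (z + z')" "z + z' \<in> pint p" by (auto simp: distrib_left pint_add)
  thus ?thesis by (auto simp: pideal_def)
qed

lemma pideal_mult: assumes "x \<in> pideal p d" "y \<in> pideal p e" shows "x * y \<in> pideal p (d + e)"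
proof -
  obtain z z' where "x = of_nat p ^ d * z" "y = of_nat p ^ e * z'" "z \<in> pint p" "z' \<in> pint p"
    using assms by (auto simp: pideal_def)
  hence "x * y = of_nat p ^ (d + e) * (z * z')" "z * z' \<in> pint p" by (auto simp: pint_mult power_add)
  thus ?thesis by (auto simp: pideal_def)
qed

lemma pideal_mult_right: "x \<in> pideal p d \<Longrightarrow> y \<in> pint p \<Longrightarrow> x * y \<in> pideal p d"
  using pideal_mult[of x d y 0] by (simp add: pideal_0)

lemma pideal_uminus: "x \<in> pideal p e \<Longrightarrow> - x \<in> pideal p e"
  using pideal_mult_right[of x e "- 1"] pint_of_int[of "- 1"] by simp

lemma pideal_diff: "x \<in> pideal p e \<Longrightarrow> y \<in> pideal p e \<Longrightarrow> x - y \<in> pideal p e"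
  using pideal_add[of x e "- y"] pideal_uminus by simp

lemma pideal_sum: "(\<And>i. i \<in> A \<Longrightarrow> f i \<in> pideal p e) \<Longrightarrow> sum f A \<in> pideal p e"
  by (induction A rule: infinite_finite_induct) (auto simp: pideal_0I pideal_add)

lemma pideal_mono: assumes "x \<in> pideal p e" "d \<le> e" shows "x \<in> pideal p d"
proof -
  obtain z where "x = of_nat p ^ e * z" "z \<in> pint p" using assms by (auto simp: pideal_def)
  hence "x = of_nat p ^ d * (of_nat (p ^ (e - d)) * z)"
    using assms(2) by (simp flip: power_add mult.assoc)
  thus ?thesis unfolding pideal_def using \<open>z \<in> pint p\<close> pint_mult pint_of_nat by blast
qed

lemma pideal_of_int: assumes "int p ^ e dvd a" shows "of_int a \<in> pideal p e"
proof -
  obtain b where "a = int p ^ e * b" using assms by auto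
  thus ?thesis unfolding pideal_def using pint_of_int[of b] by auto
qed

lemma pideal_fps_add: "f \<in> pideal_fps p e \<Longrightarrow> g \<in> pideal_fps p e \<Longrightarrow> f + g \<in> pideal_fps p e"
  by (auto simp: pideal_fps_def pideal_add)

lemma pideal_fps_diff: "f \<in> pideal_fps p e \<Longrightarrow> g \<in> pideal_fps p e \<Longrightarrow> f - g \<in> pideal_fps p e"
  by (auto simp: pideal_fps_def pideal_diff)

lemma pideal_fps_mult: "f \<in> pideal_fps p d \<Longrightarrow> g \<in> pideal_fps p e \<Longrightarrow> f * g \<in> pideal_fps p (d + e)"
  by (auto simp: pideal_fps_def fps_mult_nth intro!: pideal_sum pideal_mult)

lemma pideal_fps_mult_right: "f \<in> pideal_fps p d \<Longrightarrow> g \<in> pideal_fps p 0 \<Longrightarrow> f * g \<in> pideal_fps p d"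
  using pideal_fps_mult[of f d g 0] by simp

lemma pideal_fps_mono: "f \<in> pideal_fps p e \<Longrightarrow> d \<le> e \<Longrightarrow> f \<in> pideal_fps p d"
  using pideal_mono by (auto simp: pideal_fps_def)

lemma pideal_fps_sum: "(\<And>i. i \<in> A \<Longrightarrow> f i \<in> pideal_fps p e) \<Longrightarrow> sum f A \<in> pideal_fps p e"
  by (auto simp: pideal_fps_def fps_sum_nth intro!: pideal_sum)

lemma pideal_fps_const: "c \<in> pideal p e \<Longrightarrow> fps_const c \<in> pideal_fps p e"
  by (auto simp: pideal_fps_def pideal_0I)

lemma pideal_fps_1: "1 \<in> pideal_fps p 0"
  by (auto simp: pideal_fps_def pideal_0I pideal_0 pint_1 pint_0)

lemma pideal_fps_of_nat: "p ^ e dvd k \<Longrightarrow> of_nat k \<in> pideal_fps p e"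
  unfolding fps_of_nat[symmetric] using pideal_of_int[of e "int k"]
  by (intro pideal_fps_const) (simp flip: of_nat_power)

lemma pideal_fps_power: "f \<in> pideal_fps p 0 \<Longrightarrow> f ^ n \<in> pideal_fps p 0"
  by (induction n) (auto simp: pideal_fps_1 dest: pideal_fps_mult_right)

lemma pideal_fps_compose: "f \<in> pideal_fps p 0 \<Longrightarrow> g \<in> pideal_fps p 0 \<Longrightarrow> f oo g \<in> pideal_fps p 0"
  using pideal_fps_power[of g]
  by (auto simp: pideal_fps_def fps_compose_nth pideal_0 intro!: pint_sum pint_mult)

lemma pideal_fps_X_power: "fps_X ^ n \<in> pideal_fps p 0"
  by (auto simp: pideal_fps_def pideal_0 pint_0 pint_1)

section \<open>Congruences for powers and Frobenius\<close>

lemma pideal_fps_diff_power: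
  assumes "u - v \<in> pideal_fps p e" "u \<in> pideal_fps p 0" "v \<in> pideal_fps p 0"
  shows "u ^ i - v ^ i \<in> pideal_fps p e"
  unfolding power_diff_sumr2 using assms
  by (auto intro!: pideal_fps_mult_right pideal_fps_sum pideal_fps_power)

text \<open>The cofactor of u - v in u^p - v^p is congruent to p v^(p - 1) modulo p, so it
  contributes one more factor p.\<close>

lemma pideal_fps_diff_prime_power:
  assumes uv: "u - v \<in> pideal_fps p e" "u \<in> pideal_fps p 0" "v \<in> pideal_fps p 0" and "e > 0"
  shows "u ^ p - v ^ p \<in> pideal_fps p (Suc e)"
proof -
  have "(\<Sum>i<p. v ^ (p - Suc i) * u ^ i) - of_nat p * v ^ (p - 1) = (\<Sum>i<p. v ^ (p - Suc i) * (u ^ i - v ^ i))"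
    by (simp add: right_diff_distrib sum_subtractf flip: power_add)
  also have "\<dots> \<in> pideal_fps p e"
    using pideal_fps_mult[of _ 0 _ e] pideal_fps_diff_power[OF uv] pideal_fps_power uv(3)
    by (auto intro!: pideal_fps_sum)
  finally have "(\<Sum>i<p. v ^ (p - Suc i) * u ^ i) - of_nat p * v ^ (p - 1) \<in> pideal_fps p 1"
    using \<open>e > 0\<close> by (auto intro: pideal_fps_mono)
  moreover have "of_nat p * v ^ (p - 1) \<in> pideal_fps p 1"
    using uv(3) by (intro pideal_fps_mult_right pideal_fps_of_nat pideal_fps_power) auto
  ultimately have "(\<Sum>i<p. v ^ (p - Suc i) * u ^ i) \<in> pideal_fps p 1"
    using pideal_fps_add by fastforce
  from pideal_fps_mult[OF uv(1) this] show ?thesis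
    unfolding power_diff_sumr2 by simp
qed

text \<open>For i = p^s l, the preceding step applied s times lifts the congruence to modulus p^(s +
  1), and the l-th power preserves it.\<close>

lemma pideal_fps_diff_multiplicity:
  assumes uv: "u - v \<in> pideal_fps p 1" "u \<in> pideal_fps p 0" "v \<in> pideal_fps p 0"
  shows "u ^ i - v ^ i \<in> pideal_fps p (Suc (multiplicity p i))"
proof -
  have pw: "u ^ (p ^ s) - v ^ (p ^ s) \<in> pideal_fps p (Suc s)" for s
  proof (induction s)
    case (Suc s)
    have "(u ^ (p ^ s)) ^ p - (v ^ (p ^ s)) ^ p \<in> pideal_fps p (Suc (Suc s))"
      using Suc uv by (intro pideal_fps_diff_prime_power pideal_fps_power) auto
    thus ?case by (simp add: mult.commute flip: power_mult)
  qed (use uv in auto)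
  obtain l where l: "i = p ^ multiplicity p i * l"
    using multiplicity_dvd[of p i] by blast
  have "(u ^ (p ^ multiplicity p i)) ^ l - (v ^ (p ^ multiplicity p i)) ^ l \<in> pideal_fps p (Suc (multiplicity p i))"
    using uv by (intro pideal_fps_diff_power pideal_fps_power pw)
  thus ?thesis using l by (simp flip: power_mult)
qed

lemma pideal_fps_freshman:
  assumes "f \<in> pideal_fps p 0" "g \<in> pideal_fps p 0"
  shows "(f + g) ^ p - (f ^ p + g ^ p) \<in> pideal_fps p 1"
proof -
  have "(f + g) ^ p = (\<Sum>k\<le>p. of_nat (p choose k) * f ^ k * g ^ (p - k))" by (rule binomial_ring)
  also have "{..p} = insert 0 (insert p {0<..<p})" using prime_gt_0_nat[OF p] by auto
  finally have "(f + g) ^ p - (f ^ p + g ^ p) = (\<Sum>k\<in>{0<..<p}. of_nat (p choose k) * f ^ k * g ^ (p - k))"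
    using prime_gt_0_nat[OF p] by simp
  also have "\<dots> \<in> pideal_fps p 1"
    using assms p by (intro pideal_fps_sum pideal_fps_mult_right pideal_fps_of_nat pideal_fps_power)
      (auto intro!: dvd_choose_prime)
  finally show ?thesis .
qed

lemma fermat_int: "int p dvd a ^ p - a"
proof (cases "int p dvd a")
  case True
  thus ?thesis using prime_gt_0_nat[OF p] by (auto intro!: dvd_diff intro: dvd_trans[OF _ dvd_power])
next
  case False
  define b where "b = nat (a mod int p)"
  have b: "int b = a mod int p" using prime_gt_0_nat[OF p] by (simp add: b_def)
  hence "\<not> p dvd b" using False by (metis int_dvd_int_iff dvd_mod_iff dvd_refl)
  hence "[b ^ (p - 1) = 1] (mod p)" using p by (intro fermat_theorem)
  hence "[int b ^ (p - 1) = 1] (mod int p)" by (metis cong_int_iff of_nat_1 of_nat_power)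
  moreover have "[int b = a] (mod int p)" by (simp add: b cong_def)
  ultimately have "[a ^ (p - 1) * a = 1 * a] (mod int p)"
    by (meson cong_mult cong_pow cong_refl cong_sym cong_trans)
  moreover have "a ^ (p - 1) * a = a ^ p"
    using prime_gt_0_nat[OF p] by (simp flip: power_Suc2)
  ultimately show ?thesis by (simp add: cong_iff_dvd_diff)
qed

lemma pint_fermat:
  assumes "x \<in> pint p" shows "x ^ p - x \<in> pideal p 1"
proof -
  obtain a b where x: "x = of_int a / of_int b" "\<not> int p dvd b" using assms by (auto simp: pint_def)
  hence "b \<noteq> 0" by auto
  have "int p dvd (a ^ p - a) * b - a * (b ^ p - b)"
    using fermat_int[of a] fermat_int[of b] by (meson dvd_diff dvd_mult dvd_mult2)
  then obtain d where "(a ^ p - a) * b - a * (b ^ p - b) = int p * d" by (elim dvdE)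
  hence d: "a ^ p * b - a * b ^ p = int p * d" by (simp add: algebra_simps)
  have "x ^ p - x = of_int (a ^ p * b - a * b ^ p) / of_int (b ^ p * b)"
    using \<open>b \<noteq> 0\<close> by (simp add: x power_divide field_simps)
  also have "\<dots> = of_nat p ^ 1 * (of_int d / of_int (b ^ p * b))" unfolding d by simp
  finally have "x ^ p - x = of_nat p ^ 1 * (of_int d / of_int (b ^ p * b))" .
  moreover have "\<not> int p dvd b ^ p * b"
    using x(2) prime_int_p prime_dvd_mult_iff[OF prime_int_p] prime_dvd_power by blast
  ultimately show ?thesis unfolding pideal_def pint_def by blast
qed

text \<open>Write f = f(0) + X g. Fermat's theorem handles the constant, and the rest is X^p times
  the same expression for g, so coefficient n reduces to coefficient n - p.\<close>

lemma pideal_fps_frobenius: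
  assumes "f \<in> pideal_fps p 0"
  shows "f ^ p - (f oo fps_X ^ p) \<in> pideal_fps p 1"
proof -
  note [simp] = prime_gt_0_nat[OF p]
  have "(f ^ p - (f oo fps_X ^ p)) $ n \<in> pideal p 1" if "f \<in> pideal_fps p 0" for n f
    using that
  proof (induction n arbitrary: f rule: less_induct)
    case (less n)
    define g where "g = fps_shift 1 f"
    have g: "g \<in> pideal_fps p 0" using less.prems by (simp add: g_def pideal_fps_def)
    have f0: "f $ 0 \<in> pint p" using less.prems by (simp add: pideal_fps_def pideal_0)
    have f: "f = fps_const (f $ 0) + fps_X * g" by (rule fps_ext) (auto simp: g_def)
    define E where "E = f ^ p - (fps_const (f $ 0) ^ p + (fps_X * g) ^ p)"
    have "E \<in> pideal_fps p 1"
      unfolding E_def using f pideal_fps_freshman[of "fps_const (f $ 0)" "fps_X * g"]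
        pideal_fps_mult[OF pideal_fps_X_power[of 1] g] f0
      by (simp add: pideal_fps_const pideal_0)
    hence E: "E $ n \<in> pideal p 1" by (auto simp: pideal_fps_def)
    have "f oo fps_X ^ p = fps_const (f $ 0) + fps_X ^ p * (g oo fps_X ^ p)"
      by (subst f) (simp add: fps_compose_add_distrib fps_compose_mult_distrib)
    moreover have "f ^ p = E + fps_const ((f $ 0) ^ p) + fps_X ^ p * g ^ p"
      by (simp add: E_def power_mult_distrib fps_const_power)
    ultimately have eq: "f ^ p - (f oo fps_X ^ p) =
        E + fps_const ((f $ 0) ^ p - f $ 0) + fps_X ^ p * (g ^ p - (g oo fps_X ^ p))"
      by (simp add: algebra_simps flip: fps_const_sub)
    have 1: "fps_const ((f $ 0) ^ p - f $ 0) $ n \<in> pideal p 1"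
      using pint_fermat[OF f0] by (simp add: pideal_0I)
    have 2: "(fps_X ^ p * (g ^ p - (g oo fps_X ^ p))) $ n \<in> pideal p 1"
    proof (cases "n < p")
      case False
      moreover have "n - p < n" using False prime_gt_0_nat[OF p] by linarith
      ultimately show ?thesis using less.IH[of "n - p" g] g by (simp add: fps_X_power_mult_nth)
    qed (simp add: fps_X_power_mult_nth pideal_0I)
    show ?case unfolding eq fps_add_nth by (intro pideal_add E 1 2)
  qed
  thus ?thesis using assms by (auto simp: pideal_fps_def)
qed

lemma pideal_fps_frobenius_square:
  assumes "f \<in> pideal_fps p 0"
  shows "f ^ p\<^sup>2 - (f oo fps_X ^ p\<^sup>2) \<in> pideal_fps p 1"
proof -
  note [simp] = prime_gt_0_nat[OF p]
  define g where "g = f oo fps_X ^ p"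
  have g: "g \<in> pideal_fps p 0" unfolding g_def using assms by (intro pideal_fps_compose pideal_fps_X_power)
  have "(f ^ p) ^ p - g ^ p \<in> pideal_fps p 1"
    unfolding g_def using assms g unfolding g_def
    by (intro pideal_fps_diff_power pideal_fps_frobenius pideal_fps_power)
  moreover have "g ^ p - (g oo fps_X ^ p) \<in> pideal_fps p 1" by (intro pideal_fps_frobenius g)
  ultimately have "(f ^ p) ^ p - (g oo fps_X ^ p) \<in> pideal_fps p 1"
    using pideal_fps_add by fastforce
  moreover have "fps_X ^ p oo fps_X ^ p = (fps_X ^ p\<^sup>2 :: complex fps)"
    by (subst fps_X_power_compose) (auto simp: power2_eq_square simp flip: power_mult)
  hence "g oo fps_X ^ p = f oo fps_X ^ p\<^sup>2"
    unfolding g_def by (subst fps_compose_assoc[symmetric]) auto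
  ultimately show ?thesis by (simp add: power2_eq_square flip: power_mult)
qed

text \<open>Honda's functional equation lemma for the special element \<open>p + T\<^sup>2\<close>.\<close>

lemma honda_substitution:
  assumes psi: "\<psi> \<in> pideal_fps p 0" "\<psi> $ 0 = 0"
    and w0: "w 0 = 0"
    and w1: "\<And>j. of_nat j * w j \<in> pint p"
    and w2: "\<And>j. \<not> p\<^sup>2 dvd j \<Longrightarrow> w j \<in> pint p"
    and w3: "\<And>i. w (p\<^sup>2 * i) + w i / of_nat p \<in> pint p"
  defines "L \<equiv> Abs_fps w oo \<psi>"
  shows "L $ (p\<^sup>2 * m) + L $ m / of_nat p \<in> pint p"
proof -
  note [simp] = prime_gt_0_nat[OF p]
  have psi_pow: "(\<psi> ^ j) $ i \<in> pint p" for i j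
    using pideal_fps_power[OF psi(1), of j] by (auto simp: pideal_fps_def pideal_0)
  have "L $ (p\<^sup>2 * m) = (\<Sum>j\<in>{0..p\<^sup>2 * m}. w j * (\<psi> ^ j) $ (p\<^sup>2 * m))"
    by (simp add: L_def fps_compose_nth)
  also have "\<dots> = (\<Sum>j\<in>{j\<in>{0..p\<^sup>2 * m}. p\<^sup>2 dvd j}. w j * (\<psi> ^ j) $ (p\<^sup>2 * m))
      + (\<Sum>j\<in>{j\<in>{0..p\<^sup>2 * m}. \<not> p\<^sup>2 dvd j}. w j * (\<psi> ^ j) $ (p\<^sup>2 * m))"
    by (subst sum.union_disjoint[symmetric]) (auto intro!: sum.cong)
  also have "(\<Sum>j\<in>{j\<in>{0..p\<^sup>2 * m}. p\<^sup>2 dvd j}. w j * (\<psi> ^ j) $ (p\<^sup>2 * m)) =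
      (\<Sum>i\<in>{0..m}. w (p\<^sup>2 * i) * (\<psi> ^ (p\<^sup>2 * i)) $ (p\<^sup>2 * m))"
    by (rule sum.reindex_bij_witness[where i = "\<lambda>i. p\<^sup>2 * i" and j = "\<lambda>j. j div p\<^sup>2"]) auto
  finally have L1: "L $ (p\<^sup>2 * m) = (\<Sum>i\<in>{0..m}. w (p\<^sup>2 * i) * (\<psi> ^ (p\<^sup>2 * i)) $ (p\<^sup>2 * m))
      + (\<Sum>j\<in>{j\<in>{0..p\<^sup>2 * m}. \<not> p\<^sup>2 dvd j}. w j * (\<psi> ^ j) $ (p\<^sup>2 * m))" .
  have L2: "L $ m = (\<Sum>i\<in>{0..m}. w i * (\<psi> ^ i) $ m)"
    by (simp add: L_def fps_compose_nth)
  \<comment> \<open>With s = v_p(i), \<psi>^(p^2 i) and \<psi>^i at X^(p^2) agree modulo p^(s + 1).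
    By \<open>w1\<close> the denominator of \<open>w i\<close> contains at most p^s, so the division
    by p does no harm.\<close>
  have small: "w i * ((\<psi> ^ (p\<^sup>2 * i)) $ (p\<^sup>2 * m) - (\<psi> ^ i) $ m) / of_nat p \<in> pint p" for i
  proof (cases "i = 0")
    case False
    define s where "s = multiplicity p i"
    obtain l where l: "i = p ^ s * l" "\<not> p dvd l"
      using multiplicity_decompose'[of i p] False p not_prime_1 unfolding s_def by (metis nat_dvd_1_iff_1)
    have "(\<psi> ^ p\<^sup>2) ^ i - (\<psi> oo fps_X ^ p\<^sup>2) ^ i \<in> pideal_fps p (Suc s)"
      unfolding s_def using psi(1)
      by (intro pideal_fps_diff_multiplicity pideal_fps_frobenius_square pideal_fps_power
          pideal_fps_compose pideal_fps_X_power)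
    hence "((\<psi> ^ p\<^sup>2) ^ i - (\<psi> oo fps_X ^ p\<^sup>2) ^ i) $ (p\<^sup>2 * m) \<in> pideal p (Suc s)"
      by (auto simp: pideal_fps_def)
    also have "(\<psi> oo fps_X ^ p\<^sup>2) ^ i = \<psi> ^ i oo fps_X ^ p\<^sup>2"
      by (rule fps_compose_power) simp
    finally have "(\<psi> ^ (p\<^sup>2 * i)) $ (p\<^sup>2 * m) - (\<psi> ^ i) $ m \<in> pideal p (Suc s)"
      by (simp add: fps_nth_compose_X_power flip: power_mult)
    then obtain z where z: "(\<psi> ^ (p\<^sup>2 * i)) $ (p\<^sup>2 * m) - (\<psi> ^ i) $ m = of_nat p ^ Suc s * z" "z \<in> pint p"
      by (auto simp: pideal_def)
    have "l \<noteq> 0" using l(2) by (metis dvd_0_right)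
    hence "w i * (of_nat p ^ Suc s * z) / of_nat p = (of_nat i * w i) * z / of_nat l"
      using l(1) prime_int_p by (cases "p = 0") (simp_all add: field_simps)
    also have "\<dots> \<in> pint p" using pint_divide_nat[OF pint_mult[OF w1[of i] z(2)] l(2)] .
    finally show ?thesis unfolding z(1) .
  qed (simp add: w0 pint_0)
  have "L $ (p\<^sup>2 * m) + L $ m / of_nat p =
      (\<Sum>i\<in>{0..m}. (w (p\<^sup>2 * i) + w i / of_nat p) * (\<psi> ^ (p\<^sup>2 * i)) $ (p\<^sup>2 * m)
          - w i * ((\<psi> ^ (p\<^sup>2 * i)) $ (p\<^sup>2 * m) - (\<psi> ^ i) $ m) / of_nat p)
      + (\<Sum>j\<in>{j\<in>{0..p\<^sup>2 * m}. \<not> p\<^sup>2 dvd j}. w j * (\<psi> ^ j) $ (p\<^sup>2 * m))"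
    unfolding L1 L2 sum_divide_distrib
    by (simp add: algebra_simps diff_divide_distrib sum.distrib[symmetric])
  also have "\<dots> \<in> pint p"
    by (intro pint_add pint_sum pint_diff pint_mult w3 small psi_pow) (use w2 in auto)
  finally show ?thesis .
qed

lemma pideal_fps_inverse:
  assumes "f \<in> pideal_fps p 0" "f $ 0 = 1"
  shows "inverse f \<in> pideal_fps p 0"
proof -
  have "inverse f $ n \<in> pint p" for n
  proof (induction n rule: less_induct)
    case (less n)
    show ?case
    proof (cases "n = 0")
      case True thus ?thesis using assms(2) by (simp add: pint_1)
    next
      case False
      have "(inverse f * f) $ n = 0" using assms(2) False by (simp add: inverse_mult_eq_1)
      moreover have "{0..n} = insert n {0..<n}" by auto
      ultimately have "inverse f $ n = - (\<Sum>i\<in>{0..<n}. inverse f $ i * f $ (n - i))"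
        using assms(2) by (simp add: fps_mult_nth eq_neg_iff_add_eq_0)
      thus ?thesis using less assms(1)
        by (auto simp: pideal_fps_def pideal_0 intro!: pint_uminus pint_sum pint_mult)
    qed
  qed
  thus ?thesis by (simp add: pideal_fps_def pideal_0)
qed

text \<open>Coefficient n of y^k is k * y $ n plus a polynomial in lower coefficients; for k = N it
  can be solved for y $ n without dividing by p.\<close>

lemma pideal_fps_root:
  assumes "y ^ N \<in> pideal_fps p 0" "y $ 0 = 1" "\<not> p dvd N"
  shows "y \<in> pideal_fps p 0"
proof -
  have "y $ n \<in> pint p" for n
  proof (induction n rule: less_induct)
    case (less n)
    show ?case
    proof (cases "n = 0")
      case True thus ?thesis using assms(2) by (simp add: pint_1)
    next
      case False
      have "(\<forall>i<n. (y ^ k) $ i \<in> pint p) \<and> (y ^ k) $ n - of_nat k * y $ n \<in> pint p" for k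
      proof (induction k)
        case 0 show ?case using False by (auto simp: pint_0 pint_1)
      next
        case (Suc k)
        have "(y ^ Suc k) $ i \<in> pint p" if "i < n" for i
          unfolding power_Suc fps_mult_nth using Suc less.IH that by (intro pint_sum pint_mult) auto
        moreover have "{0..n} = insert 0 (insert n {0<..<n})" using False by auto
        hence "(y ^ Suc k) $ n - of_nat (Suc k) * y $ n =
            ((y ^ k) $ n - of_nat k * y $ n) + (\<Sum>i\<in>{0<..<n}. y $ i * (y ^ k) $ (n - i))"
          using False assms(2) by (simp add: fps_mult_nth fps_nth_power_0 algebra_simps)
        moreover have "(\<Sum>i\<in>{0<..<n}. y $ i * (y ^ k) $ (n - i)) \<in> pint p"
          using Suc less.IH by (intro pint_sum pint_mult) auto
        ultimately show ?case using Suc by (auto intro: pint_add)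
      qed
      hence *: "(y ^ N) $ n - of_nat N * y $ n \<in> pint p" by blast
      have "(y ^ N) $ n - ((y ^ N) $ n - of_nat N * y $ n) \<in> pint p"
        using assms(1) * by (rule_tac pint_diff) (auto simp: pideal_fps_def pideal_0)
      hence "of_nat N * y $ n / of_nat N \<in> pint p" using assms(3) by (intro pint_divide_nat) auto
      moreover have "N \<noteq> 0" using assms(3) by (metis dvd_0_right)
      ultimately show ?thesis by simp
    qed
  qed
  thus ?thesis by (simp add: pideal_fps_def pideal_0)
qed

end

section \<open>Central binomial coefficients\<close>

text \<open>The factorial stripped of multiples of p: up to sign, Morita's p-adic Gamma function at
  n + 1.\<close>

definition units_prod :: "nat \<Rightarrow> nat \<Rightarrow> int" where
  "units_prod p n = (\<Prod>i\<in>{i\<in>{1..n}. \<not> p dvd i}. int i)"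

lemma units_below_Suc:
  "{i\<in>{1..Suc n}. \<not> p dvd i} = (if p dvd Suc n then {i\<in>{1..n}. \<not> p dvd i} else insert (Suc n) {i\<in>{1..n}. \<not> p dvd i})"
  by (auto simp: le_Suc_eq)

lemma units_prod_Suc: "units_prod p (Suc n) = (if p dvd Suc n then 1 else int (Suc n)) * units_prod p n"
  unfolding units_prod_def units_below_Suc by auto

lemma fact_units_prod:
  assumes "p > 0"
  shows "(fact n :: int) = fact (n div p) * int p ^ (n div p) * units_prod p n"
proof (induction n)
  case (Suc n)
  show ?case
  proof (cases "p dvd Suc n")
    case True
    then obtain k where k: "Suc n = p * k" by auto
    hence "k > 0" by (auto intro: Nat.gr0I)
    then obtain l where l: "k = Suc l" by (cases k) auto
    have "n div p = l"
      using k l assms by (intro div_nat_eqI) auto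
    moreover have "Suc n div p = Suc l" using k l assms by simp
    ultimately have "fact (Suc n div p) * int p ^ (Suc n div p) * units_prod p (Suc n) =
        int p * int (Suc l) * (fact (n div p) * int p ^ (n div p) * units_prod p n)"
      using True by (simp add: units_prod_Suc del: of_nat_Suc)
    also have "int p * int (Suc l) = int (Suc n)" using k l by (simp only: of_nat_mult)
    finally show ?thesis using Suc.IH by simp
  next
    case False
    hence "Suc n div p = n div p" by (simp add: div_Suc dvd_eq_mod_eq_0)
    thus ?thesis using False Suc.IH by (simp only: units_prod_Suc fact_Suc if_False) (simp add: algebra_simps)
  qed
qed (simp add: units_prod_def)

lemma card_units_below:
  assumes "p > 0"
  shows "card {i\<in>{1..n}. \<not> p dvd i} + n div p = n"
proof (induction n)
  case (Suc n)
  show ?case unfolding units_below_Suc using Suc assms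
    by (auto simp: div_Suc dvd_eq_mod_eq_0)
qed auto

lemma coprime_units_prod: "prime p \<Longrightarrow> coprime (units_prod p n) (int p)"
  unfolding units_prod_def
proof (intro prod_coprime_left)
  fix i assume "prime p" "i \<in> {i\<in>{1..n}. \<not> p dvd i}"
  hence "coprime p i" by (intro prime_imp_coprime) auto
  thus "coprime (int i) (int p)" by (simp add: coprime_commute)
qed

text \<open>A counterpart of the reflection formula: the units above a are x - j with j running
  through the units up to b, and x - j = -j modulo q.\<close>

lemma units_prod_cong:
  assumes "p dvd q" "q dvd x" "a + b + 1 = x"
  shows "[units_prod p (x - 1) = (- 1) ^ card {i\<in>{1..b}. \<not> p dvd i} * (units_prod p a * units_prod p b)] (mod int q)"
proof -
  have dvd_x: "p dvd x" using assms(1,2) by (rule dvd_trans)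
  have "{1..x - 1} = {1..a} \<union> {a<..x - 1}"
    using assms(3) by auto
  hence split: "{i\<in>{1..x - 1}. \<not> p dvd i} = {i\<in>{1..a}. \<not> p dvd i} \<union> {i\<in>{a<..x - 1}. \<not> p dvd i}"
    by blast
  have "units_prod p (x - 1) = units_prod p a * (\<Prod>i\<in>{i\<in>{a<..x - 1}. \<not> p dvd i}. int i)"
    unfolding units_prod_def split by (rule prod.union_disjoint) auto
  also have "(\<Prod>i\<in>{i\<in>{a<..x - 1}. \<not> p dvd i}. int i) = (\<Prod>j\<in>{j\<in>{1..b}. \<not> p dvd j}. int x - int j)"
    by (rule prod.reindex_bij_witness[where i = "\<lambda>j. x - j" and j = "\<lambda>i. x - i"])
       (use assms(3) dvd_x in \<open>auto simp: of_nat_diff dest: dvd_diffD dvd_diffD1\<close>)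
  finally have "units_prod p (x - 1) = units_prod p a * (\<Prod>j\<in>{j\<in>{1..b}. \<not> p dvd j}. int x - int j)" .
  moreover have "[(\<Prod>j\<in>{j\<in>{1..b}. \<not> p dvd j}. int x - int j) = (\<Prod>j\<in>{j\<in>{1..b}. \<not> p dvd j}. - int j)] (mod int q)"
  proof (rule cong_prod)
    have "int q dvd int x" using assms(2) by simp
    thus "[int x - int j = - int j] (mod int q)" for j
      by (simp add: cong_iff_dvd_diff)
  qed
  moreover have "(\<Prod>j\<in>{j\<in>{1..b}. \<not> p dvd j}. - int j) = (- 1) ^ card {i\<in>{1..b}. \<not> p dvd i} * units_prod p b"
    unfolding units_prod_def by (rule prod_uminus)
  ultimately show ?thesis
    by (metis (no_types, lifting) cong_scalar_left mult.left_commute)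
qed

text \<open>The number x is itself a multiple of p and drops out, and the units above it are x + j,
  congruent to j.\<close>

lemma units_prod_double_cong:
  assumes "p dvd q" "q dvd x" "x > 0"
  shows "[units_prod p (2 * x - 1) = units_prod p (x - 1) ^ 2] (mod int q)"
proof -
  have dvd_x: "p dvd x" using assms(1,2) by (rule dvd_trans)
  have split: "{i\<in>{1..2 * x - 1}. \<not> p dvd i} = {i\<in>{1..x - 1}. \<not> p dvd i} \<union> {i\<in>{x<..2 * x - 1}. \<not> p dvd i}"
  proof -
    have "{1..2 * x - 1} = {1..x - 1} \<union> {x<..2 * x - 1} \<union> {x}"
      using assms(3) by auto
    thus ?thesis using dvd_x by blast
  qed
  have "units_prod p (2 * x - 1) = units_prod p (x - 1) * (\<Prod>i\<in>{i\<in>{x<..2 * x - 1}. \<not> p dvd i}. int i)"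
    unfolding units_prod_def split by (rule prod.union_disjoint) auto
  also have "(\<Prod>i\<in>{i\<in>{x<..2 * x - 1}. \<not> p dvd i}. int i) = (\<Prod>j\<in>{j\<in>{1..x - 1}. \<not> p dvd j}. int x + int j)"
    by (rule prod.reindex_bij_witness[where i = "\<lambda>j. x + j" and j = "\<lambda>i. i - x"])
       (use dvd_x in \<open>auto simp: dvd_add_right_iff dest: dvd_diffD\<close>)
  finally have "units_prod p (2 * x - 1) = units_prod p (x - 1) * (\<Prod>j\<in>{j\<in>{1..x - 1}. \<not> p dvd j}. int x + int j)" .
  moreover have "[(\<Prod>j\<in>{j\<in>{1..x - 1}. \<not> p dvd j}. int x + int j) = units_prod p (x - 1)] (mod int q)"
    unfolding units_prod_def
  proof (rule cong_prod)
    have "int q dvd int x" using assms(2) by simp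
    thus "[int x + int j = int j] (mod int q)" for j
      by (simp add: cong_iff_dvd_diff)
  qed
  ultimately show ?thesis
    by (simp only: power2_eq_square cong_scalar_left)
qed

lemma choose_fact: "int (2 * k choose k) * (fact k * fact k) = fact (2 * k)"
proof -
  have "fact k * fact (2 * k - k) * (2 * k choose k) = (fact (2 * k) :: nat)"
    by (rule binomial_fact_lemma) simp
  hence "int (fact k * fact k * (2 * k choose k)) = int (fact (2 * k))" by (simp add: mult_2)
  thus ?thesis by (simp add: mult_ac)
qed

text \<open>Without a carry (2M) div p = 2k for M = p k + d, so in the factorial decompositions of
  M! and (2M)! the powers of p balance.\<close>

lemma central_binomial_no_carry:
  assumes "prime p" "2 * d < p"
  shows "int (2 * (p * k + d) choose (p * k + d)) * units_prod p (p * k + d) ^ 2 =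
    int (2 * k choose k) * units_prod p (2 * (p * k + d))"
proof -
  have p0: "p > 0" using assms(1) prime_gt_0_nat by blast
  define M where "M = p * k + d"
  have div: "M div p = k" "(2 * M) div p = 2 * k"
    unfolding M_def using assms(2) by (intro div_nat_eqI; simp add: algebra_simps)+
  have "fact (2 * k) * int p ^ (2 * k) * units_prod p (2 * M) = fact (2 * M)"
    using fact_units_prod[OF p0, of "2 * M"] unfolding div by simp
  also have "\<dots> = int (2 * M choose M) * (fact M * fact M)" by (rule choose_fact[symmetric])
  also have "(fact M :: int) = fact k * int p ^ k * units_prod p M"
    using fact_units_prod[OF p0, of M] unfolding div .
  finally have "(fact k * fact k * int p ^ (2 * k)) * (int (2 * k choose k) * units_prod p (2 * M)) =
      (fact k * fact k * int p ^ (2 * k)) * (int (2 * M choose M) * units_prod p M ^ 2)"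
    unfolding choose_fact[symmetric] by (simp add: power2_eq_square power_add mult_2 mult_2_right mult_ac)
  thus ?thesis using p0 by (simp add: M_def)
qed

text \<open>With a carry (2M) div p = 2k + 1, which leaves one extra p and turns (2k)! into (2k +
  1)!.\<close>

lemma central_binomial_carry:
  assumes "prime p" "p \<le> 2 * d" "d < p"
  shows "int (2 * (p * k + d) choose (p * k + d)) * units_prod p (p * k + d) ^ 2 =
    int p * int (2 * k + 1) * int (2 * k choose k) * units_prod p (2 * (p * k + d))"
proof -
  have p0: "p > 0" using assms(1) prime_gt_0_nat by blast
  define M where "M = p * k + d"
  have div: "M div p = k" "(2 * M) div p = 2 * k + 1"
    unfolding M_def using assms(2,3) by (intro div_nat_eqI; simp add: algebra_simps)+
  have pow: "int p ^ (2 * k + 1) = int p * (int p ^ k * int p ^ k)" "int p ^ (2 * k) = int p ^ k * int p ^ k"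
    by (simp_all add: power_add mult_2)
  have "fact (2 * k + 1) * int p ^ (2 * k + 1) * units_prod p (2 * M) = fact (2 * M)"
    using fact_units_prod[OF p0, of "2 * M"] unfolding div by simp
  also have "\<dots> = int (2 * M choose M) * (fact M * fact M)" by (rule choose_fact[symmetric])
  also have "(fact M :: int) = fact k * int p ^ k * units_prod p M"
    using fact_units_prod[OF p0, of M] unfolding div .
  also have "(fact (2 * k + 1) :: int) = int (2 * k + 1) * (int (2 * k choose k) * (fact k * fact k))"
    unfolding choose_fact by simp
  finally have "(fact k * fact k * int p ^ (2 * k)) * (int p * int (2 * k + 1) * int (2 * k choose k) * units_prod p (2 * M)) =
      (fact k * fact k * int p ^ (2 * k)) * (int (2 * M choose M) * units_prod p M ^ 2)"
    unfolding pow power2_eq_square by (simp only: mult_ac)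
  thus ?thesis using p0 by (simp add: M_def)
qed

text \<open>The coefficients of (1 + 64 x)^(-1/2).\<close>

definition sqrt_coeff :: "nat \<Rightarrow> int" where
  "sqrt_coeff k = (- 16) ^ k * int (2 * k choose k)"

text \<open>The indices \<open>k\<close>, \<open>k1\<close>, \<open>k'\<close> belong to \<open>m\<close>, \<open>p m\<close>, \<open>p\<^sup>2 m\<close>, and modulo \<open>p ^ Suc s\<close> the last two
  satisfy \<open>k1 \<equiv> - 1 - k'\<close>, so that the reflection \<open>i \<mapsto> x - i\<close> evaluates the quotients of products of
  units; no form of Wilson's theorem is needed because its contribution occurs on both sides.\<close>

lemma sqrt_coeff_cong:
  fixes p c e k k' :: nat
  assumes p: "prime p" "odd p" and e: "0 < e" "2 * (e * c) < p"
    and N: "N * c = p + 1" and m: "m = e + N * k" and k': "k' = p * (p * k + e * c - 1) + p - e * c"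
    and s: "p ^ s dvd m"
  shows "int p ^ (2 + s) dvd sqrt_coeff k' + int p * sqrt_coeff k"
proof -
  define k1 where "k1 = p * k + (e * c - 1)"
  define d' where "d' = p - e * c"
  define q where "q = p ^ Suc s"
  define U where "U = units_prod p"
  define x where "x = p * c * m"
  have ec: "e * c > 0" using e N by (auto intro!: Nat.gr0I)
  have k'_eq: "k' = p * k1 + d'" 
  proof -
    have "p * k + (e * c - 1) = p * k + e * c - 1" using ec by (intro Nat.add_diff_assoc) simp
    moreover have "p * k1 + (p - e * c) = p * k1 + p - e * c" using e by (intro Nat.add_diff_assoc) linarith
    ultimately show ?thesis unfolding k' k1_def d'_def by (simp only:)
  qed
  have int_ec: "int (e * c - 1) = int e * int c - 1" using ec by (simp add: of_nat_diff)
  have "e * c \<le> p" using e by linarith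
  hence int_d': "int d' = int p - int e * int c" unfolding d'_def by (simp only: of_nat_diff of_nat_mult)
  have int_k1: "int k1 = int p * int k + int e * int c - 1"
    unfolding k1_def of_nat_add of_nat_mult int_ec by simp
  have "int (N * c) = int (p + 1)" by (simp only: N)
  hence int_N: "int p + 1 = int N * int c" by simp
  have d': "p \<le> 2 * d'" "d' < p" using e ec unfolding d'_def by linarith+
  \<comment> \<open>The sum is p c m, hence divisible by q; this makes k1 the reflection of
    k'.\<close>
  have x: "k' + k1 + 1 = x"
  proof -
    have "int (k' + k1 + 1) = int p * int k1 + int p - int e * int c + int k1 + 1"
      unfolding k'_eq of_nat_add of_nat_mult of_nat_1 int_d' by simp
    also note int_k1
    also have "int p * (int p * int k + int e * int c - 1) + int p - int e * int c + (int p * int k + int e * int c - 1) + 1 =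
       int p * (int e * int c + (int p + 1) * int k)" by (simp add: algebra_simps)
    also note int_N
    also have "int p * (int e * int c + int N * int c * int k) = int x"
      unfolding x_def m by (simp add: algebra_simps)
    finally show ?thesis by (simp only: of_nat_eq_iff)
  qed
  have q: "p dvd q" "q dvd x" using s mult_dvd_mono[of p p "p ^ s" "c * m"] unfolding q_def x_def by (simp_all add: mult.assoc dvd_mult)
  have "x > 0" using x by simp
  have U_cop: "coprime (U n) (int p)" for n unfolding U_def using p(1) by (rule coprime_units_prod)
  \<comment> \<open>The last base p digit of k1 is e c - 1, less than p/2, whereas that of k' is p -
    e c, more than p/2. Chaining \<open>B1\<close> and \<open>B2\<close> relates k' to k.\<close>
  have B1: "int (2 * k1 choose k1) * U k1 ^ 2 = int (2 * k choose k) * U (2 * k1)"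
    unfolding U_def k1_def using e by (intro central_binomial_no_carry p) linarith
  have B2: "int (2 * k' choose k') * U k' ^ 2 = int p * int (2 * k1 + 1) * int (2 * k1 choose k1) * U (2 * k')"
    unfolding U_def k'_eq using d' by (intro central_binomial_carry p)
  \<comment> \<open>The factor 2 k1 + 1 left by the carry is a unit, so it extends U (2 k1) to U (2
    k1 + 1), which is what the reflection at 2x pairs with U (2 k').\<close>
  have "\<not> p dvd 2 * k1 + 1"
  proof -
    have "2 * k1 + 1 = p * (2 * k) + (2 * (e * c) - 1)" 
    proof -
      obtain f where f: "e * c = Suc f" using ec gr0_implies_Suc by blast
      show ?thesis unfolding k1_def f by (simp add: algebra_simps)
    qed
    moreover have "\<not> p dvd 2 * (e * c) - 1" by (rule nat_dvd_not_less) (use ec e in linarith)+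
    ultimately show ?thesis by (simp only: dvd_add_right_iff dvd_triv_left not_False_eq_True)
  qed
  hence U_odd: "U (2 * k1 + 1) = int (2 * k1 + 1) * U (2 * k1)"
    unfolding U_def using units_prod_Suc[of p "2 * k1"] by simp
  define V where "V = (U k' * U k1) ^ 2"
  have main: "int (2 * k' choose k') * V = int p * int (2 * k choose k) * (U (2 * k1 + 1) * U (2 * k'))"
  proof -
    have "int (2 * k' choose k') * V = (int (2 * k' choose k') * U k' ^ 2) * U k1 ^ 2"
      by (simp add: V_def power_mult_distrib)
    also have "\<dots> = int p * int (2 * k1 + 1) * (int (2 * k1 choose k1) * U k1 ^ 2) * U (2 * k')"
      unfolding B2 by simp
    finally show ?thesis unfolding B1 U_odd by simp
  qed
  have "[U (2 * x - 1) = - (U (2 * k1 + 1) * U (2 * k'))] (mod int q)"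
  proof -
    \<comment> \<open>There are 2 k1 + 1 multiples of p among the first 2 k' numbers, so the number
      of units is odd. The resulting minus sign is the reason why the congruence has a sum instead
      of a difference.\<close>
    have "card {i\<in>{1..2 * k'}. \<not> p dvd i} + (2 * k1 + 1) = 2 * k'"
    proof -
      have "2 * k' div p = 2 * k1 + 1"
        unfolding k'_eq using d' by (intro div_nat_eqI) (simp_all add: algebra_simps)
      thus ?thesis using card_units_below[of p "2 * k'"] prime_gt_0_nat[OF p(1)] by simp
    qed
    hence "odd (card {i\<in>{1..2 * k'}. \<not> p dvd i})" by presburger
    thus ?thesis
      using units_prod_cong[of p q "2 * x" "2 * k1 + 1" "2 * k'"] q x unfolding U_def
      by (simp add: mod_mult_right_eq[symmetric])
  qed
  moreover have "[U (2 * x - 1) = U (x - 1) ^ 2] (mod int q)"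
    unfolding U_def using q \<open>x > 0\<close> by (rule units_prod_double_cong)
  moreover have "[U (x - 1) ^ 2 = V] (mod int q)"
  proof -
    have "[U (x - 1) ^ 2 = ((- 1) ^ card {i\<in>{1..k1}. \<not> p dvd i} * (U k' * U k1)) ^ 2] (mod int q)"
      unfolding U_def using q x by (intro cong_pow units_prod_cong)
    thus ?thesis by (simp add: V_def power_mult_distrib flip: power_mult)
  qed
  ultimately have final: "[- (U (2 * k1 + 1) * U (2 * k')) = V] (mod int q)"
    by (meson cong_sym cong_trans)
  have "int q dvd U (2 * k1 + 1) * U (2 * k') + V"
  proof -
    have "int q dvd - (- (U (2 * k1 + 1) * U (2 * k')) - V)"
      using final by (simp only: cong_iff_dvd_diff dvd_minus_iff)
    also have "- (- (U (2 * k1 + 1) * U (2 * k')) - V) = U (2 * k1 + 1) * U (2 * k') + V"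
      by (simp only: minus_diff_eq diff_minus_eq_add add.commute)
    finally show ?thesis .
  qed
  hence "int p * int q dvd int p * int (2 * k choose k) * (U (2 * k1 + 1) * U (2 * k') + V)"
    by (simp add: mult.assoc mult_dvd_mono)
  also have "\<dots> = (int (2 * k' choose k') + int p * int (2 * k choose k)) * V"
    by (simp add: distrib_left distrib_right main)
  finally have "int p ^ (2 + s) dvd (int (2 * k' choose k') + int p * int (2 * k choose k)) * V"
    by (simp add: q_def mult.assoc)
  moreover have "coprime (int p ^ (2 + s)) V"
    unfolding V_def using U_cop by (auto simp: coprime_commute)
  ultimately have choose_cong: "int p ^ (2 + s) dvd int (2 * k' choose k') + int p * int (2 * k choose k)"
    by (simp add: coprime_dvd_mult_left_iff)
  have k'_k: "k' = k + (p - 1) * (c * m)"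
  proof -
    have "int k' = int k + (int p - 1) * (int c * int m)"
    proof -
      have "int k' = int p * (int p * int k + int e * int c - 1) + int p - int e * int c"
        unfolding k'_eq of_nat_add of_nat_mult int_d' int_k1 by simp
      also have "\<dots> = int k + (int p - 1) * (int e * int c + (int p + 1) * int k)" by (simp add: algebra_simps)
      also note int_N
      also have "int e * int c + int N * int c * int k = int c * int m" unfolding m by (simp add: algebra_simps)
      finally show ?thesis .
    qed
    also have "\<dots> = int (k + (p - 1) * (c * m))" using prime_gt_0_nat[OF p(1)] by (simp add: of_nat_diff)
    finally show ?thesis by (simp only: of_nat_eq_iff)
  qed
  have "[(- 16) ^ ((p - 1) * (c * m)) = (1 :: int)] (mod int q)"
  proof -
    have "coprime 16 q"
    proof -
      have "coprime ((2 :: nat) ^ 4) (p ^ Suc s)"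
        using p(2) by (simp only: coprime_power_left_iff coprime_power_right_iff coprime_left_2_iff_odd) simp
      thus ?thesis by (simp add: q_def)
    qed
    hence "[16 ^ totient q = 1] (mod q)" by (rule euler_theorem)
    moreover obtain l where l: "c * m = p ^ s * l" using s by (metis dvd_mult dvdE)
    have "totient q = p ^ s * (p - 1)" unfolding q_def using p(1) by (rule totient_prime_power_Suc)
    ultimately have "[(16 ^ (p ^ s * (p - 1))) ^ l = 1 ^ l] (mod q)" by (intro cong_pow) simp
    moreover have "(16 ^ (p ^ s * (p - 1))) ^ l = (16 ^ ((p - 1) * (c * m)) :: nat)"
      unfolding l by (simp add: mult_ac flip: power_mult)
    ultimately have "[16 ^ ((p - 1) * (c * m)) = 1] (mod q)" by simp
    hence "[int (16 ^ ((p - 1) * (c * m))) = int 1] (mod int q)" by (simp only: cong_int_iff)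
    moreover have "even ((p - 1) * (c * m))" using p by simp
    hence "(- 16) ^ ((p - 1) * (c * m)) = (16 ^ ((p - 1) * (c * m)) :: int)" by (rule power_minus_even)
    ultimately show ?thesis by simp
  qed
  hence "int q dvd (- 16) ^ ((p - 1) * (c * m)) - 1" by (simp only: cong_iff_dvd_diff)
  then obtain z where "(- 16) ^ ((p - 1) * (c * m)) - 1 = int q * z" by (elim dvdE)
  hence z: "(- 16) ^ ((p - 1) * (c * m)) = 1 + int q * z" by simp
  \<comment> \<open>Euler's theorem compares the powers of -16 only modulo q = p^(s + 1); this
    divisibility supplies the missing factor p.\<close>
  have p_dvd: "int p dvd int (2 * k' choose k')"
  proof -
    have "int p dvd int p ^ (2 + s)" by simp
    hence "int p dvd int (2 * k' choose k') + int p * int (2 * k choose k)" using choose_cong dvd_trans by blast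
    thus ?thesis by (simp add: dvd_add_left_iff)
  qed
  have "sqrt_coeff k' + int p * sqrt_coeff k = (- 16) ^ k *
      ((int (2 * k' choose k') + int p * int (2 * k choose k)) + int q * z * int (2 * k' choose k'))"
    unfolding sqrt_coeff_def k'_k power_add z by (simp add: algebra_simps)
  moreover have "int p ^ (2 + s) dvd int q * z * int (2 * k' choose k')"
  proof -
    have "int q * int p dvd (int q * z) * int (2 * k' choose k')"
      using p_dvd by (intro mult_dvd_mono) auto
    thus ?thesis by (simp add: q_def mult_ac)
  qed
  ultimately show ?thesis using choose_cong by (simp add: dvd_add dvd_mult)
qed

text \<open>Modulo p the number c is inverse to N, so k = -e c. The last digit of k is then p - e c,
  and doubling it causes a carry.\<close>

lemma prime_dvd_sqrt_coeff:
  assumes p: "prime p" and e: "0 < e" "2 * (e * c) < p"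
    and N: "N * c = p + 1" and dvd: "p dvd e + N * k"
  shows "int p dvd sqrt_coeff k"
proof -
  have ec: "e * c > 0" using e N by (auto intro!: Nat.gr0I)
  have "p dvd c * (e + N * k)" using dvd by simp
  also have "c * (e + N * k) = e * c + (N * c) * k" by (simp add: algebra_simps)
  also have "\<dots> = p * k + (k + e * c)" unfolding N by (simp add: algebra_simps)
  finally have "p dvd k + e * c" by (simp only: dvd_add_right_iff dvd_triv_left)
  then obtain l where l: "k + e * c = p * l" by auto
  hence "l > 0" using ec by (auto intro: Nat.gr0I)
  then obtain i where i: "l = Suc i" by (cases l) auto
  have k: "k = p * i + (p - e * c)" using l e unfolding i mult_Suc_right by linarith
  have "int (2 * k choose k) * units_prod p k ^ 2 = int p * int (2 * i + 1) * int (2 * i choose i) * units_prod p (2 * k)"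
    unfolding k using e ec by (intro central_binomial_carry p) linarith+
  hence "int p dvd int (2 * k choose k) * units_prod p k ^ 2" by simp
  moreover have "coprime (int p) (units_prod p k ^ 2)"
    using coprime_units_prod[OF p] by (auto simp: coprime_commute)
  ultimately have "int p dvd int (2 * k choose k)" by (simp add: coprime_dvd_mult_left_iff)
  thus ?thesis by (simp add: sqrt_coeff_def)
qed

section \<open>The congruence for the form\<close>

lemma sqrt_coeff_gbinomial: "of_int (sqrt_coeff k) = (64 ^ k * ((- 1 / 2) gchoose k) :: complex)"
proof (induction k)
  case (Suc k)
  have "Suc k * (2 * Suc k choose Suc k) = 2 * ((2 * k + 1) * (2 * k choose k))"
  proof -
    have "Suc k * (Suc (Suc (2 * k)) choose Suc k) = Suc (Suc (2 * k)) * (Suc (2 * k) choose k)"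
      by (rule Suc_times_binomial)
    also have "Suc (2 * k) choose k = Suc (2 * k) choose Suc k"
      using binomial_symmetric[of k "Suc (2 * k)"] by simp
    also have "Suc (Suc (2 * k)) * (Suc (2 * k) choose Suc k) = 2 * (Suc k * (Suc (2 * k) choose Suc k))" by simp
    also have "Suc k * (Suc (2 * k) choose Suc k) = Suc (2 * k) * (2 * k choose k)"
      by (rule Suc_times_binomial)
    finally show ?thesis by simp
  qed
  hence "of_nat (Suc k * (2 * Suc k choose Suc k)) = (of_nat (2 * ((2 * k + 1) * (2 * k choose k))) :: complex)"
    by (simp only:)
  hence 1: "of_nat (Suc k) * of_nat (2 * Suc k choose Suc k) = (2 * (2 * of_nat k + 1) * of_nat (2 * k choose k) :: complex)"
    by (simp only: of_nat_mult of_nat_add of_nat_1 of_nat_numeral mult.assoc)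
  have 2: "of_nat (Suc k) * ((- 1 / 2) gchoose Suc k) = ((- 1 / 2 - of_nat k) * ((- 1 / 2) gchoose k) :: complex)"
    using gbinomial_mult_1[of "- 1 / 2 :: complex" k] by (simp add: algebra_simps)
  have "of_nat (Suc k) * of_int (sqrt_coeff (Suc k)) = (- 16) ^ Suc k * (of_nat (Suc k) * of_nat (2 * Suc k choose Suc k) :: complex)"
    by (simp only: sqrt_coeff_def of_int_mult of_int_power of_int_of_nat_eq of_int_neg_numeral mult_ac)
  also have "\<dots> = - 32 * (2 * of_nat k + 1) * of_int (sqrt_coeff k)"
    unfolding 1 by (simp add: sqrt_coeff_def algebra_simps)
  also have "\<dots> = 64 ^ Suc k * ((- 1 / 2 - of_nat k) * ((- 1 / 2) gchoose k))"
    unfolding Suc.IH by (simp add: field_simps)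
  also have "\<dots> = of_nat (Suc k) * (64 ^ Suc k * ((- 1 / 2) gchoose Suc k))"
    unfolding 2[symmetric] by (simp only: mult_ac)
  finally show ?case by (simp del: of_nat_Suc)
qed (simp add: sqrt_coeff_def)

lemma pideal_fps_numeral: "prime p \<Longrightarrow> numeral k \<in> pideal_fps p 0"
  using pideal_fps_of_nat[of p 0 "numeral k"] by simp

text \<open>The denominators 3 and 16 are only apparent: in terms of \<open>S1\<close> the theta
  series have integral coefficients, and those of \<open>theta_c\<close> are divisible by 16. So the
  primes 2 and 3 are covered as well.\<close>

lemma haupt_unit_integral:
  assumes p: "prime p"
  shows "haupt_unit \<in> pideal_fps p 0"
proof -
  note closed = pideal_fps_add[OF p] pideal_fps_diff[OF p] pideal_fps_mult_right[OF p]
    pideal_fps_compose[OF p] pideal_fps_X_power[OF p] pideal_fps_numeral[OF p] pideal_fps_1[OF p]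
    pideal_fps_inverse[OF p] pideal_fps_power[OF p]
  have "S1 $ n \<in> pint p" for n
    unfolding S1_def lambert_nth using p by (auto intro!: pint_sum pint_of_nat pint_0)
  hence S1: "S1 \<in> pideal_fps p 0" by (simp add: pideal_fps_def pideal_0)
  have "3 * theta_a = 3 * (1 + 8 * S1 - 32 * (S1 oo X4))"
    unfolding three_ab by (simp add: Ps_def Rs_def E2_def compose_simps)
  hence a: "theta_a = 1 + 8 * S1 - 32 * (S1 oo X4)" by (rule fps_numeral_cancel)
  have "3 * theta_b = 3 * (1 - 8 * (S1 - 6 * (S1 oo X2) + 8 * (S1 oo X4)))"
    unfolding three_ab by (simp add: Ps_def Qs_def Rs_def E2_def compose_simps)
  hence b: "theta_b = 1 - 8 * (S1 - 6 * (S1 oo X2) + 8 * (S1 oo X4))" by (rule fps_numeral_cancel)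
  have c: "theta_c = 16 * (S1 - 3 * (S1 oo X2) + 2 * (S1 oo X4))"
    unfolding theta_c_def a b by (simp add: algebra_simps)
  have "haupt = (fps_const (1 / 16) * 16) * (theta_a * (S1 - 3 * (S1 oo X2) + 2 * (S1 oo X4)) * inverse (theta_b ^ 2))"
    unfolding haupt_def c by (simp only: mult_ac)
  also have "fps_const (1 / 16) * 16 = (1 :: complex fps)" by (simp add: numeral_fps_const)
  finally have h: "haupt = theta_a * (S1 - 3 * (S1 oo X2) + 2 * (S1 oo X4)) * inverse (theta_b ^ 2)" by simp
  have "theta_a \<in> pideal_fps p 0" unfolding a by (intro closed S1)
  moreover have "theta_b \<in> pideal_fps p 0" unfolding b by (intro closed S1)
  moreover have "(theta_b ^ 2) $ 0 = 1" by (simp add: fps_nth_power_0 theta_abc_nth)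
  ultimately have "haupt \<in> pideal_fps p 0" unfolding h by (intro closed S1)
  thus ?thesis by (simp add: pideal_fps_def haupt_unit_def)
qed

lemma theta_haupt_unit: "theta haupt_unit = haupt_unit * (E2_level2 - 1)"
proof -
  have "theta fps_X = fps_X" by (simp add: theta_def)
  hence "fps_X * theta haupt_unit = fps_X * (haupt_unit * (E2_level2 - 1))"
    using theta_haupt unfolding haupt_unit(1) theta_mult by (simp add: algebra_simps)
  thus ?thesis by simp
qed

section \<open>The form as a series in q_N\<close>

lemma mult_X_power_compose_nth:
  assumes "e < N"
  shows "(fps_X ^ e * (f oo fps_X ^ N)) $ j = (if j mod N = e then f $ (j div N) else (0 :: complex))"
proof (cases "e \<le> j")
  case True
  then obtain i where i: "j = e + i" using le_Suc_ex by blast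
  have "j mod N = e \<longleftrightarrow> N dvd i"
    using assms unfolding i by (metis add.right_neutral dvd_eq_mod_eq_0 mod_add_right_eq mod_less mod_eq_dvd_iff_nat True i diff_add_inverse)
  moreover have "j div N = i div N" if "N dvd i" using that assms unfolding i by (auto elim!: dvdE)
  ultimately show ?thesis using assms by (simp add: fps_X_power_mult_nth fps_nth_compose_X_power i)
next
  case False
  hence "j mod N \<noteq> e" using mod_less_eq_dividend[of j N] by linarith
  thus ?thesis using False by (simp add: fps_X_power_mult_nth)
qed

text \<open>Here \<open>fps_X\<close> plays the role of q_N, so q is \<open>fps_X ^ N\<close>. This
  is the form without its constant power of 1728.\<close>

definition form_coeff :: "nat \<Rightarrow> nat \<Rightarrow> nat \<Rightarrow> complex" where
  "form_coeff e N m = (fps_X ^ e * (fpow haupt_unit (of_nat e / of_nat N) * E2_level2 *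
     fpow (1 + 64 * haupt) (- 1 / 2) oo fps_X ^ N)) $ m"

text \<open>Coefficients of the integral of N x^e (1 + 64 x^N)^(-1/2) dx/x; the factor N comes from
  dh/h = N dx/x at h = x^N. For e > 0 the entry at j = 0 is 0.\<close>

definition sqrt_log_coeff :: "nat \<Rightarrow> nat \<Rightarrow> nat \<Rightarrow> complex" where
  "sqrt_log_coeff e N j = (if j mod N = e then of_nat N * of_int (sqrt_coeff (j div N)) / of_nat j else 0)"

definition local_param :: "nat \<Rightarrow> complex fps" where
  "local_param N = fps_X * (fpow haupt_unit (1 / of_nat N) oo fps_X ^ N)"

text \<open>By the chain rule, theta (W oo \<psi>) is theta W at \<psi> times the logarithmic
  derivative of \<psi>, and the latter produces the factor \<open>E2_level2\<close> of the
  form.\<close>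

lemma form_coeff_substitution:
  assumes "0 < e" "e < N"
  shows "of_nat m * (Abs_fps (sqrt_log_coeff e N) oo local_param N) $ m = of_nat N * form_coeff e N m"
proof -
  have N: "N > 0" "fps_X ^ N $ 0 = (0 :: complex)" using assms by auto
  define W where "W = Abs_fps (sqrt_log_coeff e N)"
  define \<psi> where "\<psi> = local_param N"
  define Y where "Y = fpow haupt_unit (1 / of_nat N)"
  define G where "G = fpow (1 + fps_const 64 * fps_X) (- 1 / 2)"
  have psi0: "\<psi> $ 0 = 0" by (simp add: \<psi>_def local_param_def)
  have "\<psi> $ 1 = 1" using N by (simp add: \<psi>_def local_param_def)
  hence "\<psi> \<noteq> 0" by auto
  have theta_W: "theta W = of_nat N * (fps_X ^ e * (G oo fps_X ^ N))"
  proof (rule fps_ext)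
    fix j
    have "theta W $ j = of_nat N * (if j mod N = e then G $ (j div N) else 0)"
      using assms by (auto simp: W_def sqrt_log_coeff_def G_def fpow_linear_nth sqrt_coeff_gbinomial intro: Nat.gr0I)
    thus "theta W $ j = (of_nat N * (fps_X ^ e * (G oo fps_X ^ N))) $ j"
      unfolding fps_of_nat[symmetric] fps_mult_left_const_nth mult_X_power_compose_nth[OF assms(2)] .
  qed
  have Ypow: "Y ^ i = fpow haupt_unit (of_nat i / of_nat N)" for i
    unfolding Y_def by (simp add: fpow_power haupt_unit(2))
  have "Y ^ N = haupt_unit" using N unfolding Ypow by (simp add: fpow_1 haupt_unit(2))
  have psi_pow: "\<psi> ^ i = fps_X ^ i * (Y ^ i oo fps_X ^ N)" for i
    using N by (simp add: \<psi>_def local_param_def Y_def power_mult_distrib fps_compose_power)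
  have psi_N: "\<psi> ^ N = haupt oo fps_X ^ N"
    unfolding psi_pow \<open>Y ^ N = haupt_unit\<close> haupt_unit(1) using N by (simp add: fps_compose_mult_distrib)
  have G: "(G oo fps_X ^ N) oo \<psi> = fpow (1 + 64 * haupt) (- 1 / 2) oo fps_X ^ N"
  proof -
    have "(G oo fps_X ^ N) oo \<psi> = G oo (fps_X ^ N oo \<psi>)"
      using N psi0 by (intro fps_compose_assoc[symmetric]) auto
    also have "fps_X ^ N oo \<psi> = haupt oo fps_X ^ N" unfolding fps_X_power_compose[OF psi0] psi_N ..
    also have "G oo (haupt oo fps_X ^ N) = (G oo haupt) oo fps_X ^ N"
      using N haupt_nth by (intro fps_compose_assoc) auto
    also have "G oo haupt = fpow (1 + 64 * haupt) (- 1 / 2)"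
      unfolding G_def
      by (simp add: fpow_compose haupt_nth fps_compose_add_distrib fps_compose_mult_distrib numeral_fps_const)
    finally show ?thesis .
  qed
  have W_psi: "theta W oo \<psi> = of_nat N * (fps_X ^ e * (fpow haupt_unit (of_nat e / of_nat N)
       * fpow (1 + 64 * haupt) (- 1 / 2) oo fps_X ^ N))"
  proof -
    have "theta W oo \<psi> = of_nat N * (\<psi> ^ e * ((G oo fps_X ^ N) oo \<psi>))"
      unfolding theta_W fps_of_nat[symmetric]
      by (simp add: fps_compose_mult_distrib psi0 fps_X_power_compose)
    thus ?thesis unfolding G psi_pow Ypow using N by (simp add: fps_compose_mult_distrib mult.assoc)
  qed
  \<comment> \<open>The exponent 1/N of the root cancels the factor N that the substitution q = X^N
    brings into the derivative.\<close>
  have theta_psi: "theta \<psi> = \<psi> * (E2_level2 oo fps_X ^ N)"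
  proof -
    have "haupt_unit * theta Y = haupt_unit * (fps_const (1 / of_nat N) * (E2_level2 - 1) * Y)"
      unfolding Y_def theta_fpow[OF haupt_unit(2)] theta_haupt_unit by (simp add: mult_ac)
    hence theta_Y: "theta Y = fps_const (1 / of_nat N) * (E2_level2 - 1) * Y"
      using haupt_unit(2) by auto
    have "theta (Y oo fps_X ^ N) = fps_const (of_nat N) * (fps_const (1 / of_nat N) * (E2_level2 - 1) * Y oo fps_X ^ N)"
      using N by (simp add: theta_compose_X_power theta_Y)
    also have "\<dots> = (fps_const (of_nat N) * fps_const (1 / of_nat N)) * ((E2_level2 - 1) * Y oo fps_X ^ N)"
      using N by (simp add: fps_compose_mult_distrib mult.assoc del: fps_const_mult)
    also have "fps_const (of_nat N) * fps_const (1 / of_nat N) = (1 :: complex fps)" using N by simp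
    finally have 1: "theta (Y oo fps_X ^ N) = ((E2_level2 oo fps_X ^ N) - 1) * (Y oo fps_X ^ N)"
      using N by (simp add: fps_compose_mult_distrib fps_compose_sub_distrib)
    have 2: "theta fps_X = fps_X" by (simp add: theta_def)
    show ?thesis
      unfolding \<psi>_def local_param_def Y_def[symmetric] theta_mult 1 2 by (simp add: algebra_simps)
  qed
  have "\<psi> * theta (W oo \<psi>) = (theta W oo \<psi>) * theta \<psi>"
    using psi0 by (simp add: theta_def fps_compose_deriv fps_compose_mult_distrib mult_ac)
  also have "\<dots> = \<psi> * ((theta W oo \<psi>) * (E2_level2 oo fps_X ^ N))"
    unfolding theta_psi by (simp only: mult_ac)
  finally have "theta (W oo \<psi>) = (theta W oo \<psi>) * (E2_level2 oo fps_X ^ N)" using \<open>\<psi> \<noteq> 0\<close> by simp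
  also have "\<dots> = of_nat N * (fps_X ^ e * (fpow haupt_unit (of_nat e / of_nat N) * E2_level2 *
     fpow (1 + 64 * haupt) (- 1 / 2) oo fps_X ^ N))"
    unfolding W_psi using N by (simp add: fps_compose_mult_distrib mult_ac)
  finally have "theta (W oo \<psi>) $ m = (of_nat N * (fps_X ^ e * (fpow haupt_unit (of_nat e / of_nat N) * E2_level2 *
     fpow (1 + 64 * haupt) (- 1 / 2) oo fps_X ^ N))) $ m" by (rule arg_cong)
  thus ?thesis
    unfolding fps_of_nat[symmetric] fps_mult_left_const_nth
    by (simp add: W_def \<psi>_def form_coeff_def)
qed

lemma local_param_integral:
  assumes p: "prime p" and "\<not> p dvd N"
  shows "local_param N \<in> pideal_fps p 0"
proof -
  have "N > 0" using assms(2) by (metis dvd_0_right gr0I)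
  have "fpow haupt_unit (1 / of_nat N) ^ N = haupt_unit"
    using \<open>N > 0\<close> by (simp add: fpow_power fpow_1 haupt_unit(2))
  hence "fpow haupt_unit (1 / of_nat N) ^ N \<in> pideal_fps p 0"
    using haupt_unit_integral[OF p] by (simp only:)
  hence "fpow haupt_unit (1 / of_nat N) \<in> pideal_fps p 0"
    using assms(2) by (rule pideal_fps_root[OF p _ fpow_nth_0])
  from pideal_fps_compose[OF p this pideal_fps_X_power[OF p, of N]]
  have "fps_X ^ 1 * (fpow haupt_unit (1 / of_nat N) oo fps_X ^ N) \<in> pideal_fps p 0"
    by (rule pideal_fps_mult_right[OF p pideal_fps_X_power[OF p]])
  thus ?thesis by (simp add: local_param_def)
qed

text \<open>The integral in the parameter h^(1/N) has Honda type p + T^2, hence so has its image in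
  q_N. Since its m-th coefficient times m is N times that of the form, integrality turns into
  divisibility by p^2 m.\<close>

lemma form_coeff_cong:
  assumes p: "prime p" "odd p" and e: "0 < e" "2 * (e * c) < p" "e < N" and N: "N * c = p + 1" and "m > 0"
  shows "\<exists>z\<in>pint p. form_coeff e N (p\<^sup>2 * m) + of_nat p * form_coeff e N m = of_nat (p\<^sup>2 * m) * z"
proof -
  have p0: "p > 0" using prime_gt_0_nat[OF p(1)] .
  have pN: "\<not> p dvd N"
  proof
    assume "p dvd N"
    hence "p dvd p + 1" using N by (metis dvd_mult2)
    hence "p dvd 1" by (simp only: dvd_add_right_iff dvd_refl)
    thus False using p(1) by simp
  qed
  \<comment> \<open>Hence \<open>w\<close> at p^2 i and at i vanish simultaneously, which settles
    the indices outside the class of e.\<close>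
  have p_sq: "p\<^sup>2 mod N = 1"
  proof -
    have "N > 1" using e by linarith
    have "(p + 1) * (p - 1) = p\<^sup>2 - 1" using p0 by (simp add: power2_eq_square algebra_simps)
    hence "p\<^sup>2 = N * (c * (p - 1)) + 1" using p0 unfolding N[symmetric] mult.assoc by simp
    thus ?thesis using \<open>N > 1\<close> by (simp only: mod_mult_self4) simp
  qed
  define w where "w = sqrt_log_coeff e N"
  have key: "(Abs_fps w oo local_param N) $ (p\<^sup>2 * m) + (Abs_fps w oo local_param N) $ m / of_nat p \<in> pint p"
  proof (rule honda_substitution[OF p(1) local_param_integral[OF p(1) pN]])
    show "local_param N $ 0 = 0" by (simp add: local_param_def)
    show "w 0 = 0" by (simp add: w_def sqrt_log_coeff_def)
    show "of_nat j * w j \<in> pint p" for j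
      using pint_mult[OF p(1) pint_of_nat[OF p(1), of N] pint_of_int[OF p(1), of "sqrt_coeff (j div N)"]]
        pint_0[OF p(1)] by (auto simp: w_def sqrt_log_coeff_def)
    \<comment> \<open>When p divides j exactly once, the p in the denominator is cancelled by
      \<open>prime_dvd_sqrt_coeff\<close>.\<close>
    show "w j \<in> pint p" if "\<not> p\<^sup>2 dvd j" for j
    proof (cases "j mod N = e")
      case True
      have j: "j = e + N * (j div N)" using True by (metis mod_mult_div_eq)
      show ?thesis
      proof (cases "p dvd j")
        case False
        thus ?thesis unfolding w_def sqrt_log_coeff_def
          using True pint_divide_nat[OF p(1) pint_mult[OF p(1) pint_of_nat[OF p(1)] pint_of_int[OF p(1)]]] by simp
      next
        case dvd: True
        then obtain i where i: "j = p * i" by auto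
        hence "\<not> p dvd i" using that by (auto simp: power2_eq_square)
        have "int p dvd sqrt_coeff (j div N)"
          using dvd j by (intro prime_dvd_sqrt_coeff[OF p(1) e(1,2) N]) simp
        then obtain d where d: "sqrt_coeff (j div N) = int p * d" by auto
        have "w j = of_nat N * of_int d / of_nat i"
          using True p0 by (simp add: w_def sqrt_log_coeff_def d) (simp add: i)
        thus ?thesis
          using pint_divide_nat[OF p(1) pint_mult[OF p(1) pint_of_nat[OF p(1)] pint_of_int[OF p(1)]] \<open>\<not> p dvd i\<close>] by simp
      qed
    qed (simp add: w_def sqrt_log_coeff_def pint_0[OF p(1)])
    show "w (p\<^sup>2 * i) + w i / of_nat p \<in> pint p" for i
    proof (cases "i mod N = e")
      case False
      have "(p\<^sup>2 * i) mod N = i mod N" using p_sq by (metis mod_mult_left_eq mult_1)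
      thus ?thesis using False by (simp add: w_def sqrt_log_coeff_def pint_0[OF p(1)])
    next
      case True
      define k where "k = i div N"
      define k' where "k' = p * (p * k + e * c - 1) + p - e * c"
      define s where "s = multiplicity p i"
      have i: "i = e + N * k" unfolding k_def using True by (metis mod_mult_div_eq)
      hence "i > 0" using e by simp
      then obtain l where l: "i = p ^ s * l" "\<not> p dvd l"
        using multiplicity_decompose'[of i p] p(1) unfolding s_def by (metis nat_dvd_1_iff_1 not_gr0 not_prime_unit)
      have i': "p\<^sup>2 * i = e + N * k'"
      proof -
        have ec: "e * c > 0" using e N by (auto intro!: Nat.gr0I)
        have "e * c \<le> p * (p * k + e * c - 1) + p" using e by linarith
        moreover have "1 \<le> p * k + e * c" using ec by linarith
        ultimately have "int k' = int p * (int p * int k + int e * int c - 1) + int p - int e * int c"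
          unfolding k'_def by (simp only: of_nat_diff of_nat_add of_nat_mult of_nat_1)
        hence "int (e + N * k') = int e + int N * (int p * (int p * int k + int e * int c - 1) + int p - int e * int c)"
          by simp
        also have "\<dots> = int e + int N * int p * int p * int k + (int N * int c) * int e * (int p - 1)"
          by (simp add: algebra_simps)
        also have "int N * int c = int p + 1" using N by (metis of_nat_1 of_nat_add of_nat_mult)
        also have "int e + int N * int p * int p * int k + (int p + 1) * int e * (int p - 1) = int (p\<^sup>2 * i)"
          unfolding i by (simp add: power2_eq_square algebra_simps)
        finally show ?thesis by (simp only: of_nat_eq_iff)
      qed
      have mod: "(p\<^sup>2 * i) mod N = e" "(p\<^sup>2 * i) div N = k'"
        unfolding i' using e by simp_all
      have "int p ^ (2 + s) dvd sqrt_coeff k' + int p * sqrt_coeff k"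
        by (rule sqrt_coeff_cong[OF p e(1,2) N i k'_def]) (simp add: s_def multiplicity_dvd)
      then obtain d where d: "sqrt_coeff k' + int p * sqrt_coeff k = int p ^ (2 + s) * d" by auto
      have "l \<noteq> 0" using \<open>i > 0\<close> l(1) by auto
      have "w (p\<^sup>2 * i) + w i / of_nat p = of_nat N * of_int (sqrt_coeff k' + int p * sqrt_coeff k) / of_nat (p\<^sup>2 * i)"
        using True mod p0 \<open>i > 0\<close> by (simp add: w_def sqrt_log_coeff_def k_def field_simps power2_eq_square)
      also have "\<dots> = of_nat N * of_int d / of_nat l"
        unfolding d l(1) using p0 \<open>l \<noteq> 0\<close> by (simp add: field_simps power_add power2_eq_square)
      also have "\<dots> \<in> pint p" using l(2)
        by (intro pint_divide_nat pint_mult pint_of_nat pint_of_int p)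
      finally show ?thesis .
    qed
  qed
  define L where "L = Abs_fps w oo local_param N"
  have L: "of_nat i * L $ i = of_nat N * form_coeff e N i" for i
    unfolding L_def w_def using e by (intro form_coeff_substitution)
  have "N \<noteq> 0" using e by simp
  have "of_nat N * (form_coeff e N (p\<^sup>2 * m) + of_nat p * form_coeff e N m) =
      of_nat (p\<^sup>2 * m) * (L $ (p\<^sup>2 * m) + L $ m / of_nat p)"
    unfolding distrib_left mult.left_commute[of "of_nat N" "of_nat p"] L[symmetric]
    using p0 by (simp add: power2_eq_square field_simps)
  hence "form_coeff e N (p\<^sup>2 * m) + of_nat p * form_coeff e N m =
      of_nat (p\<^sup>2 * m) * ((L $ (p\<^sup>2 * m) + L $ m / of_nat p) / of_nat N)"
    using \<open>N \<noteq> 0\<close> by (simp add: field_simps)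
  moreover have "(L $ (p\<^sup>2 * m) + L $ m / of_nat p) / of_nat N \<in> pint p"
    using key pN p(1) unfolding L_def by (intro pint_divide_nat)
  ultimately show ?thesis by blast
qed

section \<open>Algebraic integrality and the expansion\<close>

text \<open>The n-th power of the number is 1728^r a^n, so it is a root of a monic polynomial; r >=
  0 makes this an integer for integral a.\<close>

lemma algebraic_1728_powr_mult:
  fixes t :: rat
  assumes "t = of_int r / of_nat n" "r \<ge> 0" "n > 0" "a \<in> \<rat>"
  shows "algebraic (complex_of_real (1728 powr of_rat t) * a)"
    and "a \<in> \<int> \<Longrightarrow> algebraic_int (complex_of_real (1728 powr of_rat t) * a)"
proof -
  define C where "C = complex_of_real (1728 powr of_rat t)"
  have "(1728 powr of_rat t) ^ n = (1728 powr (of_rat t * real n) :: real)"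
    by (simp add: powr_powr flip: powr_realpow)
  also have "of_rat t * real n = real (nat r)"
    using assms(2,3) by (simp add: assms(1) of_rat_divide)
  also have "1728 powr real (nat r) = (1728 ^ nat r :: real)" by (simp add: powr_realpow)
  finally have "C ^ n = complex_of_real (1728 ^ nat r)" unfolding C_def by (simp only: of_real_power[symmetric])
  hence "C ^ n = 1728 ^ nat r" by simp
  hence pow: "poly (Polynomial.monom 1 n) (C * a) = 1728 ^ nat r * a ^ n" by (simp add: poly_monom power_mult_distrib)
  have monic: "\<forall>i. Polynomial.coeff (Polynomial.monom 1 n :: complex poly) i \<in> \<int>" "lead_coeff (Polynomial.monom 1 n :: complex poly) = 1"
    "degree (Polynomial.monom 1 n :: complex poly) > 0"
    using \<open>n > 0\<close> by (auto simp: degree_monom_eq)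
  have "algebraic (1728 ^ nat r * a ^ n)" using assms(4) by (intro rat_imp_algebraic Rats_mult Rats_power) auto
  thus "algebraic (C * a)" using pow monic by (rule algebraic_root)
  assume "a \<in> \<int>"
  hence "algebraic_int (1728 ^ nat r * a ^ n)" by (intro int_imp_algebraic_int Ints_mult Ints_power) auto
  thus "algebraic_int (C * a)" using pow monic by (rule algebraic_int_root)
qed

text \<open>Otherwise a Bezout combination of d and p would put 1 into the proper ideal P.\<close>

lemma coprime_not_in_prime_above:
  assumes P: "prime_above p P" and "coprime d (int p)"
  shows "of_int d \<notin> P"
proof
  interpret primeideal P algebraic_integers using P by (simp add: prime_above_def)
  have int_carrier: "of_int i \<in> carrier algebraic_integers" for i
    by (simp add: algebraic_integers_def int_imp_algebraic_int)
  assume d: "of_int d \<in> P"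
  obtain u v where uv: "u * d + v * int p = 1" using bezout_int[of d "int p"] assms(2) by auto
  have "of_int u * of_int d \<in> P" "of_int v * of_nat p \<in> P"
    using I_l_closed[OF d int_carrier[of u]] I_l_closed[OF _ int_carrier[of v], of "of_nat p"] P
    by (simp_all add: algebraic_integers_def prime_above_def)
  hence "of_int u * of_int d + of_int v * of_nat p \<in> P"
    using additive_subgroup.a_closed[OF additive_subgroup_axioms] by (simp add: algebraic_integers_def)
  moreover have "of_int u * of_int d + of_int v * of_nat p = (of_int (u * d + v * int p) :: complex)" by simp
  ultimately have "1 \<in> P" unfolding uv by simp
  hence "P = carrier algebraic_integers"
    by (intro one_imp_carrier) (simp add: algebraic_integers_def)
  thus False using I_notcarr by simp
qed

text \<open>The leading exponent t - 1/2 equals e / N, so the support consists of the exponents (e +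
  N k) / N, and e > 0 makes them positive.\<close>

lemma f_form_coeff:
  fixes n :: nat and r :: int
  assumes "n > 0" "int n < 2 * r"
  defines "e \<equiv> nat (2 * r - int n)" and "t \<equiv> of_int r / of_nat n :: rat"
  assumes "e < 2 * n"
  shows "qser_coeff (f_form n r) (of_nat m / of_nat (2 * n)) =
      complex_of_real (1728 powr of_rat (t - 2 / 3)) * form_coeff e (2 * n) m"
    and "qser_coeff (f_form n r) x \<noteq> 0 \<Longrightarrow> \<exists>m\<ge>1. x = of_nat m / of_nat (2 * n)"
proof -
  define N where "N = 2 * n"
  define C where "C = complex_of_real (1728 powr of_rat (t - 2 / 3))"
  have N: "N > 0" using assms(1) by (simp add: N_def)
  have e: "of_nat e = (of_int (2 * r - int n) :: rat)" "e > 0" using assms(2) unfolding e_def by simp_all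
  have "t > 1 / 3"
  proof -
    have "1 / 2 < t" 
    proof -
      have "(of_int (int n) :: rat) < of_int (2 * r)" using assms(2) by (simp only: of_int_less_iff)
      thus ?thesis using assms(1) unfolding t_def by (simp add: field_simps)
    qed
    thus ?thesis by simp
  qed
  note f = f_form_eq[of r n, folded t_def, OF this]
  have exponent: "t - 1 / 2 = of_nat e / of_nat N"
    using assms(1) unfolding e(1) t_def N_def by (simp add: field_simps)
  define F where "F = fpow haupt_unit (of_nat e / of_nat N) * E2_level2 * fpow (1 + 64 * haupt) (- 1 / 2)"
  have snd_f: "snd (f_form n r) = fps_const C * F"
    unfolding f(2) F_def C_def exponent by (simp add: of_rat_divide)
  have coeff: "form_coeff e N m = (if m mod N = e then F $ (m div N) else 0)"
    unfolding form_coeff_def F_def[symmetric] using assms(5) by (subst mult_X_power_compose_nth) (simp_all add: N_def)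
  have diff: "x - fst (f_form n r) = of_nat k \<longleftrightarrow> x = of_nat (e + N * k) / of_nat N" for x k
    unfolding f(1) exponent using N by (auto simp: field_simps)
  have nat: "qser_coeff (f_form n r) x = C * F $ k" if "x = of_nat (e + N * k) / of_nat N" for x k
    using diff[of x k] that by (simp add: qser_coeff_def snd_f)
  show "qser_coeff (f_form n r) (of_nat m / of_nat (2 * n)) = C * form_coeff e (2 * n) m"
  proof (cases "m mod N = e")
    case True
    have "m = e + N * (m div N)" using True by (metis mod_mult_div_eq)
    hence "qser_coeff (f_form n r) (of_nat m / of_nat N) = C * F $ (m div N)"
      by (intro nat) (simp only:)
    thus ?thesis using coeff True by (simp add: N_def)
  next
    case False
    have "of_nat m / of_nat N - fst (f_form n r) \<notin> \<nat>"
    proof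
      assume "of_nat m / of_nat N - fst (f_form n r) \<in> \<nat>"
      then obtain k where "of_nat m / of_nat N - fst (f_form n r) = of_nat k" by (auto simp: Nats_def)
      hence "of_nat m / of_nat N = (of_nat (e + N * k) / of_nat N :: rat)" by (simp only: diff)
      hence "m = e + N * k" using N by (simp only: divide_cancel_right of_nat_eq_iff) auto
      thus False using False assms(5) by (simp add: N_def)
    qed
    thus ?thesis using coeff False by (simp add: qser_coeff_def N_def)
  qed
  assume "qser_coeff (f_form n r) x \<noteq> 0"
  hence "x - fst (f_form n r) \<in> \<nat>" by (auto simp: qser_coeff_def split: if_splits)
  then obtain k where "x - fst (f_form n r) = of_nat k" by (auto simp: Nats_def)
  hence "x = of_nat (e + N * k) / of_nat N" by (simp only: diff)
  thus "\<exists>m\<ge>1. x = of_nat m / of_nat (2 * n)"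
    using e(2) by (intro exI[of _ "e + N * k"]) (simp add: N_def)
qed

theorem theorem6p6:
  fixes n N :: nat and r :: int and a :: "nat \<Rightarrow> complex"
  assumes "odd n" and "\<not> n dvd 3"
    and "(real n + 1) / 2 \<le> real_of_int r" and "r \<le> int n - 1"
    and "N = 2 * n"
    and "a = (\<lambda>m. qser_coeff (f_form n r) (of_nat m / of_nat N))"
  shows "has_qN_expansion (f_form n r) N a \<and>
    (\<forall>p m. prime p \<longrightarrow> [int p = -1] (mod int n) \<longrightarrow> m \<ge> 1 \<longrightarrow>
       alg_cong_0 (a (p^2 * m) + of_nat p * a m) p (2 + multiplicity p m))"
proof (intro conjI allI impI)
  have "real n + 1 \<le> 2 * real_of_int r" using assms(3) by simp
  hence r: "int n + 1 \<le> 2 * r" by linarith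
  have "n > 0" using assms(1) by (auto intro: Nat.gr0I)
  define e where "e = nat (2 * r - int n)"
  have e: "0 < e" "e + 2 \<le> n" "e < N" using r assms(4,5) by (auto simp: e_def)
  define t :: rat where "t = of_int r / of_nat n"
  define C where "C = complex_of_real (1728 powr of_rat (t - 2 / 3))"
  have a: "a m = C * form_coeff e N m" for m
    unfolding assms(5,6) e_def C_def t_def
    by (rule f_form_coeff(1)) (use \<open>n > 0\<close> r assms(4) in auto)
  show "has_qN_expansion (f_form n r) N a"
    unfolding has_qN_expansion_def
  proof (intro conjI allI impI)
    show "qser_coeff (f_form n r) (of_nat m / of_nat N) = a m" for m
      by (simp add: assms(6))
    show "\<exists>m\<ge>1. x = of_nat m / of_nat N" if "qser_coeff (f_form n r) x \<noteq> 0" for x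
      unfolding assms(5) using \<open>n > 0\<close> r assms(4) that by (intro f_form_coeff(2)) auto
  qed
  fix p m :: nat
  assume p: "prime p" and cong: "[int p = -1] (mod int n)" and m: "m \<ge> 1"
  have n_dvd: "n dvd p + 1"
  proof -
    have "int n dvd int (p + 1)" using cong by (simp add: cong_iff_dvd_diff add.commute)
    thus ?thesis by (simp only: int_dvd_int_iff)
  qed
  \<comment> \<open>For p = 2 the number n would divide 3. Oddness of p is what lifts the congruence
    from n to N = 2n.\<close>
  have "p \<noteq> 2" using n_dvd assms(2) by auto
  hence odd_p: "odd p" using p prime_odd_nat[of p] prime_ge_2_nat[OF p] by simp
  have "coprime 2 n" using assms(1) by simp
  hence "2 * n dvd p + 1" using n_dvd odd_p by (intro divides_mult) auto
  from this obtain c where c: "N * c = p + 1" unfolding assms(5) by (metis dvdE)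
  have "c > 0" using c by (auto intro: Nat.gr0I)
  \<comment> \<open>From e + 2 <= n and 2 n c = p + 1 one gets 2 e c <= p + 1 - 4 c.\<close>
  have ec: "2 * (e * c) < p"
  proof -
    have "(e + 2) * c \<le> n * c" using e(2) by (intro mult_right_mono) auto
    moreover have "2 * (n * c) = p + 1" using c assms(5) by simp
    ultimately show ?thesis using \<open>c > 0\<close> by (simp add: algebra_simps)
  qed
  \<comment> \<open>An odd n other than 1 and 3 forces p >= 7, so p is prime to the denominator 144
    below.\<close>
  have "n \<noteq> 3" using assms(2) by auto
  hence "n \<ge> 4" using e by linarith
  moreover have "2 * n \<le> p + 1" using \<open>2 * n dvd p + 1\<close> by (intro dvd_imp_le) simp_all
  ultimately have "p \<ge> 7" by linarith
  from form_coeff_cong[OF p odd_p e(1) ec e(3) c, of m] m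
  obtain z where z: "z \<in> pint p" "form_coeff e N (p\<^sup>2 * m) + of_nat p * form_coeff e N m = of_nat (p\<^sup>2 * m) * z"
    by auto
  have x: "a (p\<^sup>2 * m) + of_nat p * a m = C * (of_nat (p\<^sup>2 * m) * z)"
    unfolding a z(2)[symmetric] by (simp add: algebra_simps)
  obtain u v where uv: "z = of_int u / of_int v" "\<not> int p dvd v" using z(1) by (auto simp: pint_def)
  define C' where "C' = complex_of_real (1728 powr of_rat t)"
  \<comment> \<open>The exponent r/n - 2/3 may be negative; moving 1728^(2/3) = 144 into the
    denominator leaves the algebraic integer C'.\<close>
  have C: "C = C' / 144"
  proof -
    have "(1728 :: real) powr (2 / 3) = (12 powr 3) powr (2 / 3)" by simp
    also have "\<dots> = 12 powr 2" unfolding powr_powr by simp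
    finally have "(1728 :: real) powr (2 / 3) = 144" by simp
    thus ?thesis unfolding C_def C'_def by (simp add: of_rat_diff powr_diff of_rat_divide)
  qed
  have "r \<ge> 0" using r by linarith
  note alg = algebraic_1728_powr_mult[OF t_def this \<open>n > 0\<close>, folded C'_def]
  define s where "s = multiplicity p m"
  obtain l where l: "m = p ^ s * l" using multiplicity_dvd[of p m] unfolding s_def by blast
  have p0: "p > 0" using prime_gt_0_nat[OF p] .
  have quotient: "(a (p\<^sup>2 * m) + of_nat p * a m) / of_nat p ^ (2 + s) =
      C' * of_int (int l * u) / of_int (144 * v)"
  proof -
    have "(of_nat (p\<^sup>2 * m) :: complex) = of_nat p ^ (2 + s) * of_nat l"
      by (simp add: l power_add power2_eq_square)
    thus ?thesis unfolding x C uv(1) using p0 by simp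
  qed
  have "algebraic (a (p\<^sup>2 * m) + of_nat p * a m)"
  proof -
    have "a (p\<^sup>2 * m) + of_nat p * a m = C' * (of_nat (p\<^sup>2 * m) * of_int u / of_int (144 * v))"
      unfolding x C uv(1) by simp
    thus ?thesis by (simp only:) (intro alg(1) Rats_divide Rats_mult; simp)
  qed
  moreover have "integral_at P ((a (p\<^sup>2 * m) + of_nat p * a m) / of_nat p ^ (2 + s))"
    if P: "prime_above p P" for P
  proof -
    have "\<not> p dvd 144"
    proof
      assume "p dvd 144"
      hence "p dvd 2 ^ 4 * 3 ^ 2" by simp
      hence "p dvd 2 \<or> p dvd 3" using p prime_dvd_mult_iff prime_dvd_power by blast
      thus False using \<open>p \<ge> 7\<close> by (auto dest!: dvd_imp_le)
    qed
    hence "\<not> int p dvd 144" by (metis int_dvd_int_iff of_nat_numeral)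
    hence "\<not> int p dvd 144 * v" using uv(2) p by (simp add: prime_dvd_mult_iff)
    hence "coprime (144 * v) (int p)" using p by (metis coprime_commute prime_imp_coprime prime_nat_int_transfer)
    hence "of_int (144 * v) \<notin> P" by (rule coprime_not_in_prime_above[OF P])
    moreover have "algebraic_int (C' * of_int (int l * u))" by (rule alg(2)) auto
    ultimately show ?thesis unfolding integral_at_def quotient
      by (intro exI[of _ "C' * of_int (int l * u)"] exI[of _ "of_int (144 * v)"])
        (auto intro!: int_imp_algebraic_int)
  qed
  ultimately show "alg_cong_0 (a (p\<^sup>2 * m) + of_nat p * a m) p (2 + multiplicity p m)"
    unfolding s_def[symmetric] by (simp add: alg_cong_0_def)
qed

end
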